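(* Let $V$ be a periodic semigroup variety. The following conditions are equivalent. (1) Any free semigroup of the variety $V$ is a subdirect product of completely 0-simple semigroups. (2) Any finitely generated free semigroup of the variety $V$ is a subdirect product of completely 0-simple semigroups. (3) Any semigroup of the variety $V$ is a subdirect product of completely 0-simple semigroups. (4) Any finitely generated semigroup of the variety $V$ is approximated by completely 0-simple semigroups of the variety $V$. (5) Any finite semigroup of the variety $V$ is approximated by completely 0-simple semigroups of the variety $V$. (6) Any finite semigroup of the variety $V$ is a subdirect product of completely 0-simple semigroups. (7) $V=\mathrm{qVar}(W)$ for some class $W$ of completely 0-simple semigroups. (8) $V$ is a Rees--Sushkevich variety and $N_{2}\notin V$. (9) For some positive integer $n$, the identities $x=x^{n+1}$ and $(axyb)^n=(ayxb)^n$ hold in $V$. (10) Any semigroup of $V$ is a normal band of groups. (11) $V$ does not contain any of the semigroups $N_{2}$, $S_0$, $S_{1l}$, $S_{2l}$, $S_{3l}$, $S_{1r}$, $S_{2r}$, $S_{3r}$, $L_2^1$, $R_2^1$.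
   Context: A semigroup is periodic if all its one-generated subsemigroups are finite; a variety is periodic if all its semigroups are periodic. A semigroup is 0-simple if it has no (nonempty two-sided) ideals except itself and possibly $\{0\}$. A 0-simple semigroup is completely 0-simple if it has a minimal nonzero idempotent (idempotents are ordered by $e\le f$ iff $ef=fe=e$). A semigroup is not required to have a zero here, so completely simple semigroups are included among completely 0-simple semigroups. A semigroup $S$ is approximated by semigroups of a class $C$ (residually $C$) if for any distinct $u,v\in S$ there are $T\in C$ and a homomorphism $f:S\to T$ with $f(u)\neq f(v)$. $\mathrm{qVar}(W)$ is the quasivariety of semigroups generated by $W$. A semigroup variety is called a Rees--Sushkevich variety if, for some positive integer $n$, it satisfies the identities $x^{2}=x^{n+2}$, $xyx=(xy)^{n+1}x$, $(xhz)^nxyz=xyz(xhz)^n$. A semigroup $S$ is a normal band of groups if it has a congruence $\theta$ all of whose classes are groups and such that $S/\theta$ is a normal band, i.e. satisfies $x^2=x$ and $axyb=ayxb$. Semigroups: $N_2=\{a,0\}$ with all products $0$. $S_{0}=\{a,b,c,0\}$ with $ab=ba=c$, all other products $0$. $S_{1l}=\{e,a,0\}$ with $e^{2}=e$, $ae=a$, all other products $0$. $S_{2l}=\{a,u,v,e,f,0\}$ with $ue=vf=ae=af=a$, $e^2=ef=e$, $f^2=fe=f$, all other products $0$. $S_{3l}=\{x,e,f,g\}$ with $yz=z$ for all $y,z\in S_{3l}$ with $z\neq x$, and $ex=fx=x^{2}=e$, $gx=f$. $S_{1r},S_{2r},S_{3r}$ are the semigroups anti-isomorphic to $S_{1l},S_{2l},S_{3l}$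 respectively. $L_2^1$ (resp. $R_2^1$) is the 2-element left zero (resp. right zero) semigroup with an identity element adjoined. *)

theory Defs
  imports "HOL-Algebra.Group" "HOL-Library.FuncSet" "HOL-Library.Infinite_Typeclass"
begin

section \<open>Semigroups with explicit carrier\<close>

record 'a sgrp = "'a partial_object" +
  mul :: "'a \<Rightarrow> 'a \<Rightarrow> 'a" (infixl \<open>\<odot>\<index>\<close> 70)

text \<open>Semigroups are nonempty.\<close>

definition is_semigroup :: "'a sgrp \<Rightarrow> bool" where
  "is_semigroup S \<longleftrightarrow> carrier S \<noteq> {} \<and>
     (\<forall>x\<in>carrier S. \<forall>y\<in>carrier S. x \<odot>\<^bsub>S\<^esub> y \<in> carrier S) \<and>
     (\<forall>x\<in>carrier S. \<forall>y\<in>carrier S. \<forall>z\<in>carrier S.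
        (x \<odot>\<^bsub>S\<^esub> y) \<odot>\<^bsub>S\<^esub> z = x \<odot>\<^bsub>S\<^esub> (y \<odot>\<^bsub>S\<^esub> z))"

definition sg_hom :: "'a sgrp \<Rightarrow> 'b sgrp \<Rightarrow> ('a \<Rightarrow> 'b) set" where
  "sg_hom S T = {h. h \<in> carrier S \<rightarrow> carrier T \<and>
     (\<forall>x\<in>carrier S. \<forall>y\<in>carrier S. h (x \<odot>\<^bsub>S\<^esub> y) = h x \<odot>\<^bsub>T\<^esub> h y)}"

definition sg_isomorphic :: "'a sgrp \<Rightarrow> 'b sgrp \<Rightarrow> bool" where
  "sg_isomorphic S T \<longleftrightarrow> (\<exists>h\<in>sg_hom S T. bij_betw h (carrier S) (carrier T))"

definition sg_opposite :: "'a sgrp \<Rightarrow> 'a sgrp" where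
  "sg_opposite S = \<lparr>carrier = carrier S, mul = (\<lambda>x y. y \<odot>\<^bsub>S\<^esub> x)\<rparr>"

inductive_set sg_generated :: "'a sgrp \<Rightarrow> 'a set \<Rightarrow> 'a set" for S and X where
  gen: "x \<in> X \<Longrightarrow> x \<in> sg_generated S X"
| mult: "x \<in> sg_generated S X \<Longrightarrow> y \<in> sg_generated S X \<Longrightarrow> x \<odot>\<^bsub>S\<^esub> y \<in> sg_generated S X"

definition finitely_generated :: "'a sgrp \<Rightarrow> bool" where
  "finitely_generated S \<longleftrightarrow>
     (\<exists>X. finite X \<and> X \<subseteq> carrier S \<and> sg_generated S X = carrier S)"

definition periodic :: "'a sgrp \<Rightarrow> bool" where
  "periodic S \<longleftrightarrow> (\<forall>x\<in>carrier S. finite (sg_generated S {x}))"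


section \<open>Completely 0-simple semigroups\<close>

definition is_ideal :: "'a sgrp \<Rightarrow> 'a set \<Rightarrow> bool" where
  "is_ideal S I \<longleftrightarrow> I \<subseteq> carrier S \<and> I \<noteq> {} \<and>
     (\<forall>i\<in>I. \<forall>s\<in>carrier S. s \<odot>\<^bsub>S\<^esub> i \<in> I \<and> i \<odot>\<^bsub>S\<^esub> s \<in> I)"

definition is_zero :: "'a sgrp \<Rightarrow> 'a \<Rightarrow> bool" where
  "is_zero S z \<longleftrightarrow> z \<in> carrier S \<and>
     (\<forall>s\<in>carrier S. s \<odot>\<^bsub>S\<^esub> z = z \<and> z \<odot>\<^bsub>S\<^esub> s = z)"

definition zero_simple :: "'a sgrp \<Rightarrow> bool" where
  "zero_simple S \<longleftrightarrow> is_semigroup S \<and>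
     (\<forall>I. is_ideal S I \<longrightarrow> I = carrier S \<or> (\<exists>z. is_zero S z \<and> I = {z}))"

definition idempotent_le :: "'a sgrp \<Rightarrow> 'a \<Rightarrow> 'a \<Rightarrow> bool" where
  "idempotent_le S e f \<longleftrightarrow> e \<odot>\<^bsub>S\<^esub> f = e \<and> f \<odot>\<^bsub>S\<^esub> e = e"

text \<open>
  The element of a one-element semigroup counts as nonzero, so that the trivial group is
  completely simple, hence completely 0-simple.
\<close>

definition nonzero_idempotents :: "'a sgrp \<Rightarrow> 'a set" where
  "nonzero_idempotents S =
     {e \<in> carrier S. e \<odot>\<^bsub>S\<^esub> e = e \<and> (is_zero S e \<longrightarrow> carrier S = {e})}"

definition completely_zero_simple :: "'a sgrp \<Rightarrow> bool" where
  "completely_zero_simple S \<longleftrightarrow> zero_simple S \<and>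
     (\<exists>e\<in>nonzero_idempotents S. \<forall>f\<in>nonzero_idempotents S. idempotent_le S f e \<longrightarrow> f = e)"


section \<open>Approximation and subdirect products\<close>

definition approximated_by :: "'a sgrp \<Rightarrow> 'b sgrp set \<Rightarrow> bool" where
  "approximated_by S C \<longleftrightarrow>
     (\<forall>u\<in>carrier S. \<forall>v\<in>carrier S. u \<noteq> v \<longrightarrow> (\<exists>T\<in>C. \<exists>f\<in>sg_hom S T. f u \<noteq> f v))"

definition sg_product :: "'i set \<Rightarrow> ('i \<Rightarrow> 'a sgrp) \<Rightarrow> ('i \<Rightarrow> 'a) sgrp" where
  "sg_product I T = \<lparr>carrier = (\<Pi>\<^sub>E i\<in>I. carrier (T i)),
                     mul = (\<lambda>f g. \<lambda>i\<in>I. f i \<odot>\<^bsub>T i\<^esub> g i)\<rparr>"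

text \<open>
  Up to isomorphism, all factors of a subdirect decomposition of \<open>S\<close> are quotients of \<open>S\<close>, and
  one factor for each pair of distinct points of \<open>S\<close> is enough. So taking factors over the type
  \<open>'a\<close> and index sets inside \<open>'a \<times> 'a\<close> is no restriction for isomorphism-closed \<open>C\<close>.
\<close>

definition subdirect_product_of :: "'a sgrp \<Rightarrow> 'a sgrp set \<Rightarrow> bool" where
  "subdirect_product_of S C \<longleftrightarrow>
     (\<exists>(I :: ('a \<times> 'a) set) T h.
        (\<forall>i\<in>I. T i \<in> C) \<and>
        h \<in> sg_hom S (sg_product I T) \<and> inj_on h (carrier S) \<and>
        (\<forall>i\<in>I. (\<lambda>s. h s i) ` carrier S = carrier (T i)))"


section \<open>Identities, varieties, quasivarieties\<close>

text \<open>
  Semigroup words are nonempty lists of variables; the identity \<open>p = q\<close> is the pair \<open>(p, q)\<close>.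
  The value of the empty list is irrelevant.
\<close>

type_synonym sg_word = "nat list"
type_synonym sg_identity = "sg_word \<times> sg_word"

definition word_pow :: "sg_word \<Rightarrow> nat \<Rightarrow> sg_word" where
  "word_pow w n = concat (replicate n w)"

definition sg_eval :: "'a sgrp \<Rightarrow> (nat \<Rightarrow> 'a) \<Rightarrow> sg_word \<Rightarrow> 'a" where
  "sg_eval S \<phi> w = foldl (\<lambda>s x. s \<odot>\<^bsub>S\<^esub> \<phi> x) (\<phi> (hd w)) (tl w)"

definition proper_identity :: "sg_identity \<Rightarrow> bool" where
  "proper_identity = (\<lambda>(p, q). p \<noteq> [] \<and> q \<noteq> [])"

definition holds_under :: "'a sgrp \<Rightarrow> (nat \<Rightarrow> 'a) \<Rightarrow> sg_identity \<Rightarrow> bool" where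
  "holds_under S \<phi> = (\<lambda>(p, q). sg_eval S \<phi> p = sg_eval S \<phi> q)"

definition satisfies :: "'a sgrp \<Rightarrow> sg_identity \<Rightarrow> bool" where
  "satisfies S \<epsilon> \<longleftrightarrow> (\<forall>\<phi> \<in> UNIV \<rightarrow> carrier S. holds_under S \<phi> \<epsilon>)"

text \<open>A quasi-identity is a finite list of premises together with a conclusion.\<close>

definition satisfies_quasi :: "'a sgrp \<Rightarrow> sg_identity list \<Rightarrow> sg_identity \<Rightarrow> bool" where
  "satisfies_quasi S \<Gamma> \<epsilon> \<longleftrightarrow>
     (\<forall>\<phi> \<in> UNIV \<rightarrow> carrier S. (\<forall>\<gamma>\<in>set \<Gamma>. holds_under S \<phi> \<gamma>) \<longrightarrow> holds_under S \<phi> \<epsilon>)"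

text \<open>
  Classes of semigroups are represented by sets of semigroups whose carriers lie in one type
  \<open>'u\<close>, the universe, which is infinite but otherwise arbitrary.
  Semigroups over other types are handled up to isomorphism. Freeness is
  tested against the members of \<open>V\<close> in the universe; as \<open>'u\<close> is infinite, every set of at most
  \<open>|'u|\<close> free generators has its free semigroup represented there. The set of free generators
  is required to be nonempty because semigroups are.
\<close>

definition variety :: "('u::infinite) sgrp set \<Rightarrow> bool" where
  "variety V \<longleftrightarrow> (\<exists>\<Sigma>. (\<forall>\<epsilon>\<in>\<Sigma>. proper_identity \<epsilon>) \<and>
     V = {S. is_semigroup S \<and> (\<forall>\<epsilon>\<in>\<Sigma>. satisfies S \<epsilon>)})"

definition qVar :: "('u::infinite) sgrp set \<Rightarrow> 'u sgrp set" where
  "qVar W = {S. is_semigroup S \<and>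
     (\<forall>\<Gamma> \<epsilon>. (\<forall>\<gamma>\<in>set \<Gamma>. proper_identity \<gamma>) \<and> proper_identity \<epsilon> \<and>
        (\<forall>T\<in>W. satisfies_quasi T \<Gamma> \<epsilon>) \<longrightarrow> satisfies_quasi S \<Gamma> \<epsilon>)}"

definition holds_in :: "('u::infinite) sgrp set \<Rightarrow> sg_identity \<Rightarrow> bool" where
  "holds_in V \<epsilon> \<longleftrightarrow> (\<forall>S\<in>V. satisfies S \<epsilon>)"

definition contains_copy :: "('u::infinite) sgrp set \<Rightarrow> 'b sgrp \<Rightarrow> bool" where
  "contains_copy V T \<longleftrightarrow> (\<exists>S\<in>V. sg_isomorphic S T)"

definition periodic_variety :: "('u::infinite) sgrp set \<Rightarrow> bool" where
  "periodic_variety V \<longleftrightarrow> variety V \<and> (\<forall>S\<in>V. periodic S)"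

definition free_on :: "('u::infinite) sgrp set \<Rightarrow> 'u sgrp \<Rightarrow> 'u set \<Rightarrow> bool" where
  "free_on V F X \<longleftrightarrow> F \<in> V \<and> X \<noteq> {} \<and> X \<subseteq> carrier F \<and>
     (\<forall>T\<in>V. \<forall>\<phi> \<in> X \<rightarrow> carrier T.
        \<exists>!h. h \<in> sg_hom F T \<and> h \<in> extensional (carrier F) \<and> (\<forall>x\<in>X. h x = \<phi> x))"

definition free_in :: "('u::infinite) sgrp set \<Rightarrow> 'u sgrp \<Rightarrow> bool" where
  "free_in V F \<longleftrightarrow> (\<exists>X. free_on V F X)"

definition rees_sushkevich :: "('u::infinite) sgrp set \<Rightarrow> bool" where
  "rees_sushkevich V \<longleftrightarrow> variety V \<and>
     (let x = 0; y = 1; z = 2; h = 3 in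
      \<exists>n>0. holds_in V ([x, x], word_pow [x] (n + 2)) \<and>
            holds_in V ([x, y, x], word_pow [x, y] (n + 1) @ [x]) \<and>
            holds_in V (word_pow [x, h, z] n @ [x, y, z], [x, y, z] @ word_pow [x, h, z] n))"


section \<open>Normal bands of groups\<close>

definition sg_congruence :: "'a sgrp \<Rightarrow> ('a \<times> 'a) set \<Rightarrow> bool" where
  "sg_congruence S \<theta> \<longleftrightarrow> equiv (carrier S) \<theta> \<and>
     (\<forall>(x, x')\<in>\<theta>. \<forall>(y, y')\<in>\<theta>. (x \<odot>\<^bsub>S\<^esub> y, x' \<odot>\<^bsub>S\<^esub> y') \<in> \<theta>)"

definition sg_quotient :: "'a sgrp \<Rightarrow> ('a \<times> 'a) set \<Rightarrow> 'a set sgrp" where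
  "sg_quotient S \<theta> = \<lparr>carrier = carrier S // \<theta>,
                     mul = (\<lambda>A B. \<Union>a\<in>A. \<Union>b\<in>B. \<theta> `` {a \<odot>\<^bsub>S\<^esub> b})\<rparr>"

definition normal_band :: "'a sgrp \<Rightarrow> bool" where
  "normal_band S \<longleftrightarrow> is_semigroup S \<and>
     (let a = 0; x = 1; y = 2; b = 3 in
      satisfies S ([x, x], [x]) \<and> satisfies S ([a, x, y, b], [a, y, x, b]))"

definition normal_band_of_groups :: "'a sgrp \<Rightarrow> bool" where
  "normal_band_of_groups S \<longleftrightarrow> is_semigroup S \<and>
     (\<exists>\<theta>. sg_congruence S \<theta> \<and>
        (\<forall>G \<in> carrier S // \<theta>. \<exists>e. group \<lparr>carrier = G, mult = mul S, one = e\<rparr>) \<and>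
        normal_band (sg_quotient S \<theta>))"


section \<open>Particular small semigroups\<close>

text \<open>\<open>E0\<close> is the zero and \<open>E1\<close> the adjoined identity.\<close>

datatype elt = E0 | E1 | Ea | Eb | Ec | Ee | Ef | Eg | Eu | Ev | Ex

definition N2 :: "elt sgrp" where
  "N2 = \<lparr>carrier = {Ea, E0}, mul = (\<lambda>_ _. E0)\<rparr>"

definition S0 :: "elt sgrp" where
  "S0 = \<lparr>carrier = {Ea, Eb, Ec, E0},
         mul = (\<lambda>p q. if (p, q) \<in> {(Ea, Eb), (Eb, Ea)} then Ec else E0)\<rparr>"

definition S1l :: "elt sgrp" where
  "S1l = \<lparr>carrier = {Ee, Ea, E0},
          mul = (\<lambda>p q. if (p, q) = (Ee, Ee) then Ee
                       else if (p, q) = (Ea, Ee) then Ea else E0)\<rparr>"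

definition S2l :: "elt sgrp" where
  "S2l = \<lparr>carrier = {Ea, Eu, Ev, Ee, Ef, E0},
          mul = (\<lambda>p q. if (p, q) \<in> {(Eu, Ee), (Ev, Ef), (Ea, Ee), (Ea, Ef)} then Ea
                       else if (p, q) \<in> {(Ee, Ee), (Ee, Ef)} then Ee
                       else if (p, q) \<in> {(Ef, Ef), (Ef, Ee)} then Ef else E0)\<rparr>"

definition S3l :: "elt sgrp" where
  "S3l = \<lparr>carrier = {Ex, Ee, Ef, Eg},
          mul = (\<lambda>p q. if q \<noteq> Ex then q else if p = Eg then Ef else Ee)\<rparr>"

definition S1r :: "elt sgrp" where "S1r = sg_opposite S1l"
definition S2r :: "elt sgrp" where "S2r = sg_opposite S2l"
definition S3r :: "elt sgrp" where "S3r = sg_opposite S3l"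

definition L21 :: "elt sgrp" where
  "L21 = \<lparr>carrier = {Ee, Ef, E1}, mul = (\<lambda>p q. if p = E1 then q else p)\<rparr>"

definition R21 :: "elt sgrp" where
  "R21 = \<lparr>carrier = {Ee, Ef, E1}, mul = (\<lambda>p q. if q = E1 then p else q)\<rparr>"


definition all_equivalent :: "bool list \<Rightarrow> bool" where
  "all_equivalent Ps \<longleftrightarrow> (\<forall>P\<in>set Ps. \<forall>Q\<in>set Ps. P \<longleftrightarrow> Q)"

end

theory Submission
  imports Defs "HOL-Library.Countable"
begin

text \<open>
  All eleven conditions are compared with the laws of condition (9). In terms of the idempotent
  \<open>x\<^sup>n\<close> of the subgroup containing \<open>x\<close>, the first law says that every semigroup of the variety is
  a union of groups, and the second that \<open>(a x y b)\<^sup>n\<close> does not depend on the order of \<open>x\<close> and \<open>y\<close>.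
  For a union of groups with bounded exponent the second law is equivalent to a local condition:
  idempotents below a common idempotent commute
  (\<open>locally_commuting_imp_permutes\<close>, \<open>permutes_imp_locally_commuting\<close>). The two tools
  for this are that the principal ideals of a union of groups form a semilattice (\<open>J_meet\<close>) and that
  periodic semigroups are stable (\<open>sandwich_cancel_right\<close>). The local condition makes an idempotent
  \<open>f\<close> in a given \<open>\<J>\<close>-class below a given idempotent \<open>e\<close> unique, so that an element of this
  class with left identity \<open>e\<close> and right identity \<open>e'\<close> is known up to the group containing it
  (\<open>idm_eq_of_common_identities\<close>). Equality of \<open>x\<^sup>n\<close> and \<open>y\<^sup>n\<close> is then the congruence
  of a normal band of groups, and the Rees--Sushkevich identities follow.

  The laws give completely 0-simple factors as follows. For an element \<open>c\<close>, collapse everything not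
  above \<open>c\<close> to zero and identify two elements above \<open>c\<close> when they multiply the \<open>\<J>\<close>-class of \<open>c\<close> in
  the same way. An element \<open>s\<close> above \<open>c\<close> acts like \<open>s f\<close>, where \<open>f\<close> is the idempotent of the class below
  \<open>s\<^sup>n\<close>, so the quotient is this \<open>\<J>\<close>-class, possibly with a zero adjoined. These quotients separate
  the points (\<open>separating_quotient\<close>) and belong to the variety, which gives subdirect
  decompositions, approximations, and generation as a quasivariety.

  Conversely, a completely 0-simple union of groups satisfies the second law, so the point is to show
  that the completely 0-simple semigroups at hand are unions of groups. An element outside all
  subgroups of a completely 0-simple semigroup has square zero and is regular, and then every identity
  \<open>x y = q\<close> of the semigroup is trivial; this puts \<open>S0\<close> into the variety
  (\<open>square_zero_regular_imp_S0\<close>). But \<open>S0\<close> violates a quasi-identity that holds in all periodic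
  completely 0-simple semigroups (\<open>completely_zero_simple_quasi_identity\<close>). For free
  semigroups, the one on a single generator has only monogenic quotients, and a completely 0-simple one
  among these is a group, which yields the first law directly.

  Finally, a variety without \<open>N2\<close> satisfies an identity with a single variable on one side, which gives
  the first law. A variety of unions of groups without \<open>L21\<close> and \<open>R21\<close> satisfies identities that fail in
  these two semigroups; substituting local idempotents into them shows that the idempotents commute
  (\<open>L21_identity_consequence\<close>). The other semigroups of condition (11) contain an element that is
  not in a subgroup, and the Rees--Sushkevich identities fail in \<open>L21\<close> and in \<open>R21\<close>.
\<close>


section \<open>Powers and values of words\<close>

text \<open>The value at exponent 0 is a dummy: semigroups need not have an identity.\<close>

primrec sg_pow :: "'a sgrp \<Rightarrow> 'a \<Rightarrow> nat \<Rightarrow> 'a" where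
  "sg_pow S x 0 = x"
| "sg_pow S x (Suc k) = (if k = 0 then x else sg_pow S x k \<odot>\<^bsub>S\<^esub> x)"

lemma range_mem: "\<phi> \<in> UNIV \<rightarrow> A \<Longrightarrow> \<phi> i \<in> A"
  by auto

locale semigrp =
  fixes S :: "'a sgrp" (structure)
  assumes semigroup: "is_semigroup S"
begin

lemma closed [simp, intro]: "x \<in> carrier S \<Longrightarrow> y \<in> carrier S \<Longrightarrow> x \<odot> y \<in> carrier S"
  using semigroup by (simp add: is_semigroup_def)

lemma assoc:
  "x \<in> carrier S \<Longrightarrow> y \<in> carrier S \<Longrightarrow> z \<in> carrier S \<Longrightarrow> x \<odot> y \<odot> z = x \<odot> (y \<odot> z)"
  using semigroup by (simp add: is_semigroup_def)

lemma pow_closed [simp, intro]: "x \<in> carrier S \<Longrightarrow> sg_pow S x k \<in> carrier S"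
  by (induction k) auto

lemma pow_add:
  assumes "x \<in> carrier S" "j > 0" "k > 0"
  shows "sg_pow S x (j + k) = sg_pow S x j \<odot> sg_pow S x k"
  using \<open>k > 0\<close>
proof (induction k)
  case (Suc k)
  then show ?case using assms by (cases "k = 0") (auto simp: assoc)
qed simp

lemma pow_pow:
  assumes "x \<in> carrier S" "j > 0" "k > 0"
  shows "sg_pow S (sg_pow S x j) k = sg_pow S x (j * k)"
  using \<open>k > 0\<close>
proof (induction k)
  case (Suc k)
  then show ?case using assms pow_add[of x "j * k" j]
    by (cases "k = 0") (auto simp: add.commute)
qed simp

lemma pow_swap:
  assumes "x \<in> carrier S" "y \<in> carrier S" "k > 0"
  shows "sg_pow S (x \<odot> y) (Suc k) = x \<odot> sg_pow S (y \<odot> x) k \<odot> y"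
  using \<open>k > 0\<close>
proof (induction k)
  case (Suc k)
  then show ?case using assms by (cases "k = 0") (auto simp: assoc)
qed simp

lemma pow_idempotent: "x \<odot> x = x \<Longrightarrow> sg_pow S x k = x"
  by (induction k) auto

lemma eval_closed [intro]:
  assumes "\<phi> \<in> UNIV \<rightarrow> carrier S"
  shows "sg_eval S \<phi> w \<in> carrier S"
proof -
  have "s \<in> carrier S \<Longrightarrow> foldl (\<lambda>s x. s \<odot> \<phi> x) s xs \<in> carrier S" for s xs
    using range_mem[OF assms] by (induction xs arbitrary: s) auto
  then show ?thesis using assms by (auto simp: sg_eval_def)
qed

end

lemma eval_single [simp]: "sg_eval S \<phi> [x] = \<phi> x"
  by (simp add: sg_eval_def)

lemma eval_snoc: "w \<noteq> [] \<Longrightarrow> sg_eval S \<phi> (w @ [x]) = sg_eval S \<phi> w \<odot>\<^bsub>S\<^esub> \<phi> x"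
  by (simp add: sg_eval_def)

lemma nonempty_snoc_induct [consumes 1, case_names single snoc]:
  assumes "w \<noteq> []" and "\<And>x. P [x]" and "\<And>w x. w \<noteq> [] \<Longrightarrow> P w \<Longrightarrow> P (w @ [x])"
  shows "P w"
  using assms(1)
proof (induction w rule: rev_induct)
  case (snoc x w)
  then show ?case using assms(2,3) by (cases "w = []") auto
qed simp

lemma eval_cong:
  assumes "w \<noteq> []" "\<And>i. i \<in> set w \<Longrightarrow> \<phi> i = \<psi> i"
  shows "sg_eval S \<phi> w = sg_eval S \<psi> w"
  using assms by (induction w rule: nonempty_snoc_induct) (auto simp: eval_snoc)

lemma (in semigrp) eval_append:
  assumes "\<phi> \<in> UNIV \<rightarrow> carrier S" "u \<noteq> []" "v \<noteq> []"
  shows "sg_eval S \<phi> (u @ v) = sg_eval S \<phi> u \<odot> sg_eval S \<phi> v"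
  using \<open>v \<noteq> []\<close>
proof (induction v rule: nonempty_snoc_induct)
  case (single x)
  then show ?case using assms(2) by (simp add: eval_snoc)
next
  case (snoc w x)
  have "sg_eval S \<phi> (u @ w @ [x]) = sg_eval S \<phi> (u @ w) \<odot> \<phi> x"
    using eval_snoc[of "u @ w"] assms(2) by simp
  then show ?case using snoc assms(1) by (simp add: eval_snoc assoc eval_closed range_mem[OF assms(1)])
qed

lemma word_pow_Suc: "word_pow w (Suc k) = word_pow w k @ w"
  by (induction k) (auto simp: word_pow_def)

lemma word_pow_eq_Nil: "word_pow w k = [] \<longleftrightarrow> w = [] \<or> k = 0"
  by (cases k) (auto simp: word_pow_def)

lemma (in semigrp) eval_word_pow:
  assumes "\<phi> \<in> UNIV \<rightarrow> carrier S" "w \<noteq> []" "k > 0"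
  shows "sg_eval S \<phi> (word_pow w k) = sg_pow S (sg_eval S \<phi> w) k"
  using \<open>k > 0\<close>
proof (induction k)
  case (Suc k)
  then show ?case using assms eval_append[OF assms(1), of "word_pow w k" w]
    by (cases "k = 0") (auto simp: word_pow_Suc word_pow_eq_Nil, simp add: word_pow_def)
qed simp

lemma eval_const: "w \<noteq> [] \<Longrightarrow> sg_eval S (\<lambda>_. x) w = sg_pow S x (length w)"
  by (induction w rule: nonempty_snoc_induct) (auto simp: eval_snoc)


section \<open>Homomorphisms and images\<close>

lemma hom_closed: "h \<in> sg_hom S T \<Longrightarrow> x \<in> carrier S \<Longrightarrow> h x \<in> carrier T"
  by (auto simp: sg_hom_def)

lemma hom_mult:
  "h \<in> sg_hom S T \<Longrightarrow> x \<in> carrier S \<Longrightarrow> y \<in> carrier S \<Longrightarrow> h (x \<odot>\<^bsub>S\<^esub> y) = h x \<odot>\<^bsub>T\<^esub> h y"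
  by (auto simp: sg_hom_def)

lemma hom_comp: "g \<in> sg_hom S T \<Longrightarrow> h \<in> sg_hom T U \<Longrightarrow> h \<circ> g \<in> sg_hom S U"
  by (auto simp: sg_hom_def Pi_iff)

lemma hom_eval:
  assumes "is_semigroup S" "h \<in> sg_hom S T" "\<phi> \<in> UNIV \<rightarrow> carrier S"
  shows "h (sg_eval S \<phi> w) = sg_eval T (h \<circ> \<phi>) w"
proof -
  interpret semigrp S by unfold_locales fact
  show ?thesis
  proof (cases "w = []")
    case False
    then show ?thesis using assms
      by (induction w rule: nonempty_snoc_induct)
         (auto simp: eval_snoc hom_mult eval_closed range_mem[OF assms(3)])
  qed (simp add: sg_eval_def)
qed

lemma hom_pow:
  assumes "is_semigroup S" "h \<in> sg_hom S T" "x \<in> carrier S"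
  shows "h (sg_pow S x k) = sg_pow T (h x) k"
proof -
  interpret semigrp S by unfold_locales fact
  show ?thesis using assms by (induction k) (auto simp: hom_mult)
qed

lemma surjective_hom_lift:
  assumes "h ` carrier S = carrier T" "\<phi> \<in> UNIV \<rightarrow> carrier T"
  obtains \<sigma> where "\<sigma> \<in> UNIV \<rightarrow> carrier S" "\<phi> = h \<circ> \<sigma>"
proof -
  have "\<phi> i \<in> h ` carrier S" for i using assms by auto
  then have "\<forall>i. \<exists>s\<in>carrier S. h s = \<phi> i" by (metis imageE)
  then obtain \<sigma> where "\<forall>i. \<sigma> i \<in> carrier S \<and> h (\<sigma> i) = \<phi> i" by metis
  then show thesis by (intro that[of \<sigma>]) auto
qed

lemma satisfies_surjective_image:
  assumes "is_semigroup S" "h \<in> sg_hom S T" "h ` carrier S = carrier T" "satisfies S \<epsilon>"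
  shows "satisfies T \<epsilon>"
  unfolding satisfies_def
proof
  fix \<phi> :: "nat \<Rightarrow> _" assume "\<phi> \<in> UNIV \<rightarrow> carrier T"
  then obtain \<sigma> where \<sigma>: "\<sigma> \<in> UNIV \<rightarrow> carrier S" "\<phi> = h \<circ> \<sigma>"
    using surjective_hom_lift[OF assms(3)] by metis
  show "holds_under T \<phi> \<epsilon>"
    using assms(4) \<sigma> hom_eval[OF assms(1,2) \<sigma>(1), symmetric]
    by (auto simp: satisfies_def holds_under_def split: prod.splits)
qed

text \<open>
  The image of a semigroup under a map of sets whose kernel is a congruence, with the multiplication
  carried over. Quotients, free semigroups and isomorphic copies inside a prescribed type are
  all obtained in this way.
\<close>

definition sg_image :: "'a sgrp \<Rightarrow> ('a \<Rightarrow> 'b) \<Rightarrow> 'b sgrp" where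
  "sg_image S r = \<lparr>carrier = r ` carrier S,
     mul = (\<lambda>a b. r (inv_into (carrier S) r a \<odot>\<^bsub>S\<^esub> inv_into (carrier S) r b))\<rparr>"

definition kernel_congruence :: "'a sgrp \<Rightarrow> ('a \<Rightarrow> 'b) \<Rightarrow> bool" where
  "kernel_congruence S r \<longleftrightarrow>
     (\<forall>x\<in>carrier S. \<forall>x'\<in>carrier S. \<forall>y\<in>carrier S. \<forall>y'\<in>carrier S.
        r x = r x' \<longrightarrow> r y = r y' \<longrightarrow> r (x \<odot>\<^bsub>S\<^esub> y) = r (x' \<odot>\<^bsub>S\<^esub> y'))"

lemma carrier_sg_image [simp]: "carrier (sg_image S r) = r ` carrier S"
  by (simp add: sg_image_def)

lemma sg_image_hom:
  assumes "kernel_congruence S r"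
  shows "r \<in> sg_hom S (sg_image S r)"
proof -
  have "r (x \<odot>\<^bsub>S\<^esub> y) = r x \<odot>\<^bsub>sg_image S r\<^esub> r y" if "x \<in> carrier S" "y \<in> carrier S" for x y
  proof -
    let ?i = "inv_into (carrier S) r"
    have "?i (r x) \<in> carrier S" "?i (r y) \<in> carrier S" "r (?i (r x)) = r x" "r (?i (r y)) = r y"
      using that by (auto intro: inv_into_into f_inv_into_f)
    then have "r (x \<odot>\<^bsub>S\<^esub> y) = r (?i (r x) \<odot>\<^bsub>S\<^esub> ?i (r y))"
      using assms that unfolding kernel_congruence_def by metis
    then show ?thesis by (simp add: sg_image_def)
  qed
  then show ?thesis by (auto simp: sg_hom_def)
qed

lemma semigroup_surjective_image:
  assumes "is_semigroup S" "h \<in> sg_hom S T" "h ` carrier S = carrier T"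
  shows "is_semigroup T"
proof -
  interpret semigrp S by unfold_locales fact
  have lift: "\<exists>x\<in>carrier S. a = h x" if "a \<in> carrier T" for a
    using that assms(3) by (metis imageE)
  have "carrier T \<noteq> {}" using assms(3) semigroup by (auto simp: is_semigroup_def)
  moreover have "a \<odot>\<^bsub>T\<^esub> b \<in> carrier T" if "a \<in> carrier T" "b \<in> carrier T" for a b
  proof -
    from that assms(3) obtain x y where "x \<in> carrier S" "y \<in> carrier S" "a = h x" "b = h y"
      by (metis imageE)
    then show ?thesis using hom_mult[OF assms(2), of x y] hom_closed[OF assms(2)] by (metis closed)
  qed
  moreover have "a \<odot>\<^bsub>T\<^esub> b \<odot>\<^bsub>T\<^esub> c = a \<odot>\<^bsub>T\<^esub> (b \<odot>\<^bsub>T\<^esub> c)"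
    if abc: "a \<in> carrier T" "b \<in> carrier T" "c \<in> carrier T" for a b c
  proof -
    obtain x where x: "x \<in> carrier S" "a = h x" using lift[OF abc(1)] by blast
    obtain y where y: "y \<in> carrier S" "b = h y" using lift[OF abc(2)] by blast
    obtain z where z: "z \<in> carrier S" "c = h z" using lift[OF abc(3)] by blast
    note * = x y z
    have "h (x \<odot>\<^bsub>S\<^esub> y \<odot>\<^bsub>S\<^esub> z) = h (x \<odot>\<^bsub>S\<^esub> (y \<odot>\<^bsub>S\<^esub> z))" using * by (simp add: assoc)
    then show ?thesis using * by (simp add: hom_mult[OF assms(2)])
  qed
  ultimately show ?thesis by (simp add: is_semigroup_def)
qed

lemma isomorphic_imp_embedding:
  assumes "sg_isomorphic S T" "is_semigroup S"
  obtains g where "g \<in> sg_hom T S" "bij_betw g (carrier T) (carrier S)"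
proof -
  interpret semigrp S by unfold_locales fact
  obtain h where h: "h \<in> sg_hom S T" "bij_betw h (carrier S) (carrier T)"
    using assms(1) by (auto simp: sg_isomorphic_def)
  let ?g = "inv_into (carrier S) h"
  have g: "bij_betw ?g (carrier T) (carrier S)" using h(2) by (rule bij_betw_inv_into)
  have "?g (x \<odot>\<^bsub>T\<^esub> y) = ?g x \<odot>\<^bsub>S\<^esub> ?g y" if "x \<in> carrier T" "y \<in> carrier T" for x y
  proof -
    have *: "?g x \<in> carrier S" "?g y \<in> carrier S" using g that by (auto simp: bij_betw_def)
    have "h (?g x \<odot>\<^bsub>S\<^esub> ?g y) = x \<odot>\<^bsub>T\<^esub> y"
      using hom_mult[OF h(1) *] that h(2) by (simp add: bij_betw_inv_into_right)
    then show ?thesis using h(2) * by (metis bij_betw_inv_into_left closed)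
  qed
  then have "?g \<in> sg_hom T S" using g by (auto simp: sg_hom_def bij_betw_def)
  with g that show thesis by blast
qed



section \<open>Periodic semigroups\<close>

lemma semigroup_opposite: "is_semigroup S \<Longrightarrow> is_semigroup (sg_opposite S)"
  by (simp add: is_semigroup_def sg_opposite_def)

lemma carrier_opposite [simp]: "carrier (sg_opposite S) = carrier S"
  by (simp add: sg_opposite_def)

lemma mul_opposite [simp]: "x \<odot>\<^bsub>sg_opposite S\<^esub> y = y \<odot>\<^bsub>S\<^esub> x"
  by (simp add: sg_opposite_def)

lemma (in semigrp) pow_opposite:
  assumes "x \<in> carrier S"
  shows "sg_pow (sg_opposite S) x k = sg_pow S x k"
proof (induction k)
  case (Suc k)
  then show ?case using assms pow_add[of x 1 k] by auto
qed simp

definition satisfies_power_law :: "'a sgrp \<Rightarrow> nat \<Rightarrow> nat \<Rightarrow> bool" where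
  "satisfies_power_law S m n \<longleftrightarrow> (\<forall>x\<in>carrier S. sg_pow S x (m + n) = sg_pow S x m)"

locale periodic_semigrp = semigrp +
  fixes m n :: nat
  assumes m_pos: "m > 0" and n_pos: "n > 0" and power_law: "satisfies_power_law S m n"
begin

lemma pow_periodic: "x \<in> carrier S \<Longrightarrow> sg_pow S x (m + n) = sg_pow S x m"
  using power_law by (simp add: satisfies_power_law_def)

lemma opposite_periodic: "periodic_semigrp (sg_opposite S) m n"
proof -
  have "satisfies_power_law (sg_opposite S) m n"
    using pow_periodic by (simp add: satisfies_power_law_def pow_opposite)
  then show ?thesis
    by unfold_locales (use semigroup m_pos n_pos in \<open>auto simp: semigroup_opposite\<close>)
qed

lemma sandwich_pow:
  assumes "a \<in> carrier S" "u \<in> carrier S" "c \<in> carrier S" "a = u \<odot> a \<odot> c" "k > 0"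
  shows "a = sg_pow S u k \<odot> a \<odot> sg_pow S c k"
  using \<open>k > 0\<close>
proof (induction k)
  case (Suc k)
  show ?case
  proof (cases "k = 0")
    case False
    then have "a = sg_pow S u k \<odot> (u \<odot> a \<odot> c) \<odot> sg_pow S c k"
      using Suc assms(4) by simp
    also have "\<dots> = (sg_pow S u k \<odot> u) \<odot> a \<odot> (c \<odot> sg_pow S c k)"
      using assms(1-3) by (simp add: assoc)
    also have "c \<odot> sg_pow S c k = sg_pow S c (Suc k)"
      using pow_add[of c 1 k] assms False by simp
    finally show ?thesis using False by simp
  qed (use assms in simp)
qed simp

text \<open>
  Stability: iterating \<open>a = u a c\<close> brings the power \<open>c\<^sup>m\<close> to the right of \<open>a\<close>, and
  periodicity turns it into \<open>c\<^sup>m\<^sup>+\<^sup>n\<close>. So \<open>a = a c\<^sup>n\<close>: multiplication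
  by \<open>c\<close> on the right can be undone.
\<close>

lemma sandwich_cancel_right:
  assumes "a \<in> carrier S" "u \<in> carrier S" "c \<in> carrier S" "a = u \<odot> a \<odot> c"
  shows "\<exists>d\<in>carrier S. a = a \<odot> c \<odot> d"
proof -
  have "a = sg_pow S u m \<odot> a \<odot> sg_pow S c m"
    using sandwich_pow[OF assms m_pos] .
  also have "sg_pow S c m = sg_pow S c m \<odot> sg_pow S c n"
    using pow_periodic[OF assms(3)] pow_add[OF assms(3) m_pos n_pos] by simp
  also have "sg_pow S u m \<odot> a \<odot> \<dots> = (sg_pow S u m \<odot> a \<odot> sg_pow S c m) \<odot> sg_pow S c n"
    using assms by (simp add: assoc)
  finally have *: "a = a \<odot> sg_pow S c n"
    using sandwich_pow[OF assms m_pos] by simp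
  have "a = a \<odot> (sg_pow S c n \<odot> sg_pow S c n)"
    using * assms by (metis assoc pow_closed)
  also have "sg_pow S c n \<odot> sg_pow S c n = c \<odot> sg_pow S c (2 * n - 1)"
    using pow_add[of c n n] pow_add[of c 1 "2 * n - 1"] assms n_pos by simp
      (metis One_nat_def Suc_pred mult_2 nat_0_less_mult_iff pos2)
  finally show ?thesis using assms by (metis assoc pow_closed)
qed

lemma sandwich_cancel_left:
  assumes "a \<in> carrier S" "u \<in> carrier S" "c \<in> carrier S" "a = c \<odot> a \<odot> u"
  shows "\<exists>d\<in>carrier S. a = d \<odot> c \<odot> a"
proof -
  interpret op: periodic_semigrp "sg_opposite S" m n by (rule opposite_periodic)
  show ?thesis using op.sandwich_cancel_right[of a u c] assms by (auto simp: assoc)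
qed

end


section \<open>Semigroups satisfying \<open>x = x\<^sup>n\<^sup>+\<^sup>1\<close>\<close>

text \<open>
  No identity is adjoined: in a semigroup with \<open>x = x\<^sup>n\<^sup>+\<^sup>1\<close> every \<open>b\<close> lies in \<open>S b S\<close>, so this is
  the usual order of principal ideals.
\<close>

definition J_below :: "'a sgrp \<Rightarrow> 'a \<Rightarrow> 'a \<Rightarrow> bool" where
  "J_below S a b \<longleftrightarrow> (\<exists>u\<in>carrier S. \<exists>v\<in>carrier S. a = u \<odot>\<^bsub>S\<^esub> b \<odot>\<^bsub>S\<^esub> v)"

text \<open>
  For a union of groups this says that every local submonoid \<open>e S e\<close> is a semilattice of groups.
\<close>

definition locally_commuting :: "'a sgrp \<Rightarrow> bool" where
  "locally_commuting S \<longleftrightarrow>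
     (\<forall>e\<in>carrier S. \<forall>f\<in>carrier S. \<forall>g\<in>carrier S.
        e \<odot>\<^bsub>S\<^esub> e = e \<longrightarrow> f \<odot>\<^bsub>S\<^esub> f = f \<longrightarrow> g \<odot>\<^bsub>S\<^esub> g = g \<longrightarrow>
        idempotent_le S f e \<longrightarrow> idempotent_le S g e \<longrightarrow> f \<odot>\<^bsub>S\<^esub> g = g \<odot>\<^bsub>S\<^esub> f)"

definition permutes_inner_factors :: "'a sgrp \<Rightarrow> nat \<Rightarrow> bool" where
  "permutes_inner_factors S n \<longleftrightarrow>
     (\<forall>a\<in>carrier S. \<forall>x\<in>carrier S. \<forall>y\<in>carrier S. \<forall>b\<in>carrier S.
        sg_pow S (a \<odot>\<^bsub>S\<^esub> x \<odot>\<^bsub>S\<^esub> y \<odot>\<^bsub>S\<^esub> b) n = sg_pow S (a \<odot>\<^bsub>S\<^esub> y \<odot>\<^bsub>S\<^esub> x \<odot>\<^bsub>S\<^esub> b) n)"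

locale cr_semigrp = semigrp +
  fixes n :: nat
  assumes exponent_pos: "n > 0" and cr_law: "satisfies_power_law S 1 n"

sublocale cr_semigrp \<subseteq> periodic_semigrp S 1 n
  by unfold_locales (use exponent_pos cr_law in auto)

context cr_semigrp
begin

text \<open>The identity of the maximal subgroup that contains \<open>x\<close>.\<close>

abbreviation idm :: "'a \<Rightarrow> 'a" where "idm x \<equiv> sg_pow S x n"

lemma opposite_cr: "cr_semigrp (sg_opposite S) n"
proof -
  interpret op: periodic_semigrp "sg_opposite S" 1 n by (rule opposite_periodic)
  show ?thesis by unfold_locales (use exponent_pos op.power_law in auto)
qed

lemma idm_left [simp]: "x \<in> carrier S \<Longrightarrow> idm x \<odot> x = x"
  using pow_periodic[of x] exponent_pos by auto

lemma idm_right [simp]: "x \<in> carrier S \<Longrightarrow> x \<odot> idm x = x"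
  using pow_periodic[of x] pow_add[of x 1 n] exponent_pos by auto

lemma idm_factor:
  assumes "x \<in> carrier S"
  shows "\<exists>d\<in>carrier S. idm x = x \<odot> d \<and> idm x = d \<odot> x"
proof -
  have "idm x \<odot> idm x = idm x"
  proof (cases "n = 1")
    case True
    then show ?thesis using idm_left[OF assms] by simp
  next
    case False
    then have "idm x = x \<odot> sg_pow S x (n - 1)"
      using pow_add[of x 1 "n - 1"] assms exponent_pos by simp
    then show ?thesis using assms by (metis assoc idm_left pow_closed)
  qed
  then have "idm x = sg_pow S x (n + n)" using pow_add[of x n n] assms exponent_pos by simp
  \<comment> \<open>The exponent \<open>2 n - 1\<close>, unlike \<open>n - 1\<close>, is positive also for \<open>n = 1\<close>.\<close>
  also have "n + n = 1 + (2 * n - 1)" using exponent_pos by simp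
  finally have 1: "idm x = sg_pow S x (1 + (2 * n - 1))" .
  then have "idm x = x \<odot> sg_pow S x (2 * n - 1)"
    using pow_add[of x 1 "2 * n - 1"] assms exponent_pos by simp
  moreover have "idm x = sg_pow S x (2 * n - 1) \<odot> x"
    using 1 pow_add[of x "2 * n - 1" 1] assms exponent_pos by (simp add: add.commute)
  ultimately show ?thesis using assms by blast
qed

lemma idm_idempotent [simp]: "x \<in> carrier S \<Longrightarrow> idm x \<odot> idm x = idm x"
  using idm_factor[of x] by (metis assoc idm_left pow_closed)

lemma idm_absorb_right: "a \<in> carrier S \<Longrightarrow> x \<in> carrier S \<Longrightarrow> x \<odot> a = x \<Longrightarrow> idm x \<odot> a = idm x"
  using idm_factor[of x] by (metis assoc)

lemma idm_absorb_left: "a \<in> carrier S \<Longrightarrow> x \<in> carrier S \<Longrightarrow> a \<odot> x = x \<Longrightarrow> a \<odot> idm x = idm x"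
  using idm_factor[of x] by (metis assoc)

lemma J_refl: "x \<in> carrier S \<Longrightarrow> J_below S x x"
  unfolding J_below_def by (metis idm_left idm_right pow_closed)

lemma J_trans:
  assumes "J_below S a b" "J_below S b c" "c \<in> carrier S"
  shows "J_below S a c"
proof -
  obtain u v r t where uv: "u \<in> carrier S" "v \<in> carrier S" "a = u \<odot> b \<odot> v"
    and rt: "r \<in> carrier S" "t \<in> carrier S" "b = r \<odot> c \<odot> t"
    using assms(1,2) unfolding J_below_def by blast
  then have "a = (u \<odot> r) \<odot> c \<odot> (t \<odot> v)" using assms(3) by (simp add: assoc)
  with uv rt show ?thesis unfolding J_below_def by blast
qed

lemma J_mult_left:
  assumes "a \<in> carrier S" "b \<in> carrier S" shows "J_below S (a \<odot> b) a"
proof -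
  have "a \<odot> b = idm a \<odot> a \<odot> b" using assms by simp
  then show ?thesis using assms unfolding J_below_def by blast
qed

lemma J_mult_right:
  assumes "a \<in> carrier S" "b \<in> carrier S" shows "J_below S (a \<odot> b) b"
proof -
  have "a \<odot> b = a \<odot> b \<odot> idm b" using assms by (simp add: assoc)
  then show ?thesis using assms unfolding J_below_def by blast
qed

lemma J_idm: "x \<in> carrier S \<Longrightarrow> J_below S (idm x) x" "x \<in> carrier S \<Longrightarrow> J_below S x (idm x)"
  using idm_factor[of x] J_mult_left[of x] J_mult_left[of "idm x" x] by auto

lemma J_swap:
  assumes "a \<in> carrier S" "b \<in> carrier S"
  shows "J_below S (a \<odot> b) (b \<odot> a)"
proof -
  obtain d where d: "d \<in> carrier S" "idm (b \<odot> a) = b \<odot> a \<odot> d"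
    using idm_factor assms by blast
  have "a \<odot> b = a \<odot> idm (b \<odot> a) \<odot> b"
    using pow_periodic[of "a \<odot> b"] pow_swap[OF assms exponent_pos] assms by simp
  also have "\<dots> = a \<odot> (b \<odot> a) \<odot> (d \<odot> b)" using assms d by (simp add: assoc)
  finally show ?thesis using assms d unfolding J_below_def by blast
qed

text \<open>
  The principal ideals form a semilattice: the ideal of \<open>a b\<close> is the intersection of those of
  \<open>a\<close> and \<open>b\<close>. The square of a common element \<open>z = u a v = r b t\<close> contains \<open>b t u a\<close>, a
  cyclic shift of a multiple of \<open>a b\<close>, and \<open>z\<close> lies in the ideal of its square.
\<close>

lemma J_meet:
  assumes "a \<in> carrier S" "b \<in> carrier S" "J_below S z a" "J_below S z b"
  shows "J_below S z (a \<odot> b)"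
proof -
  obtain u v r t where uv: "u \<in> carrier S" "v \<in> carrier S" "z = u \<odot> a \<odot> v"
    and rt: "r \<in> carrier S" "t \<in> carrier S" "z = r \<odot> b \<odot> t"
    using assms(3,4) unfolding J_below_def by blast
  then have z: "z \<in> carrier S" using assms by simp
  obtain d where d: "d \<in> carrier S" "idm z = z \<odot> d" using idm_factor z by blast
  have "z = z \<odot> (z \<odot> d)" using z d by (metis idm_right)
  also have "\<dots> = (r \<odot> b \<odot> t) \<odot> ((u \<odot> a \<odot> v) \<odot> d)" using uv(3) rt(3) by simp
  also have "\<dots> = r \<odot> ((b \<odot> (t \<odot> u)) \<odot> a) \<odot> (v \<odot> d)"
    using assms(1,2) uv(1,2) rt(1,2) d by (simp add: assoc)
  finally have "J_below S z ((b \<odot> (t \<odot> u)) \<odot> a)"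
    unfolding J_below_def using uv rt d by blast
  moreover have "J_below S ((b \<odot> (t \<odot> u)) \<odot> a) (a \<odot> (b \<odot> (t \<odot> u)))"
    using J_swap assms uv rt by simp
  moreover have "J_below S (a \<odot> (b \<odot> (t \<odot> u))) (a \<odot> b)"
    using J_mult_left[of "a \<odot> b" "t \<odot> u"] assms uv rt by (simp add: assoc)
  ultimately show ?thesis using J_trans assms uv rt by (meson closed)
qed

lemma J_below_mult_iff:
  assumes "a \<in> carrier S" "b \<in> carrier S"
  shows "J_below S z (a \<odot> b) \<longleftrightarrow> J_below S z a \<and> J_below S z b"
  using J_meet J_trans J_mult_left J_mult_right assms by meson

lemma stable_right:
  assumes "a \<in> carrier S" "c \<in> carrier S" "J_below S a (a \<odot> c)"
  shows "\<exists>d\<in>carrier S. a = a \<odot> c \<odot> d"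
proof -
  obtain u v where uv: "u \<in> carrier S" "v \<in> carrier S" "a = u \<odot> (a \<odot> c) \<odot> v"
    using assms(3) unfolding J_below_def by blast
  then have "a = u \<odot> a \<odot> (c \<odot> v)" using assms by (simp add: assoc)
  then obtain d where "d \<in> carrier S" "a = a \<odot> (c \<odot> v) \<odot> d"
    using sandwich_cancel_right[of a u "c \<odot> v"] assms uv by auto
  then have "a = a \<odot> c \<odot> (v \<odot> d)" "v \<odot> d \<in> carrier S" using assms uv by (simp_all add: assoc)
  then show ?thesis by blast
qed

lemma J_opposite: "a \<in> carrier S \<Longrightarrow> b \<in> carrier S \<Longrightarrow> J_below (sg_opposite S) a b \<longleftrightarrow> J_below S a b"
  unfolding J_below_def by (auto simp: assoc)

lemma stable_left:
  assumes "a \<in> carrier S" "c \<in> carrier S" "J_below S a (c \<odot> a)"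
  shows "\<exists>d\<in>carrier S. a = d \<odot> c \<odot> a"
proof -
  interpret op: cr_semigrp "sg_opposite S" n by (rule opposite_cr)
  show ?thesis using op.stable_right[of a c] assms J_opposite[of a "c \<odot> a"] by (auto simp: assoc)
qed

lemma idm_eqI:
  assumes "s \<in> carrier S" "t \<in> carrier S"
    and "p \<in> carrier S" "s = t \<odot> p" and "q \<in> carrier S" "t = q \<odot> s"
  shows "idm s = idm t"
proof -
  have "idm t \<odot> s = s" using assms by (metis assoc idm_left pow_closed)
  then have 1: "idm t \<odot> idm s = idm s" by (intro idm_absorb_left assms pow_closed)
  have "t \<odot> idm s = t" using assms by (metis assoc idm_right pow_closed)
  then have "idm t \<odot> idm s = idm t" by (intro idm_absorb_right assms pow_closed)
  with 1 show ?thesis by simp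
qed

text \<open>
  The product of commuting idempotents lies below both, and by stability no idempotent lies strictly
  below another one of its \<open>\<J>\<close>-class.
\<close>

lemma primitive_in_J:
  assumes "f \<in> carrier S" "g \<in> carrier S" "f \<odot> g = g \<odot> f"
    and "J_below S f g" "J_below S g f" "f \<odot> f = f" "g \<odot> g = g"
  shows "f = g"
proof -
  have *: "f \<odot> g = f" if h: "f \<in> carrier S" "g \<in> carrier S" "f \<odot> g = g \<odot> f" "J_below S f g" "f \<odot> f = f"
      "g \<odot> g = g" for f g
  proof -
    have "J_below S f (f \<odot> g)" using h J_refl J_meet by blast
    then obtain d where d: "d \<in> carrier S" "f = f \<odot> g \<odot> d" using stable_right h by blast
    have "f = g \<odot> (f \<odot> d)" using h(1-3) d by (metis assoc)
    then have "g \<odot> f = f" using h(1,2,6) d by (metis assoc closed)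
    with h(3) show ?thesis by simp
  qed
  show ?thesis using *[of f g] *[of g f] assms by metis
qed

lemma local_idempotent_unique:
  assumes LC: "locally_commuting S"
    and "e \<in> carrier S" "f \<in> carrier S" "g \<in> carrier S"
    and "e \<odot> e = e" "f \<odot> f = f" "g \<odot> g = g"
    and "idempotent_le S f e" "idempotent_le S g e" "J_below S f g" "J_below S g f"
  shows "f = g"
proof (rule primitive_in_J)
  show "f \<odot> g = g \<odot> f" using LC assms(2-9) unfolding locally_commuting_def by blast
qed (use assms in auto)

text \<open>
  Inside a \<open>\<J>\<close>-class, \<open>s\<close> and \<open>t\<close> with a common left identity \<open>e\<close> generate the same right
  ideal: the idempotents of \<open>s e\<close> and of \<open>t e\<close> lie below \<open>e\<close> in the same \<open>\<J>\<close>-class, so they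
  coincide.
\<close>

lemma common_left_identity:
  assumes LC: "locally_commuting S"
    and e: "e \<in> carrier S" "e \<odot> e = e"
    and s: "s \<in> carrier S" "e \<odot> s = s" and t: "t \<in> carrier S" "e \<odot> t = t"
    and J: "J_below S s t" "J_below S t s"
  shows "\<exists>p\<in>carrier S. s = t \<odot> p"
proof -
  have se: "J_below S s (s \<odot> e)" if "s \<in> carrier S" "e \<odot> s = s" for s
    using that e J_meet[of s e s] J_refl J_mult_left[of e s] by simp
  have le: "idempotent_le S (idm (s \<odot> e)) e" if "s \<in> carrier S" "e \<odot> s = s" for s
    using that e idm_absorb_left[of e "s \<odot> e"] idm_absorb_right[of e "s \<odot> e"]
    by (simp add: idempotent_le_def assoc[symmetric]) (simp add: assoc)
  have Jst: "J_below S (idm (s \<odot> e)) (idm (t \<odot> e))"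
    if "s \<in> carrier S" "e \<odot> s = s" "t \<in> carrier S" "e \<odot> t = t" "J_below S s t" for s t
  proof -
    have "J_below S (idm (s \<odot> e)) (s \<odot> e)" "J_below S (s \<odot> e) s" "J_below S t (t \<odot> e)"
      "J_below S (t \<odot> e) (idm (t \<odot> e))"
      using that e J_idm J_mult_left se by auto
    then show ?thesis using that e J_trans by (meson closed pow_closed)
  qed
  have eq: "idm (s \<odot> e) = idm (t \<odot> e)"
    using local_idempotent_unique[OF LC e(1) _ _ e(2), of "idm (s \<odot> e)" "idm (t \<odot> e)"]
      le Jst s t J e by simp
  obtain w where w: "w \<in> carrier S" "s = s \<odot> e \<odot> w" using stable_right[OF s(1) e(1)] se s by blast
  have "s = idm (s \<odot> e) \<odot> s" using s(1) e(1) w by (metis assoc closed idm_left pow_closed)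
  then have s_eq: "s = idm (t \<odot> e) \<odot> s" using eq by simp
  obtain d where d: "d \<in> carrier S" "idm (t \<odot> e) = t \<odot> e \<odot> d"
    using idm_factor t e by blast
  have "s = t \<odot> e \<odot> d \<odot> s" using s_eq d(2) by simp
  then have "s = t \<odot> (e \<odot> d \<odot> s)" using s(1) t(1) e(1) d(1) by (simp add: assoc)
  moreover have "e \<odot> d \<odot> s \<in> carrier S" using s(1) e(1) d(1) by simp
  ultimately show ?thesis by blast
qed

lemma locally_commuting_opposite:
  assumes "locally_commuting S"
  shows "locally_commuting (sg_opposite S)"
  unfolding locally_commuting_def carrier_opposite mul_opposite idempotent_le_def
proof (intro ballI impI)
  fix e f g assume "e \<in> carrier S" "f \<in> carrier S" "g \<in> carrier S" "e \<odot> e = e" "f \<odot> f = f"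
    "g \<odot> g = g" "e \<odot> f = f \<and> f \<odot> e = f" "e \<odot> g = g \<and> g \<odot> e = g"
  then show "g \<odot> f = f \<odot> g"
    using assms unfolding locally_commuting_def idempotent_le_def by metis
qed

lemma common_right_identity:
  assumes LC: "locally_commuting S"
    and e: "e \<in> carrier S" "e \<odot> e = e"
    and s: "s \<in> carrier S" "s \<odot> e = s" and t: "t \<in> carrier S" "t \<odot> e = t"
    and J: "J_below S s t" "J_below S t s"
  shows "\<exists>p\<in>carrier S. s = p \<odot> t"
proof -
  interpret op: cr_semigrp "sg_opposite S" n by (rule opposite_cr)
  show ?thesis
    using op.common_left_identity[OF locally_commuting_opposite[OF LC], of e s t] assms
    by (simp add: J_opposite)
qed

lemma idm_eq_of_common_identities:
  assumes LC: "locally_commuting S"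
    and "e \<in> carrier S" "e \<odot> e = e" "f \<in> carrier S" "f \<odot> f = f"
    and "s \<in> carrier S" "e \<odot> s = s" "s \<odot> f = s"
    and "t \<in> carrier S" "e \<odot> t = t" "t \<odot> f = t"
    and J: "J_below S s t" "J_below S t s"
  shows "idm s = idm t"
proof -
  obtain p where p: "p \<in> carrier S" "s = t \<odot> p"
    using common_left_identity[OF LC, of e s t] assms by blast
  obtain q where q: "q \<in> carrier S" "t = q \<odot> s"
    using common_right_identity[OF LC, of f t s] assms by blast
  show ?thesis by (rule idm_eqI[OF assms(6,9) p q])
qed

lemma idm_eq_of_ends:
  assumes LC: "locally_commuting S" and "a \<in> carrier S" "b \<in> carrier S"
    and "s = a \<odot> s'" "s = s'' \<odot> b" "s' \<in> carrier S" "s'' \<in> carrier S"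
    and "t = a \<odot> t'" "t = t'' \<odot> b" "t' \<in> carrier S" "t'' \<in> carrier S"
    and J: "J_below S s t" "J_below S t s"
  shows "idm s = idm t"
proof (rule idm_eq_of_common_identities[OF LC, of "idm a" "idm b"])
  show "idm a \<odot> s = s" "idm a \<odot> t = t" unfolding assms(4,8) using assms(2,6,10) by (simp_all add: assoc[symmetric])
  show "s \<odot> idm b = s" "t \<odot> idm b = t" unfolding assms(5,9) using assms(3,7,11) by (simp_all add: assoc)
qed (use assms in auto)

lemma locally_commuting_imp_permutes:
  assumes LC: "locally_commuting S"
  shows "permutes_inner_factors S n"
  unfolding permutes_inner_factors_def
proof (intro ballI)
  fix a x y b assume *: "a \<in> carrier S" "x \<in> carrier S" "y \<in> carrier S" "b \<in> carrier S"
  have "J_below S (a \<odot> x \<odot> y \<odot> b) (a \<odot> y \<odot> x \<odot> b)"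
    if "x \<in> carrier S" "y \<in> carrier S" for x y
    using * that J_refl[of "a \<odot> x \<odot> y \<odot> b"] by (auto simp: J_below_mult_iff)
  then show "idm (a \<odot> x \<odot> y \<odot> b) = idm (a \<odot> y \<odot> x \<odot> b)"
    using * by (intro idm_eq_of_ends[OF LC, of a b _ "x \<odot> y \<odot> b" "a \<odot> x \<odot> y" _ "y \<odot> x \<odot> b" "a \<odot> y \<odot> x"])
       (auto simp: assoc)
qed

text \<open>
  With the common upper bound at both ends, the law says that \<open>f g\<close> and \<open>g f\<close> have the same
  idempotent. It absorbs \<open>g\<close> on both sides, hence so do the products themselves.
\<close>

lemma permutes_imp_locally_commuting:
  assumes "permutes_inner_factors S n"
  shows "locally_commuting S"
  unfolding locally_commuting_def
proof (intro ballI impI)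
  fix e f g assume c: "e \<in> carrier S" "f \<in> carrier S" "g \<in> carrier S"
    and i: "e \<odot> e = e" "f \<odot> f = f" "g \<odot> g = g"
    and le: "idempotent_le S f e" "idempotent_le S g e"
  have *: "idm (f \<odot> g) = idm (g \<odot> f)"
  proof -
    have "idm (e \<odot> f \<odot> g \<odot> e) = idm (e \<odot> g \<odot> f \<odot> e)"
      using assms c unfolding permutes_inner_factors_def by blast
    moreover have "e \<odot> f = f" "g \<odot> e = g" "e \<odot> g = g" "f \<odot> e = f"
      using le by (simp_all add: idempotent_le_def)
    ultimately show ?thesis using c by (simp add: assoc)
  qed
  have a: "g \<odot> f \<odot> g = f \<odot> g" if "f \<in> carrier S" "g \<in> carrier S" "g \<odot> g = g" "idm (f \<odot> g) = idm (g \<odot> f)" for f g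
  proof -
    have "g \<odot> idm (f \<odot> g) = idm (f \<odot> g)"
      using that idm_absorb_left[of g "g \<odot> f"] by (simp add: assoc[symmetric])
    then have *: "g \<odot> (idm (f \<odot> g) \<odot> (f \<odot> g)) = idm (f \<odot> g) \<odot> (f \<odot> g)"
      using that(1,2) by (simp add: assoc[symmetric] del: idm_left)
    have "idm (f \<odot> g) \<odot> (f \<odot> g) = f \<odot> g" using that(1,2) by simp
    then show ?thesis using * that(1,2) by (simp add: assoc)
  qed
  have b: "g \<odot> f \<odot> g = g \<odot> f" if "f \<in> carrier S" "g \<in> carrier S" "g \<odot> g = g" "idm (f \<odot> g) = idm (g \<odot> f)" for f g
  proof -
    have "idm (g \<odot> f) \<odot> g = idm (g \<odot> f)"
      using that idm_absorb_right[of g "f \<odot> g"] by (simp add: assoc)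
    then have *: "((g \<odot> f) \<odot> idm (g \<odot> f)) \<odot> g = (g \<odot> f) \<odot> idm (g \<odot> f)"
      using that(1,2) by (simp add: assoc del: idm_right)
    have "(g \<odot> f) \<odot> idm (g \<odot> f) = g \<odot> f" using that(1,2) by simp
    then show ?thesis using * by simp
  qed
  show "f \<odot> g = g \<odot> f"
    by (rule trans[OF a[OF c(2,3) i(3) *, symmetric] b[OF c(2,3) i(3) *]])
qed

end



section \<open>Normal bands of groups\<close>

context cr_semigrp
begin

text \<open>
  The idempotent of a product depends only on the idempotents of the factors. This is what makes
  the relation \<open>idm x = idm y\<close>, whose classes are groups, a congruence.
\<close>

lemma idm_mult:
  assumes LC: "locally_commuting S" and "a \<in> carrier S" "b \<in> carrier S"
  shows "idm (a \<odot> b) = idm (idm a \<odot> idm b)"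
proof -
  obtain c where c: "c \<in> carrier S" "idm a = a \<odot> c" using idm_factor assms by blast
  obtain d where d: "d \<in> carrier S" "idm b = d \<odot> b" using idm_factor assms by blast
  have eq: "idm a \<odot> idm b = a \<odot> (c \<odot> idm b)" "idm a \<odot> idm b = (idm a \<odot> d) \<odot> b"
    using assms c d by (simp_all add: assoc)
  have "J_below S (a \<odot> b) (idm a \<odot> idm b)" "J_below S (idm a \<odot> idm b) (a \<odot> b)"
    using assms J_refl J_idm J_mult_left J_mult_right J_trans
    by (meson J_below_mult_iff closed pow_closed)+
  then show ?thesis
    using idm_eq_of_ends[OF LC assms(2,3) refl refl assms(3,2) eq] assms c d by simp
qed

definition same_idm :: "('a \<times> 'a) set" where
  "same_idm = {(x, y). x \<in> carrier S \<and> y \<in> carrier S \<and> idm x = idm y}"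

lemma same_idm_congruence:
  assumes LC: "locally_commuting S"
  shows "sg_congruence S same_idm"
proof -
  have "equiv (carrier S) same_idm"
    by (intro equivI) (auto simp: same_idm_def refl_on_def sym_def trans_def)
  moreover have "(x \<odot> y, x' \<odot> y') \<in> same_idm" if "(x, x') \<in> same_idm" "(y, y') \<in> same_idm" for x x' y y'
    using that idm_mult[OF LC, of x y] idm_mult[OF LC, of x' y'] by (simp add: same_idm_def)
  ultimately show ?thesis by (auto simp: sg_congruence_def)
qed

lemma same_idm_class_group:
  assumes LC: "locally_commuting S" and x: "x \<in> carrier S"
  shows "group \<lparr>carrier = same_idm `` {x}, mult = mul S, one = idm x\<rparr>"
proof -
  have mem: "y \<in> same_idm `` {x} \<longleftrightarrow> y \<in> carrier S \<and> idm y = idm x" for y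
    using x by (auto simp: same_idm_def)
  have idm_idm: "idm (idm y) = idm y" if "y \<in> carrier S" for y
    using that by (simp add: pow_idempotent)
  have mult_mem: "y \<odot> z \<in> same_idm `` {x}" if "y \<in> same_idm `` {x}" "z \<in> same_idm `` {x}" for y z
    using that[unfolded mem] idm_mult[OF LC, of y z] idm_idm[of x] x mem[of "y \<odot> z"] by simp
  let ?M = "\<lparr>carrier = same_idm `` {x}, mult = mul S, one = idm x\<rparr>"
  have M: "y \<in> carrier ?M \<longleftrightarrow> y \<in> carrier S \<and> idm y = idm x" "mult ?M = mul S" "one ?M = idm x" for y
    using mem by simp_all
  show ?thesis
  proof (rule groupI)
    fix y z assume "y \<in> carrier ?M" "z \<in> carrier ?M"
    then show "y \<otimes>\<^bsub>?M\<^esub> z \<in> carrier ?M" using mult_mem by simp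
  next
    show "\<one>\<^bsub>?M\<^esub> \<in> carrier ?M" unfolding M using idm_idm x by simp
  next
    fix y z w assume "y \<in> carrier ?M" "z \<in> carrier ?M" "w \<in> carrier ?M"
    then show "y \<otimes>\<^bsub>?M\<^esub> z \<otimes>\<^bsub>?M\<^esub> w = y \<otimes>\<^bsub>?M\<^esub> (z \<otimes>\<^bsub>?M\<^esub> w)" unfolding M by (simp add: assoc)
  next
    fix y assume "y \<in> carrier ?M"
    then have "y \<in> carrier S" "idm x = idm y" unfolding M by simp_all
    then show "\<one>\<^bsub>?M\<^esub> \<otimes>\<^bsub>?M\<^esub> y = y" unfolding M by simp
  next
    fix y assume y: "y \<in> carrier ?M"
    then have yc: "y \<in> carrier S" "idm y = idm x" unfolding M by simp_all
    \<comment> \<open>The inverse of \<open>y\<close>; the exponent \<open>n - 1\<close> could be 0.\<close>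
    define z where "z = sg_pow S y (2 * n - 1)"
    have "z \<odot> y = sg_pow S y (n + n)"
      using pow_add[of y "2 * n - 1" 1] yc exponent_pos by (simp add: z_def flip: mult_2)
    then have zy: "z \<odot> y = idm x" using pow_add[of y n n] yc x exponent_pos by simp
    have "idm z = sg_pow S (idm y) (2 * n - 1)"
      using pow_pow[of y "2 * n - 1" n] pow_pow[of y n "2 * n - 1"] yc exponent_pos
      by (simp add: z_def mult.commute)
    then have "idm z = idm x" using yc x by (simp add: pow_idempotent)
    then have "z \<in> carrier ?M" unfolding M using yc by (simp add: z_def)
    with zy show "\<exists>z\<in>carrier ?M. z \<otimes>\<^bsub>?M\<^esub> y = \<one>\<^bsub>?M\<^esub>" unfolding M(2,3) by blast
  qed
qed

end

lemma congruence_class_hom: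
  assumes S: "is_semigroup S" and \<theta>: "sg_congruence S \<theta>"
  shows "(\<lambda>x. \<theta> `` {x}) \<in> sg_hom S (sg_quotient S \<theta>)"
    and "(\<lambda>x. \<theta> `` {x}) ` carrier S = carrier (sg_quotient S \<theta>)"
proof -
  interpret semigrp S by unfold_locales fact
  have eq: "equiv (carrier S) \<theta>"
    and cong: "\<And>x x' y y'. (x, x') \<in> \<theta> \<Longrightarrow> (y, y') \<in> \<theta> \<Longrightarrow> (x \<odot>\<^bsub>S\<^esub> y, x' \<odot>\<^bsub>S\<^esub> y') \<in> \<theta>"
    using \<theta> by (auto simp: sg_congruence_def)
  show "(\<lambda>x. \<theta> `` {x}) ` carrier S = carrier (sg_quotient S \<theta>)"
    by (auto simp: sg_quotient_def quotient_def)
  have "\<theta> `` {x} \<odot>\<^bsub>sg_quotient S \<theta>\<^esub> \<theta> `` {y} = \<theta> `` {x \<odot>\<^bsub>S\<^esub> y}"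
    if "x \<in> carrier S" "y \<in> carrier S" for x y
  proof -
    have "\<theta> `` {a \<odot>\<^bsub>S\<^esub> b} = \<theta> `` {x \<odot>\<^bsub>S\<^esub> y}" if "a \<in> \<theta> `` {x}" "b \<in> \<theta> `` {y}" for a b
      using that cong[of x a y b] equiv_class_eq[OF eq] by auto
    then have "(\<Union>a\<in>\<theta> `` {x}. \<Union>b\<in>\<theta> `` {y}. \<theta> `` {a \<odot>\<^bsub>S\<^esub> b})
      = (\<Union>a\<in>\<theta> `` {x}. \<Union>b\<in>\<theta> `` {y}. \<theta> `` {x \<odot>\<^bsub>S\<^esub> y})"
      by (intro SUP_cong refl)
    moreover have "\<theta> `` {x} \<noteq> {}" "\<theta> `` {y} \<noteq> {}" using equiv_class_self[OF eq] that by blast+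
    ultimately have "(\<Union>a\<in>\<theta> `` {x}. \<Union>b\<in>\<theta> `` {y}. \<theta> `` {a \<odot>\<^bsub>S\<^esub> b}) = \<theta> `` {x \<odot>\<^bsub>S\<^esub> y}"
      by simp
    then show ?thesis by (simp add: sg_quotient_def)
  qed
  then show "(\<lambda>x. \<theta> `` {x}) \<in> sg_hom S (sg_quotient S \<theta>)"
    by (auto simp: sg_hom_def sg_quotient_def quotient_def)
qed

lemma satisfies_quotient_iff:
  assumes S: "is_semigroup S" and \<theta>: "sg_congruence S \<theta>"
  shows "satisfies (sg_quotient S \<theta>) (p, q) \<longleftrightarrow>
    (\<forall>\<sigma>\<in>UNIV \<rightarrow> carrier S. (sg_eval S \<sigma> p, sg_eval S \<sigma> q) \<in> \<theta>)"
proof -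
  interpret semigrp S by unfold_locales fact
  let ?c = "\<lambda>x. \<theta> `` {x}" and ?Q = "sg_quotient S \<theta>"
  have eq: "equiv (carrier S) \<theta>" using \<theta> by (auto simp: sg_congruence_def)
  note hom = congruence_class_hom[OF S \<theta>]
  have *: "holds_under ?Q (?c \<circ> \<sigma>) (p, q) \<longleftrightarrow> (sg_eval S \<sigma> p, sg_eval S \<sigma> q) \<in> \<theta>"
    if "\<sigma> \<in> UNIV \<rightarrow> carrier S" for \<sigma>
    using that eq_equiv_class_iff[OF eq, of "sg_eval S \<sigma> p" "sg_eval S \<sigma> q"]
    by (simp add: holds_under_def eval_closed hom_eval[OF S hom(1) that, symmetric])
  have "?c \<circ> \<sigma> \<in> UNIV \<rightarrow> carrier ?Q" if "\<sigma> \<in> UNIV \<rightarrow> carrier S" for \<sigma> :: "nat \<Rightarrow> 'a"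
    using hom_closed[OF hom(1)] range_mem[OF that] by simp
  then show ?thesis
    unfolding satisfies_def using * surjective_hom_lift[OF hom(2)] by metis
qed

lemma eval_4: "sg_eval S \<phi> [i, j, k, l] = \<phi> i \<odot>\<^bsub>S\<^esub> \<phi> j \<odot>\<^bsub>S\<^esub> \<phi> k \<odot>\<^bsub>S\<^esub> \<phi> l"
  by (simp add: sg_eval_def)

lemma (in cr_semigrp) normal_band_of_groups:
  assumes LC: "locally_commuting S"
  shows "normal_band_of_groups S"
proof -
  note \<theta> = same_idm_congruence[OF LC]
  have "satisfies (sg_quotient S same_idm) ([1, 1], [1])"
  proof -
    have "idm (x \<odot> x) = idm x" if "x \<in> carrier S" for x
      using that idm_mult[OF LC, of x x] by (simp add: pow_idempotent)
    then show ?thesis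
      unfolding satisfies_quotient_iff[OF semigroup \<theta>]
      by (simp add: same_idm_def sg_eval_def Pi_iff)
  qed
  moreover have "satisfies (sg_quotient S same_idm) ([0, 1, 2, 3], [0, 2, 1, 3])"
    using locally_commuting_imp_permutes[OF LC]
    unfolding satisfies_quotient_iff[OF semigroup \<theta>] permutes_inner_factors_def
    by (simp add: same_idm_def eval_4 Pi_iff)
  moreover have "is_semigroup (sg_quotient S same_idm)"
    using semigroup_surjective_image[OF semigroup congruence_class_hom[OF semigroup \<theta>]] .
  moreover have "\<exists>e. group \<lparr>carrier = G, mult = mul S, one = e\<rparr>" if "G \<in> carrier S // same_idm" for G
    using that same_idm_class_group[OF LC] by (auto simp: quotient_def)
  ultimately show ?thesis
    using \<theta> semigroup unfolding normal_band_of_groups_def normal_band_def Let_def by blast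
qed

text \<open>
  Conversely, in a group the law \<open>x\<^sup>m\<^sup>+\<^sup>n = x\<^sup>m\<close> says that \<open>x\<^sup>n\<close> is the identity, so elements of
  the same class have the same \<open>n\<close>-th power.
\<close>

lemma (in periodic_semigrp) normal_band_of_groups_laws:
  assumes "normal_band_of_groups S"
  shows "satisfies_power_law S 1 n" "permutes_inner_factors S n"
proof -
  obtain \<theta> where \<theta>: "sg_congruence S \<theta>" and nb: "normal_band (sg_quotient S \<theta>)"
    and grp: "\<And>G. G \<in> carrier S // \<theta> \<Longrightarrow> \<exists>e. group \<lparr>carrier = G, mult = mul S, one = e\<rparr>"
    using assms unfolding normal_band_of_groups_def by blast
  have eq: "equiv (carrier S) \<theta>" using \<theta> by (auto simp: sg_congruence_def)
  have *: "\<exists>e. e \<odot> x = x \<and> x \<odot> e = x \<and> (\<forall>y. (x, y) \<in> \<theta> \<longrightarrow> sg_pow S y n = e)" if x: "x \<in> carrier S" for x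
  proof -
    let ?G = "\<theta> `` {x}"
    have "?G \<in> carrier S // \<theta>" using x by (auto simp: quotient_def)
    then obtain e where "group \<lparr>carrier = ?G, mult = mul S, one = e\<rparr>" using grp by blast
    then interpret G: group "\<lparr>carrier = ?G, mult = mul S, one = e\<rparr>" .
    have xG: "x \<in> ?G" using eq x by (rule equiv_class_self)
    have "sg_pow S y n = e" if y: "(x, y) \<in> \<theta>" for y
    proof -
      have pow: "sg_pow S y k \<in> ?G" for k
      proof (induction k)
        case (Suc k)
        then show ?case using y G.m_closed[of "sg_pow S y k" y] by simp
      qed (use y in simp)
      have yS: "y \<in> carrier S" using y eq by (auto simp: equiv_def)
      have "sg_pow S y m \<odot> sg_pow S y n = sg_pow S y m"
        using pow_add[OF yS m_pos n_pos] pow_periodic[OF yS] by simp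
      then show ?thesis using G.l_cancel_one[of "sg_pow S y m" "sg_pow S y n"] pow by simp
    qed
    moreover have "e \<odot> x = x" "x \<odot> e = x" using xG G.l_one[of x] G.r_one[of x] by simp_all
    ultimately show ?thesis by blast
  qed
  have "sg_pow S x (1 + n) = x" if x: "x \<in> carrier S" for x
    using *[OF x] equiv_class_self[OF eq x] n_pos by auto
  then show "satisfies_power_law S 1 n" by (simp add: satisfies_power_law_def)
  show "permutes_inner_factors S n"
    unfolding permutes_inner_factors_def
  proof (intro ballI)
    fix a x y b assume c: "a \<in> carrier S" "x \<in> carrier S" "y \<in> carrier S" "b \<in> carrier S"
    define \<sigma> where "\<sigma> i = (if i = 0 then a else if i = 1 then x else if i = 2 then y else b)" for i :: nat
    have "satisfies (sg_quotient S \<theta>) ([0, 1, 2, 3], [0, 2, 1, 3])"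
      using nb by (simp add: normal_band_def Let_def)
    moreover have "\<sigma> \<in> UNIV \<rightarrow> carrier S" using c by (simp add: \<sigma>_def)
    ultimately have "(a \<odot> x \<odot> y \<odot> b, a \<odot> y \<odot> x \<odot> b) \<in> \<theta>"
      unfolding satisfies_quotient_iff[OF semigroup \<theta>] by (auto simp: eval_4 \<sigma>_def)
    moreover have "(a \<odot> x \<odot> y \<odot> b, a \<odot> x \<odot> y \<odot> b) \<in> \<theta>"
      using equiv_class_self[OF eq, of "a \<odot> x \<odot> y \<odot> b"] c by simp
    ultimately show "sg_pow S (a \<odot> x \<odot> y \<odot> b) n = sg_pow S (a \<odot> y \<odot> x \<odot> b) n"
      using *[of "a \<odot> x \<odot> y \<odot> b"] c by auto
  qed
qed

text \<open>
  Both products \<open>idm p q\<close> and \<open>q idm p\<close> start with \<open>x\<close>, end with \<open>z\<close> and generate the same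
  ideal, so they have the same idempotent \<open>g\<close>, which lies below \<open>idm p\<close>. Absorbing \<open>g\<close> shows
  that both are equal to \<open>idm p q idm p\<close>.
\<close>

lemma (in cr_semigrp) idm_commutes_same_ends:
  assumes LC: "locally_commuting S"
    and c: "x \<in> carrier S" "h \<in> carrier S" "y \<in> carrier S" "z \<in> carrier S"
  shows "idm (x \<odot> h \<odot> z) \<odot> (x \<odot> y \<odot> z) = (x \<odot> y \<odot> z) \<odot> idm (x \<odot> h \<odot> z)"
proof -
  define p q where "p = x \<odot> h \<odot> z" and "q = x \<odot> y \<odot> z"
  have pq: "p \<in> carrier S" "q \<in> carrier S" using c by (auto simp: p_def q_def)
  let ?s = "idm p \<odot> q" and ?t = "q \<odot> idm p"
  have "idm x \<odot> p = p" "idm x \<odot> q = q" "p \<odot> idm z = p" "q \<odot> idm z = q"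
    using c by (simp_all add: p_def q_def assoc[symmetric]) (simp_all add: assoc)
  then have ends: "idm x \<odot> ?s = ?s" "idm x \<odot> ?t = ?t" "?s \<odot> idm z = ?s" "?t \<odot> idm z = ?t"
    using pq c idm_absorb_left[of "idm x" p] idm_absorb_right[of "idm z" p]
    by (simp_all add: assoc[symmetric]) (simp_all add: assoc)
  have J: "J_below S ?s ?t" "J_below S ?t ?s"
    using pq J_refl J_mult_left J_mult_right J_meet by (meson closed pow_closed)+
  have g: "idm ?s = idm ?t"
    using idm_eq_of_common_identities[OF LC _ _ _ _ _ ends(1,3) _ ends(2,4) J] pq c by simp
  have ge: "idm ?t \<odot> idm p = idm ?t" using pq by (intro idm_absorb_right) (simp_all add: assoc)
  have eg: "idm p \<odot> idm ?s = idm ?s" using pq by (intro idm_absorb_left) (simp_all add: assoc[symmetric])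
  have "?s = ?s \<odot> (idm ?s \<odot> idm p)" using pq ge g idm_right[of ?s] by simp
  also have "\<dots> = ?s \<odot> idm p" using pq by (simp add: assoc[symmetric] del: idm_left)
  finally have "?s = idm p \<odot> q \<odot> idm p" .
  moreover have "?t = (idm p \<odot> idm ?t) \<odot> ?t" using pq eg g idm_left[of ?t] by simp
  then have "?t = idm p \<odot> (idm ?t \<odot> ?t)" using pq by (metis assoc closed pow_closed)
  then have "?t = idm p \<odot> q \<odot> idm p" using pq idm_left[of ?t] by (simp add: assoc)
  ultimately show ?thesis by (simp add: p_def q_def)
qed



section \<open>Completely 0-simple semigroups with a power law\<close>

lemma is_zero_unique:
  "is_zero S z \<Longrightarrow> is_zero S z' \<Longrightarrow> z = z'"
  by (metis is_zero_def)

context semigrp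
begin

lemma zero_pow: "is_zero S z \<Longrightarrow> sg_pow S z k = z"
  by (rule pow_idempotent) (auto simp: is_zero_def)

text \<open>
  If \<open>S a S\<close> were zero, the elements with this property would form an ideal containing \<open>a\<close>, hence
  all of \<open>S\<close>, and a nonzero idempotent \<open>e = e e e\<close> would be zero.
\<close>

lemma zero_simple_factor:
  assumes c0s: "completely_zero_simple S"
    and a: "a \<in> carrier S" "\<not> is_zero S a" and b: "b \<in> carrier S"
  shows "\<exists>u\<in>carrier S. \<exists>v\<in>carrier S. b = u \<odot> a \<odot> v"
proof -
  have ideal: "I = carrier S \<or> (\<exists>z. is_zero S z \<and> I = {z})" if "is_ideal S I" for I
    using c0s that by (auto simp: completely_zero_simple_def zero_simple_def)
  obtain e where e: "e \<in> carrier S" "e \<odot> e = e" "is_zero S e \<longrightarrow> carrier S = {e}"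
    using c0s by (auto simp: completely_zero_simple_def nonzero_idempotents_def)
  then have e_nz: "\<not> is_zero S e" using a by auto
  define I where "I = {u \<odot> a \<odot> v |u v. u \<in> carrier S \<and> v \<in> carrier S}"
  have "is_ideal S I"
    unfolding is_ideal_def
  proof (intro conjI ballI)
    fix i s assume "i \<in> I" and s: "s \<in> carrier S"
    then obtain u v where uv: "u \<in> carrier S" "v \<in> carrier S" "i = u \<odot> a \<odot> v"
      unfolding I_def by blast
    have "s \<odot> i = (s \<odot> u) \<odot> a \<odot> v" "i \<odot> s = u \<odot> a \<odot> (v \<odot> s)"
      using uv s a by (simp_all add: assoc)
    then show "s \<odot> i \<in> I" "i \<odot> s \<in> I" unfolding I_def using uv s by blast+
  qed (use a in \<open>auto simp: I_def\<close>)
  moreover have False if I: "I = {z}" and z: "is_zero S z" for z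
  proof -
    define A where "A = {x \<in> carrier S. \<forall>u\<in>carrier S. \<forall>v\<in>carrier S. u \<odot> x \<odot> v = z}"
    have aA: "a \<in> A" using a I by (auto simp: A_def I_def)
    have "is_ideal S A"
      unfolding is_ideal_def
    proof (intro conjI ballI)
      fix i s assume i: "i \<in> A" and s: "s \<in> carrier S"
      then have iS: "i \<in> carrier S" by (simp add: A_def)
      have "u \<odot> (s \<odot> i) \<odot> v = (u \<odot> s) \<odot> i \<odot> v" "u \<odot> (i \<odot> s) \<odot> v = u \<odot> i \<odot> (s \<odot> v)"
        if "u \<in> carrier S" "v \<in> carrier S" for u v
        using that iS s by (simp_all add: assoc)
      then show "s \<odot> i \<in> A" "i \<odot> s \<in> A" using i s iS unfolding A_def by auto
    qed (use aA in \<open>auto simp: A_def\<close>)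
    then have "A = carrier S" using ideal[of A] aA a by auto
    then have "e \<in> A" using e(1) by simp
    then have "e \<odot> e \<odot> e = z" using e(1) unfolding A_def by blast
    then show False using e e_nz z by simp
  qed
  ultimately have "I = carrier S" using ideal by blast
  then show ?thesis using b unfolding I_def by blast
qed

end

text \<open>
  Nonzero elements are \<open>\<J>\<close>-equivalent. So, unless both products are zero, stability recovers \<open>a\<close>
  from \<open>a y x b\<close> by multiplication on the right and \<open>b\<close> from \<open>a x y b\<close> by multiplication on the
  left; each product is then a multiple of the other, on opposite sides.
\<close>

lemma (in cr_semigrp) completely_zero_simple_permutes:
  assumes c0s: "completely_zero_simple S"
  shows "permutes_inner_factors S n"
  unfolding permutes_inner_factors_def
proof (intro ballI)
  fix a x y b assume c: "a \<in> carrier S" "x \<in> carrier S" "y \<in> carrier S" "b \<in> carrier S"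
  let ?s = "a \<odot> x \<odot> y \<odot> b" and ?t = "a \<odot> y \<odot> x \<odot> b"
  have J: "J_below S u v" if "u \<in> carrier S" "v \<in> carrier S" "\<not> is_zero S v" for u v
    using zero_simple_factor[OF c0s that(2,3,1)] unfolding J_below_def .
  have st: "J_below S ?s ?t" "J_below S ?t ?s"
    using J_refl[of ?s] J_refl[of ?t] c by (auto simp: J_below_mult_iff)
  have zero: "u = v" if "is_zero S v" "J_below S u v" for u v
    using that unfolding J_below_def is_zero_def by force
  show "idm ?s = idm ?t"
  proof (cases "is_zero S ?s \<or> is_zero S ?t")
    case True
    then show ?thesis using zero st by metis
  next
    case False
    have right: "\<exists>d\<in>carrier S. a = a \<odot> w \<odot> d" if "w \<in> carrier S" "\<not> is_zero S (a \<odot> w)" for w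
      using that J[of a "a \<odot> w"] stable_right c by simp
    have left: "\<exists>d\<in>carrier S. b = d \<odot> w \<odot> b" if "w \<in> carrier S" "\<not> is_zero S (w \<odot> b)" for w
      using that J[of b "w \<odot> b"] stable_left c by simp
    obtain d where d: "d \<in> carrier S" "a = a \<odot> (y \<odot> x \<odot> b) \<odot> d"
      using right[of "y \<odot> x \<odot> b"] False c by (auto simp: assoc)
    obtain d' where d': "d' \<in> carrier S" "b = d' \<odot> (a \<odot> x \<odot> y) \<odot> b"
      using left[of "a \<odot> x \<odot> y"] False c by (auto simp: assoc)
    have "?s = ?t \<odot> (d \<odot> (x \<odot> y \<odot> b))"
      using arg_cong[OF d(2), of "\<lambda>a. a \<odot> (x \<odot> y \<odot> b)"] c d(1) by (simp add: assoc)
    moreover have "?t = ((a \<odot> y \<odot> x) \<odot> d') \<odot> ?s"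
      using arg_cong[OF d'(2), of "\<lambda>b. (a \<odot> y \<odot> x) \<odot> b"] c d'(1) by (simp add: assoc)
    ultimately show ?thesis
      using c d(1) d'(1) by (intro idm_eqI[of _ _ "d \<odot> (x \<odot> y \<odot> b)" "(a \<odot> y \<odot> x) \<odot> d'"]) auto
  qed
qed

context periodic_semigrp
begin

text \<open>
  If \<open>x x\<close> is not zero, then \<open>x\<close> lies in \<open>S x x S\<close> and stability gives \<open>x = t x x\<close>. Iterating,
  \<open>x = t\<^sup>m x\<^sup>m\<^sup>+\<^sup>1\<close>, which the power law turns into \<open>x = x\<^sup>n\<^sup>+\<^sup>1\<close>.
\<close>

lemma square_zero_or_in_subgroup:
  assumes c0s: "completely_zero_simple S" and x: "x \<in> carrier S" and "sg_pow S x (Suc n) \<noteq> x"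
  shows "is_zero S (x \<odot> x)"
proof (rule ccontr)
  assume "\<not> is_zero S (x \<odot> x)"
  then obtain u v where uv: "u \<in> carrier S" "v \<in> carrier S" "x = u \<odot> (x \<odot> x) \<odot> v"
    using zero_simple_factor[OF c0s _ _ x] x by blast
  then have "x = (u \<odot> x) \<odot> x \<odot> v" using x by (simp add: assoc)
  then obtain w where w: "w \<in> carrier S" "x = w \<odot> (u \<odot> x) \<odot> x"
    using sandwich_cancel_left[of x v "u \<odot> x"] x uv by auto
  then have eq: "x = (w \<odot> u) \<odot> (x \<odot> x)" using x uv by (simp add: assoc)
  define t where "t = w \<odot> u"
  have t: "t \<in> carrier S" "x = t \<odot> (x \<odot> x)" using w uv eq by (auto simp: t_def)
  have *: "x = sg_pow S t k \<odot> sg_pow S x (Suc k)" if "k > 0" for k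
    using that
  proof (induction k)
    case (Suc k)
    show ?case
    proof (cases "k = 0")
      case False
      have "x = sg_pow S t k \<odot> sg_pow S x (1 + k)" using Suc False by simp
      also have "sg_pow S x (1 + k) = (t \<odot> (x \<odot> x)) \<odot> sg_pow S x k"
        using pow_add[of x 1 k] x False t(2) by simp
      also have "\<dots> = t \<odot> sg_pow S x (1 + (1 + k))"
        using pow_add[of x 1 "1 + k"] pow_add[of x 1 k] x False t(1) by (simp add: assoc)
      finally show ?thesis using False t(1) x by (simp add: assoc)
    qed (use t in simp)
  qed simp
  have "sg_pow S x (Suc m + n) = sg_pow S x (Suc m)"
    using pow_add[of x 1 "m + n"] pow_add[of x 1 m] pow_periodic[of x] m_pos x by simp
  then have "x = sg_pow S t m \<odot> sg_pow S x (Suc m + n)" using *[OF m_pos] by simp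
  also have "\<dots> = (sg_pow S t m \<odot> sg_pow S x (Suc m)) \<odot> sg_pow S x n"
    using pow_add[of x "Suc m" n] n_pos x t(1) by (simp add: assoc del: sg_pow.simps)
  also have "\<dots> = x \<odot> sg_pow S x n" using *[OF m_pos] by simp
  also have "\<dots> = sg_pow S x (Suc n)" using pow_add[of x 1 n] x n_pos by simp
  finally show False using assms(3) by simp
qed

text \<open>
  For a nonzero idempotent \<open>e\<close> there are factorizations \<open>x = u e v\<close> and \<open>e = p x q\<close>. Stability recovers
  \<open>e\<close> from \<open>e v q\<close> and from \<open>p u e\<close>, and the product of the multipliers is an inverse of \<open>x\<close>.
\<close>

lemma completely_zero_simple_regular:
  assumes c0s: "completely_zero_simple S" and x: "x \<in> carrier S" "\<not> is_zero S x"
  shows "\<exists>y\<in>carrier S. x \<odot> y \<odot> x = x"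
proof -
  obtain e where e: "e \<in> carrier S" "e \<odot> e = e" "is_zero S e \<longrightarrow> carrier S = {e}"
    using c0s by (auto simp: completely_zero_simple_def nonzero_idempotents_def)
  then have e_nz: "\<not> is_zero S e" using x by auto
  obtain u v where uv: "u \<in> carrier S" "v \<in> carrier S" "x = u \<odot> e \<odot> v"
    using zero_simple_factor[OF c0s e(1) e_nz x(1)] by blast
  obtain p q where pq: "p \<in> carrier S" "q \<in> carrier S" "e = p \<odot> x \<odot> q"
    using zero_simple_factor[OF c0s x e(1)] by blast
  have "e = p \<odot> (u \<odot> (e \<odot> e) \<odot> v) \<odot> q" using pq(3) uv(3) e(2) by simp
  then have pu: "e = (p \<odot> u) \<odot> e \<odot> (e \<odot> v \<odot> q)" and vq: "e = (p \<odot> u \<odot> e) \<odot> e \<odot> (v \<odot> q)"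
    using pq(1,2) uv(1,2) e(1) by (simp_all add: assoc)
  obtain d where d: "d \<in> carrier S" "e = e \<odot> (v \<odot> q) \<odot> d"
    using sandwich_cancel_right[OF e(1) _ _ vq] pq(1,2) uv(1,2) e(1) by auto
  obtain d' where d': "d' \<in> carrier S" "e = d' \<odot> (p \<odot> u) \<odot> e"
    using sandwich_cancel_left[OF e(1) _ _ pu] pq(1,2) uv(1,2) e(1) by auto
  let ?y = "((q \<odot> d) \<odot> e) \<odot> (d' \<odot> p)"
  have "x \<odot> ?y \<odot> x = u \<odot> (e \<odot> (v \<odot> q) \<odot> d) \<odot> e \<odot> (d' \<odot> (p \<odot> u) \<odot> e) \<odot> v"
    unfolding uv(3) using pq(1,2) uv(1,2) e(1) d(1) d'(1) by (simp add: assoc)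
  also have "\<dots> = u \<odot> e \<odot> v" using d(2) d'(2) e uv(1,2) by (simp add: assoc)
  finally have "x \<odot> ?y \<odot> x = x" using uv(3) by simp
  then show ?thesis using pq(1,2) e(1) d(1) d'(1) by blast
qed

text \<open>
  A quasi-identity that \<open>S0\<close> violates at \<open>a\<close> and \<open>b\<close>. If \<open>x y\<close> is not zero, stability makes \<open>x\<close> a left
  multiple of \<open>x x\<close>, so that \<open>x\<^sup>3 = x\<^sup>2\<close> leaves \<open>x\<close> idempotent.
\<close>

lemma completely_zero_simple_quasi_identity:
  assumes c0s: "completely_zero_simple S" and c: "x \<in> carrier S" "y \<in> carrier S"
    and comm: "x \<odot> y = y \<odot> x" and "x \<odot> x \<odot> x = x \<odot> x" "x \<odot> x \<odot> y = x \<odot> x"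
  shows "x \<odot> y = x \<odot> x"
proof (cases "is_zero S (x \<odot> y)")
  case True
  then have "x \<odot> x \<odot> y = x \<odot> y" using c by (simp add: assoc) (simp add: is_zero_def)
  then show ?thesis using assms(6) by simp
next
  case False
  have yx: "\<exists>w\<in>carrier S. x = w \<odot> (y \<odot> x)"
  proof -
    obtain u v where uv: "u \<in> carrier S" "v \<in> carrier S" "x = u \<odot> (x \<odot> y) \<odot> v"
      using zero_simple_factor[OF c0s _ False c(1)] c by blast
    then have "x = (u \<odot> y) \<odot> x \<odot> v" using c comm by (simp add: assoc)
    then obtain d where "d \<in> carrier S" "x = d \<odot> (u \<odot> y) \<odot> x"
      using sandwich_cancel_left[OF c(1)] c uv by blast
    then show ?thesis using c uv(1) by (intro bexI[of _ "d \<odot> u"]) (simp_all add: assoc)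
  qed
  have "\<exists>w\<in>carrier S. y = w \<odot> (x \<odot> y)"
  proof -
    obtain u v where uv: "u \<in> carrier S" "v \<in> carrier S" "y = u \<odot> (x \<odot> y) \<odot> v"
      using zero_simple_factor[OF c0s _ False c(2)] c by blast
    then have "y = (u \<odot> x) \<odot> y \<odot> v" using c by (simp add: assoc)
    then obtain d where "d \<in> carrier S" "y = d \<odot> (u \<odot> x) \<odot> y"
      using sandwich_cancel_left[OF c(2)] c uv by blast
    then show ?thesis using c uv(1) by (intro bexI[of _ "d \<odot> u"]) (simp_all add: assoc)
  qed
  then obtain q where q: "q \<in> carrier S" "y = q \<odot> (y \<odot> x)" using comm by auto
  obtain w where w: "w \<in> carrier S" "x = w \<odot> (y \<odot> x)" using yx by blast
  define t where "t = w \<odot> (q \<odot> y)"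
  have t: "t \<in> carrier S" using w q c by (simp add: t_def)
  have "y \<odot> x = (q \<odot> y) \<odot> (x \<odot> x)"
    using arg_cong[OF q(2), of "\<lambda>y. y \<odot> x"] q(1) c by (simp add: assoc)
  then have "w \<odot> (y \<odot> x) = t \<odot> (x \<odot> x)" using w(1) q(1) c by (simp add: t_def assoc)
  then have x: "x = t \<odot> (x \<odot> x)" using w(2) by simp
  have "x = t \<odot> (x \<odot> x \<odot> x)" using x assms(5) by simp
  also have "\<dots> = t \<odot> (x \<odot> x) \<odot> x" using t c by (simp add: assoc)
  also have "\<dots> = x \<odot> x" using x by simp
  finally have "x \<odot> x = x" by simp
  then show ?thesis using assms(6) by simp
qed

end


section \<open>Separating the elements of a normal band of groups\<close>

context cr_semigrp
begin

definition same_J :: "'a \<Rightarrow> 'a \<Rightarrow> bool" where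
  "same_J c d \<longleftrightarrow> d \<in> carrier S \<and> J_below S c d \<and> J_below S d c"

text \<open>
  Elements that are not above \<open>c\<close> are collapsed to a zero; elements above \<open>c\<close> are identified
  when they act in the same way, by left and by right multiplication, on the \<open>\<J>\<close>-class of \<open>c\<close>.
\<close>

definition J_action_eq :: "'a \<Rightarrow> 'a \<Rightarrow> 'a \<Rightarrow> bool" where
  "J_action_eq c s t \<longleftrightarrow>
     (if J_below S c s then J_below S c t \<and> (\<forall>p. same_J c p \<longrightarrow> p \<odot> s = p \<odot> t \<and> s \<odot> p = t \<odot> p)
      else \<not> J_below S c t)"

lemma J_action_refl: "J_action_eq c s s"
  by (simp add: J_action_eq_def)

lemma J_action_sym: "J_action_eq c s t \<Longrightarrow> J_action_eq c t s"
  by (auto simp: J_action_eq_def split: if_splits)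

lemma J_action_trans: "J_action_eq c s t \<Longrightarrow> J_action_eq c t w \<Longrightarrow> J_action_eq c s w"
  by (auto simp: J_action_eq_def split: if_splits)

lemma same_J_mult:
  assumes "same_J c d" "s \<in> carrier S" "c \<in> carrier S" "J_below S c s"
  shows "same_J c (d \<odot> s)" "same_J c (s \<odot> d)"
  using assms J_mult_left[of d s] J_mult_right[of s d] J_trans J_meet
  unfolding same_J_def by (meson closed)+

lemma J_action_mult:
  assumes c: "c \<in> carrier S" "s \<in> carrier S" "s' \<in> carrier S" "t \<in> carrier S" "t' \<in> carrier S"
    and eq: "J_action_eq c s s'" "J_action_eq c t t'"
  shows "J_action_eq c (s \<odot> t) (s' \<odot> t')"
proof (cases "J_below S c s \<and> J_below S c t")
  case True
  then have above: "J_below S c s" "J_below S c t" "J_below S c s'" "J_below S c t'"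
    and act: "\<And>p. same_J c p \<Longrightarrow> p \<odot> s = p \<odot> s' \<and> s \<odot> p = s' \<odot> p"
      "\<And>p. same_J c p \<Longrightarrow> p \<odot> t = p \<odot> t' \<and> t \<odot> p = t' \<odot> p"
    using eq by (auto simp: J_action_eq_def)
  have "p \<odot> (s \<odot> t) = p \<odot> (s' \<odot> t') \<and> (s \<odot> t) \<odot> p = (s' \<odot> t') \<odot> p" if p: "same_J c p" for p
  proof -
    have pS: "p \<in> carrier S" using p by (simp add: same_J_def)
    have "p \<odot> (s \<odot> t) = p \<odot> s' \<odot> t" using act(1)[OF p] pS c by (simp add: assoc[symmetric])
    also have "\<dots> = p \<odot> s' \<odot> t'" using act(2)[of "p \<odot> s'"] same_J_mult[OF p] c above by simp
    finally have 1: "p \<odot> (s \<odot> t) = p \<odot> (s' \<odot> t')" using pS c by (simp add: assoc)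
    have "(s \<odot> t) \<odot> p = s \<odot> (t' \<odot> p)" using act(2)[OF p] pS c by (simp add: assoc)
    also have "\<dots> = s' \<odot> (t' \<odot> p)" using act(1)[of "t' \<odot> p"] same_J_mult[OF p] c above by simp
    finally show ?thesis using 1 pS c by (simp add: assoc)
  qed
  then show ?thesis using above c by (simp add: J_action_eq_def J_below_mult_iff)
next
  case False
  then have "\<not> (J_below S c s' \<and> J_below S c t')" using eq by (auto simp: J_action_eq_def split: if_splits)
  then show ?thesis using False c by (auto simp: J_action_eq_def J_below_mult_iff)
qed

lemma J_action_inject:
  assumes "c \<in> carrier S" "same_J c s" "same_J c t" "J_action_eq c s t"
  shows "s = t"
proof -
  have S: "s \<in> carrier S" "t \<in> carrier S" using assms by (auto simp: same_J_def)
  have eq: "s \<odot> s = s \<odot> t" "t \<odot> s = t \<odot> t" "s \<odot> s = t \<odot> s"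
    using assms by (auto simp: J_action_eq_def same_J_def)
  have l: "idm s \<odot> t = s"
  proof -
    obtain d where d: "d \<in> carrier S" "idm s = d \<odot> s" using idm_factor S by blast
    have "idm s \<odot> t = d \<odot> (s \<odot> t)" using d S by (simp add: assoc)
    also have "\<dots> = idm s \<odot> s" using d S eq(1) by (simp add: assoc)
    finally show ?thesis using S by simp
  qed
  have r: "s \<odot> idm t = t"
  proof -
    obtain d where d: "d \<in> carrier S" "idm t = t \<odot> d" using idm_factor S by blast
    have "s \<odot> idm t = (s \<odot> t) \<odot> d" using d S by (simp add: assoc)
    also have "\<dots> = t \<odot> idm t" using d S eq by (simp add: assoc[symmetric])
    finally show ?thesis using S by simp
  qed
  have "idm s \<odot> t = t" using r S by (metis assoc idm_left pow_closed)
  then show ?thesis using l by simp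
qed

text \<open>
  The element \<open>s\<close> acts on the \<open>\<J>\<close>-class of \<open>c\<close> like \<open>s f\<close>, where \<open>f\<close> is the idempotent of this
  class below \<open>idm s\<close>; it is unique because local idempotents commute.
\<close>

lemma J_action_representative:
  assumes LC: "locally_commuting S" and c: "c \<in> carrier S" and s: "s \<in> carrier S" "J_below S c s"
  shows "\<exists>d. same_J c d \<and> J_action_eq c s d"
proof -
  define e where "e = idm s"
  have e: "e \<in> carrier S" "e \<odot> e = e" "e \<odot> s = s" "s \<odot> e = s" using s by (auto simp: e_def)
  have ce: "J_below S c e" using s J_idm J_trans e(1) by (auto simp: e_def)
  define f where "f = idm (e \<odot> c \<odot> e)"
  have J_idm_mem: "same_J c (idm d)" if "same_J c d" for d
    using that J_idm J_trans c unfolding same_J_def by (meson pow_closed)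
  have "same_J c c" using c J_refl by (simp add: same_J_def)
  then have Df: "same_J c f"
    unfolding f_def using J_idm_mem same_J_mult[of c _ e] c e ce by blast
  have f: "f \<in> carrier S" "f \<odot> f = f" "e \<odot> f = f" "f \<odot> e = f"
    using e c idm_absorb_left[of e "e \<odot> c \<odot> e"] idm_absorb_right[of e "e \<odot> c \<odot> e"]
    by (auto simp: f_def assoc) (simp_all add: assoc[symmetric])
  have unique: "g = f" if g: "same_J c g" "g \<odot> g = g" "e \<odot> g = g" "g \<odot> e = g" for g
  proof (rule local_idempotent_unique[OF LC e(1) _ f(1) e(2) _ f(2)])
    show "J_below S g f" "J_below S f g"
      using g(1) Df J_trans f(1) unfolding same_J_def by blast+
  qed (use g f in \<open>auto simp: idempotent_le_def same_J_def\<close>)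
  have unique_idm: "idm g = f" if g: "same_J c g" "e \<odot> g = g" "g \<odot> e = g" for g
    using g J_idm_mem e(1) idm_absorb_left[of e g] idm_absorb_right[of e g]
    by (intro unique) (auto simp: same_J_def)
  have sf: "same_J c (s \<odot> f)" "same_J c (f \<odot> s)" using same_J_mult[OF Df s(1) c s(2)] by blast+
  have "idm (s \<odot> f) = f" using sf e f s(1) by (intro unique_idm) (simp_all add: assoc, simp_all add: assoc[symmetric])
  then have "f \<odot> (s \<odot> f) = s \<odot> f" using idm_left[of "s \<odot> f"] s f by simp
  moreover have "idm (f \<odot> s) = f" using sf e f s(1) by (intro unique_idm) (simp_all add: assoc, simp_all add: assoc[symmetric])
  then have "(f \<odot> s) \<odot> f = f \<odot> s" using idm_right[of "f \<odot> s"] s f by simp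
  ultimately have comm: "s \<odot> f = f \<odot> s" using s f by (simp add: assoc)
  have "p \<odot> s = p \<odot> (s \<odot> f) \<and> s \<odot> p = (s \<odot> f) \<odot> p" if p: "same_J c p" for p
  proof
    have pS: "p \<in> carrier S" using p by (simp add: same_J_def)
    define h where "h = idm (p \<odot> s)"
    have h: "h \<in> carrier S" "h \<odot> h = h" "h \<odot> e = h" "p \<odot> s \<odot> h = p \<odot> s"
      using pS s(1) e idm_absorb_right[of e "p \<odot> s"] by (simp_all add: h_def assoc)
    have Dh: "same_J c h" unfolding h_def using J_idm_mem same_J_mult[OF p s(1) c s(2)] by blast
    have "e \<odot> h = f"
    proof (rule unique)
      show "same_J c (e \<odot> h)" using same_J_mult(2)[OF Dh e(1) c ce] .
      show "e \<odot> h \<odot> (e \<odot> h) = e \<odot> h" using h e by (metis assoc closed)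
    qed (use h e in \<open>simp_all add: assoc, simp_all add: assoc[symmetric]\<close>)
    then have "p \<odot> (s \<odot> f) = p \<odot> (s \<odot> e) \<odot> h" using pS s(1) e(1) h(1) by (simp add: assoc)
    then show "p \<odot> s = p \<odot> (s \<odot> f)" using e(4) h(4) by simp
    define k where "k = idm (s \<odot> p)"
    have k: "k \<in> carrier S" "k \<odot> k = k" "e \<odot> k = k" "k \<odot> (s \<odot> p) = s \<odot> p"
      using pS s(1) e idm_absorb_left[of e "s \<odot> p"] idm_left[of "s \<odot> p"]
      by (simp_all add: k_def assoc[of e s p, symmetric] del: idm_left)
    have Dk: "same_J c k" unfolding k_def using J_idm_mem same_J_mult[OF p s(1) c s(2)] by blast
    have "k \<odot> e = f"
    proof (rule unique)
      show "same_J c (k \<odot> e)" using same_J_mult(1)[OF Dk e(1) c ce] .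
      show "k \<odot> e \<odot> (k \<odot> e) = k \<odot> e" using k e by (metis assoc closed)
    qed (use k e in \<open>simp_all add: assoc, simp_all add: assoc[symmetric]\<close>)
    then have "(f \<odot> s) \<odot> p = (k \<odot> e \<odot> s) \<odot> p" by simp
    also have "\<dots> = k \<odot> (e \<odot> s \<odot> p)" using pS s(1) e(1) k(1) by (simp add: assoc)
    finally have "(f \<odot> s) \<odot> p = k \<odot> (e \<odot> s \<odot> p)" .
    then show "s \<odot> p = (s \<odot> f) \<odot> p" using e(3) k(4) comm by simp
  qed
  moreover have "J_below S c (s \<odot> f)" using sf by (simp add: same_J_def)
  ultimately show ?thesis using sf(1) s(2) by (auto simp: J_action_eq_def)
qed

text \<open>
  The image of the \<open>\<J>\<close>-class of \<open>c\<close> exhausts the quotient up to a zero, so every ideal that meets it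
  is everything. As the quotient map is injective on this class, its idempotents remain primitive.
\<close>

lemma completely_zero_simple_quotient:
  assumes LC: "locally_commuting S" and c: "c \<in> carrier S"
    and hom: "h \<in> sg_hom S T" "h ` carrier S = carrier T"
    and kernel: "\<And>s t. s \<in> carrier S \<Longrightarrow> t \<in> carrier S \<Longrightarrow> h s = h t \<longleftrightarrow> J_action_eq c s t"
  shows "completely_zero_simple T"
proof -
  have T: "is_semigroup T" using semigroup_surjective_image[OF semigroup hom] .
  then interpret T: semigrp T by unfold_locales
  note mult = hom_mult[OF hom(1), symmetric]
  have same_JS: "d \<in> carrier S" if "same_J c d" for d using that by (simp add: same_J_def)
  have cases: "(\<exists>d. same_J c d \<and> x = h d) \<or> (\<exists>i\<in>carrier S. \<not> J_below S c i \<and> x = h i)" if "x \<in> carrier T" for x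
  proof -
    obtain s where s: "s \<in> carrier S" "x = h s" using \<open>x \<in> carrier T\<close> hom(2) by blast
    show ?thesis
    proof (cases "J_below S c s")
      case True
      then obtain d where "same_J c d" "J_action_eq c s d" using J_action_representative[OF LC c s(1)] by blast
      then show ?thesis using s kernel same_JS by blast
    qed (use s in blast)
  qed
  have zero: "is_zero T (h i)" if i: "i \<in> carrier S" "\<not> J_below S c i" for i
  proof -
    have "h s \<odot>\<^bsub>T\<^esub> h i = h i \<and> h i \<odot>\<^bsub>T\<^esub> h s = h i" if s: "s \<in> carrier S" for s
      using i s kernel c by (simp add: mult J_action_eq_def J_below_mult_iff)
    then show ?thesis unfolding is_zero_def hom(2)[symmetric] using i by auto
  qed
  have full: "I = carrier T" if I: "is_ideal T I" and d: "same_J c d" "h d \<in> I" for I d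
  proof
    show "I \<subseteq> carrier T" using I by (simp add: is_ideal_def)
    have left: "h s \<odot>\<^bsub>T\<^esub> x \<in> I" and right: "x \<odot>\<^bsub>T\<^esub> h s \<in> I" if "s \<in> carrier S" "x \<in> I" for s x
      using I that hom_closed[OF hom(1)] by (auto simp: is_ideal_def)
    show "carrier T \<subseteq> I"
    proof
      fix x assume "x \<in> carrier T"
      then consider d' where "same_J c d'" "x = h d'" | i where "i \<in> carrier S" "\<not> J_below S c i" "x = h i"
        using cases by blast
      then show "x \<in> I"
      proof cases
        case 1
        then have "J_below S d' d" using d J_trans same_JS by (meson same_J_def)
        then obtain u v where "u \<in> carrier S" "v \<in> carrier S" "d' = u \<odot> d \<odot> v"
          unfolding J_below_def by blast
        then have "x = h u \<odot>\<^bsub>T\<^esub> h d \<odot>\<^bsub>T\<^esub> h v" using 1 same_JS[OF d(1)] by (simp add: hom_mult[OF hom(1)])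
        then show ?thesis using left right d \<open>u \<in> carrier S\<close> \<open>v \<in> carrier S\<close> by simp
      next
        case 2
        then have "h i \<odot>\<^bsub>T\<^esub> h d = x" using zero[of i] hom_closed[OF hom(1) same_JS[OF d(1)]] by (simp add: is_zero_def)
        then show ?thesis using left 2 d by metis
      qed
    qed
  qed
  have "zero_simple T"
    unfolding zero_simple_def
  proof (intro conjI allI impI T)
    fix I assume I: "is_ideal T I"
    show "I = carrier T \<or> (\<exists>z. is_zero T z \<and> I = {z})"
    proof (cases "\<exists>d. same_J c d \<and> h d \<in> I")
      case True
      then show ?thesis using full[OF I] by blast
    next
      case False
      have "is_zero T x" if "x \<in> I" for x
      proof -
        have "x \<in> carrier T" using I that by (auto simp: is_ideal_def)
        then show ?thesis using cases[of x] zero False that by blast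
      qed
      moreover have "I \<noteq> {}" using I by (simp add: is_ideal_def)
      ultimately show ?thesis using is_zero_unique by (metis is_singletonI' is_singletonE singletonI)
    qed
  qed
  moreover have "\<exists>e\<in>nonzero_idempotents T. \<forall>f\<in>nonzero_idempotents T. idempotent_le T f e \<longrightarrow> f = e"
  proof
    define e where "e = idm c"
    have e: "e \<in> carrier S" "e \<odot> e = e" using c by (auto simp: e_def)
    have De: "same_J c e" using c J_idm by (simp add: same_J_def e_def)
    have whole: "carrier T = {x}" if "same_J c d" "x = h d" "is_zero T x" for x d
    proof -
      have "is_ideal T {x}" using that(3) by (simp add: is_ideal_def is_zero_def)
      then show ?thesis using full[of "{x}" d] that by simp
    qed
    show "h e \<in> nonzero_idempotents T"
      using e hom_closed[OF hom(1)] whole[OF De refl] by (simp add: nonzero_idempotents_def mult)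
    show "\<forall>f\<in>nonzero_idempotents T. idempotent_le T f (h e) \<longrightarrow> f = h e"
    proof (intro ballI impI)
      fix f assume f: "f \<in> nonzero_idempotents T" and le: "idempotent_le T f (h e)"
      then have fT: "f \<in> carrier T" "f \<odot>\<^bsub>T\<^esub> f = f" "is_zero T f \<longrightarrow> carrier T = {f}"
        by (auto simp: nonzero_idempotents_def)
      consider d where "same_J c d" "f = h d" | i where "i \<in> carrier S" "\<not> J_below S c i" "f = h i"
        using cases[OF fT(1)] by blast
      then show "f = h e"
      proof cases
        case 1
        have dS: "d \<in> carrier S" using 1 same_JS by blast
        have above: "J_below S c d" "J_below S c e" using 1 De by (auto simp: same_J_def)
        have lift: "p = q" if "same_J c p" "same_J c q" "h p = h q" for p q
          using J_action_inject[OF c that(1,2)] kernel same_JS that by blast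
        have "d \<odot> d = d" "d \<odot> e = d" "e \<odot> d = d"
          using 1 dS e fT(2) le same_J_mult[OF 1(1) dS c above(1)] same_J_mult[OF 1(1) e(1) c above(2)]
          by (auto intro!: lift simp: mult idempotent_le_def)
        moreover have "J_below S d e" "J_below S e d"
          using J_trans[of d c e] J_trans[of e c d] 1(1) De dS e(1) by (simp_all add: same_J_def)
        ultimately have "d = e" using dS e by (intro primitive_in_J[of d e]) simp_all
        then show ?thesis using 1 by simp
      next
        case 2
        then have "carrier T = {f}" using zero fT by blast
        then show ?thesis using hom_closed[OF hom(1) e(1)] by simp
      qed
    qed
  qed
  ultimately show ?thesis by (simp add: completely_zero_simple_def)
qed

text \<open>
  For \<open>u \<noteq> v\<close> one of the two, called \<open>c\<close>, is either not below the other or in the same \<open>\<J>\<close>-class;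
  in both cases the quotient for this \<open>c\<close> separates \<open>u\<close> from \<open>v\<close>. Choosing representatives of the
  classes keeps the quotient inside the type of \<open>S\<close>.
\<close>

lemma separating_quotient:
  assumes LC: "locally_commuting S" and uv: "u \<in> carrier S" "v \<in> carrier S" "u \<noteq> v"
  shows "\<exists>(T :: 'a sgrp) f. completely_zero_simple T \<and> f \<in> sg_hom S T \<and> f ` carrier S = carrier T \<and> f u \<noteq> f v"
proof -
  have "\<exists>c\<in>carrier S. \<not> J_action_eq c u v"
  proof (cases "J_below S u v \<and> J_below S v u")
    case True
    then have "same_J u u" "same_J u v" using uv J_refl by (auto simp: same_J_def)
    then show ?thesis using J_action_inject uv by blast
  next
    case False
    then show ?thesis using uv J_refl[of u] J_refl[of v] unfolding J_action_eq_def by meson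
  qed
  then obtain c where c: "c \<in> carrier S" "\<not> J_action_eq c u v" by blast
  define r where "r s = (SOME t. t \<in> carrier S \<and> J_action_eq c s t)" for s
  have r: "r s \<in> carrier S \<and> J_action_eq c s (r s)" if "s \<in> carrier S" for s
    unfolding r_def by (rule someI[of _ s]) (simp add: that J_action_refl)
  have kernel: "r s = r t \<longleftrightarrow> J_action_eq c s t" if "s \<in> carrier S" "t \<in> carrier S" for s t
  proof
    assume "r s = r t"
    then show "J_action_eq c s t" using r[OF that(1)] r[OF that(2)] J_action_sym J_action_trans by metis
  next
    assume "J_action_eq c s t"
    then have "J_action_eq c s = J_action_eq c t" using J_action_sym J_action_trans by blast
    then show "r s = r t" by (simp add: r_def)
  qed
  have "kernel_congruence S r"
    unfolding kernel_congruence_def using kernel J_action_mult[OF c(1)] by simp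
  then have hom: "r \<in> sg_hom S (sg_image S r)" by (rule sg_image_hom)
  have surj: "r ` carrier S = carrier (sg_image S r)" by simp
  have "completely_zero_simple (sg_image S r)"
    using completely_zero_simple_quotient[OF LC c(1) hom surj kernel] .
  moreover have "r u \<noteq> r v" using kernel[OF uv(1,2)] c(2) by blast
  ultimately show ?thesis using hom surj by blast
qed

end



section \<open>Varieties and their free semigroups\<close>

lemma variety_semigroup: "variety V \<Longrightarrow> S \<in> V \<Longrightarrow> is_semigroup S"
  by (auto simp: variety_def)

lemma variety_surjective_image:
  assumes "variety V" "S \<in> V" "h \<in> sg_hom S T" "h ` carrier S = carrier T"
  shows "T \<in> V"
proof -
  obtain \<Sigma> where V: "V = {S. is_semigroup S \<and> (\<forall>\<epsilon>\<in>\<Sigma>. satisfies S \<epsilon>)}"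
    using assms(1) by (auto simp: variety_def)
  then have S: "is_semigroup S" "\<forall>\<epsilon>\<in>\<Sigma>. satisfies S \<epsilon>" using assms(2) by auto
  show ?thesis
    unfolding V using S satisfies_surjective_image[OF S(1) assms(3,4)]
      semigroup_surjective_image[OF S(1) assms(3,4)] by blast
qed

lemma variety_memI:
  assumes "variety V" "is_semigroup S"
    and "\<And>p q. p \<noteq> [] \<Longrightarrow> q \<noteq> [] \<Longrightarrow> holds_in V (p, q) \<Longrightarrow> satisfies S (p, q)"
  shows "S \<in> V"
proof -
  obtain \<Sigma> where \<Sigma>: "\<forall>\<epsilon>\<in>\<Sigma>. proper_identity \<epsilon>"
    and V: "V = {S. is_semigroup S \<and> (\<forall>\<epsilon>\<in>\<Sigma>. satisfies S \<epsilon>)}"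
    using assms(1) by (auto simp: variety_def)
  have "satisfies S \<epsilon>" if "\<epsilon> \<in> \<Sigma>" for \<epsilon>
  proof -
    obtain p q where "\<epsilon> = (p, q)" by force
    moreover have "holds_in V \<epsilon>" using that V by (auto simp: holds_in_def)
    ultimately show ?thesis using assms(3)[of p q] \<Sigma> that by (auto simp: proper_identity_def)
  qed
  then show ?thesis using assms(2) V by simp
qed

lemma holds_in_iff:
  "holds_in V (p, q) \<longleftrightarrow> (\<forall>S\<in>V. \<forall>\<phi>\<in>UNIV \<rightarrow> carrier S. sg_eval S \<phi> p = sg_eval S \<phi> q)"
  by (simp add: holds_in_def satisfies_def holds_under_def)

lemma infinite_inj_nat: "\<exists>j :: nat \<Rightarrow> 'u::infinite. inj j"
  using infinite_countable_subset[OF infinite_UNIV] by blast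

text \<open>If \<open>T\<close> satisfied all identities of \<open>V\<close>, then so would its copy inside the universe.\<close>

lemma separating_identity:
  fixes V :: "('u::infinite) sgrp set"
  assumes V: "variety V" and T: "is_semigroup T" "finite (carrier T)" and "\<not> contains_copy V T"
  obtains p q where "p \<noteq> []" "q \<noteq> []" "holds_in V (p, q)" "\<not> satisfies T (p, q)"
proof -
  have "contains_copy V T"
    if *: "\<And>p q. p \<noteq> [] \<Longrightarrow> q \<noteq> [] \<Longrightarrow> holds_in V (p, q) \<Longrightarrow> satisfies T (p, q)"
  proof -
    obtain i :: "_ \<Rightarrow> nat" where i: "inj_on i (carrier T)"
      using finite_imp_inj_to_nat_seg[OF T(2)] by blast
    obtain j :: "nat \<Rightarrow> 'u" where j: "inj j" using infinite_inj_nat by blast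
    define r where "r = j \<circ> i"
    have r: "inj_on r (carrier T)"
      unfolding r_def using i j by (metis comp_inj_on inj_on_subset subset_UNIV)
    then have "kernel_congruence T r" unfolding kernel_congruence_def inj_on_def by metis
    note hom = sg_image_hom[OF this]
    have surj: "r ` carrier T = carrier (sg_image T r)" by simp
    have "sg_image T r \<in> V"
    proof (rule variety_memI[OF V])
      show "is_semigroup (sg_image T r)" using semigroup_surjective_image[OF T(1) hom surj] .
      show "satisfies (sg_image T r) (p, q)" if "p \<noteq> []" "q \<noteq> []" "holds_in V (p, q)" for p q
        using satisfies_surjective_image[OF T(1) hom surj] * that by blast
    qed
    moreover have "sg_isomorphic T (sg_image T r)"
      unfolding sg_isomorphic_def using hom r by (auto simp: bij_betw_def)
    then obtain g where "g \<in> sg_hom (sg_image T r) T" "bij_betw g (carrier (sg_image T r)) (carrier T)"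
      using isomorphic_imp_embedding T(1) by blast
    then have "sg_isomorphic (sg_image T r) T" by (auto simp: sg_isomorphic_def)
    ultimately show ?thesis by (auto simp: contains_copy_def)
  qed
  then show thesis using assms(4) that by blast
qed

lemma contains_copyE:
  assumes "contains_copy V T" "variety V"
  obtains S g where "S \<in> V" "is_semigroup S" "g \<in> sg_hom T S" "bij_betw g (carrier T) (carrier S)"
proof -
  obtain S where S: "S \<in> V" "sg_isomorphic S T" using assms(1) by (auto simp: contains_copy_def)
  show thesis
    using isomorphic_imp_embedding[OF S(2)] variety_semigroup[OF assms(2) S(1)] S(1) that by metis
qed

lemma not_contains_copyI:
  assumes V: "variety V"
    and "\<And>S g. S \<in> V \<Longrightarrow> is_semigroup S \<Longrightarrow> g \<in> sg_hom T S \<Longrightarrow> inj_on g (carrier T) \<Longrightarrow> False"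
  shows "\<not> contains_copy V T"
  using contains_copyE[OF _ V, of T] assms(2) by (metis bij_betw_def)

text \<open>The semigroup of nonempty words in the letters \<open>0, \<dots>, k - 1\<close>.\<close>

definition word_sgrp :: "nat \<Rightarrow> sg_word sgrp" where
  "word_sgrp k = \<lparr>carrier = {w. w \<noteq> [] \<and> set w \<subseteq> {..<k}}, mul = (@)\<rparr>"

lemma word_sgrp_semigroup: "k > 0 \<Longrightarrow> is_semigroup (word_sgrp k)"
  by (auto simp: is_semigroup_def word_sgrp_def intro!: exI[of _ "[0]"])

lemma eval_hom_word_sgrp:
  assumes "is_semigroup S" "\<phi> \<in> UNIV \<rightarrow> carrier S"
  shows "sg_eval S \<phi> \<in> sg_hom (word_sgrp k) S"
proof -
  interpret semigrp S by unfold_locales fact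
  show ?thesis using assms(2) by (auto simp: sg_hom_def word_sgrp_def eval_append eval_closed)
qed

lemma generated_eval_subset:
  assumes "w \<noteq> []" "\<And>i. i \<in> set w \<Longrightarrow> \<phi> i \<in> X"
  shows "sg_eval S \<phi> w \<in> sg_generated S X"
  using assms
  by (induction w rule: nonempty_snoc_induct) (auto simp: eval_snoc intro: sg_generated.intros)

text \<open>
  Words modulo the identities of \<open>V\<close>, with representatives coded into the universe, form a free
  semigroup of \<open>V\<close> on \<open>k\<close> generators. An equation between generators is an identity of \<open>V\<close>.
\<close>

lemma free_semigroup_exists:
  fixes V :: "('u::infinite) sgrp set"
  assumes V: "variety V" and k: "k > 0"
  obtains F \<phi> where "F \<in> V" "free_in V F" "finitely_generated F" "\<phi> \<in> UNIV \<rightarrow> carrier F"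
    "\<forall>a\<in>carrier F. \<exists>w. w \<noteq> [] \<and> set w \<subseteq> {..<k} \<and> a = sg_eval F \<phi> w"
    "\<forall>p q. p \<noteq> [] \<and> q \<noteq> [] \<and> set p \<subseteq> {..<k} \<and> set q \<subseteq> {..<k} \<and>
       sg_eval F \<phi> p = sg_eval F \<phi> q \<longrightarrow> holds_in V (p, q)"
proof -
  let ?W = "word_sgrp k"
  have W: "is_semigroup ?W" using word_sgrp_semigroup[OF k] .
  have carrier_W: "w \<in> carrier ?W \<longleftrightarrow> w \<noteq> [] \<and> set w \<subseteq> {..<k}" for w
    by (simp add: word_sgrp_def)
  obtain j :: "nat \<Rightarrow> 'u" where j: "inj j" using infinite_inj_nat by blast
  define rep where "rep w = (SOME v. v \<in> carrier ?W \<and> holds_in V (w, v))" for w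
  define r :: "sg_word \<Rightarrow> 'u" where "r w = j (to_nat (rep w))" for w
  have kernel: "r p = r q \<longleftrightarrow> holds_in V (p, q)" if "p \<in> carrier ?W" "q \<in> carrier ?W" for p q
  proof
    have some: "holds_in V (w, rep w)" if "w \<in> carrier ?W" for w
      unfolding rep_def
      by (rule conjunct2, rule someI[of _ w]) (simp add: that holds_in_iff)
    assume "r p = r q"
    then have "rep p = rep q" using j by (simp add: r_def inj_eq)
    then show "holds_in V (p, q)" using some[OF that(1)] some[OF that(2)] by (simp add: holds_in_iff)
  next
    assume "holds_in V (p, q)"
    then have "holds_in V (p, v) \<longleftrightarrow> holds_in V (q, v)" for v by (simp add: holds_in_iff)
    then show "r p = r q" by (simp add: r_def rep_def)
  qed
  have "kernel_congruence ?W r"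
    unfolding kernel_congruence_def
  proof (intro ballI impI)
    fix x x' y y' assume c: "x \<in> carrier ?W" "x' \<in> carrier ?W" "y \<in> carrier ?W" "y' \<in> carrier ?W"
      and eq: "r x = r x'" "r y = r y'"
    have "holds_in V (x @ y, x' @ y')"
      unfolding holds_in_iff
    proof (intro ballI)
      fix S and \<phi> :: "nat \<Rightarrow> 'u" assume S: "S \<in> V" and \<phi>: "\<phi> \<in> UNIV \<rightarrow> carrier S"
      interpret semigrp S using variety_semigroup[OF V S] by unfold_locales
      show "sg_eval S \<phi> (x @ y) = sg_eval S \<phi> (x' @ y')"
        using eq c kernel S \<phi> by (simp add: eval_append carrier_W holds_in_iff)
    qed
    then show "r (x \<odot>\<^bsub>?W\<^esub> y) = r (x' \<odot>\<^bsub>?W\<^esub> y')"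
      using kernel[of "x @ y" "x' @ y'"] c by (simp add: word_sgrp_def)
  qed
  note hom = sg_image_hom[OF this]
  define F where "F = sg_image ?W r"
  have hom: "r \<in> sg_hom ?W F" using hom by (simp add: F_def)
  have surj: "r ` carrier ?W = carrier F" by (simp add: F_def)
  have F: "is_semigroup F" using semigroup_surjective_image[OF W hom surj] .
  interpret F: semigrp F using F by unfold_locales
  have FV: "F \<in> V"
  proof (rule variety_memI[OF V F])
    fix p q :: sg_word assume pq: "p \<noteq> []" "q \<noteq> []" "holds_in V (p, q)"
    show "satisfies F (p, q)"
      unfolding satisfies_def
    proof
      fix \<psi> :: "nat \<Rightarrow> _" assume "\<psi> \<in> UNIV \<rightarrow> carrier F"
      then obtain \<sigma> where \<sigma>: "\<sigma> \<in> UNIV \<rightarrow> carrier ?W" "\<psi> = r \<circ> \<sigma>"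
        using surjective_hom_lift[OF surj] by metis
      have "holds_in V (sg_eval ?W \<sigma> p, sg_eval ?W \<sigma> q)"
        unfolding holds_in_iff
      proof (intro ballI)
        fix S and \<phi> :: "nat \<Rightarrow> 'u" assume S: "S \<in> V" and \<phi>: "\<phi> \<in> UNIV \<rightarrow> carrier S"
        have h: "sg_eval S \<phi> \<in> sg_hom ?W S"
          using eval_hom_word_sgrp[OF variety_semigroup[OF V S] \<phi>] .
        have "sg_eval S \<phi> \<circ> \<sigma> \<in> UNIV \<rightarrow> carrier S" using hom_closed[OF h] range_mem[OF \<sigma>(1)] by simp
        then show "sg_eval S \<phi> (sg_eval ?W \<sigma> p) = sg_eval S \<phi> (sg_eval ?W \<sigma> q)"
          using pq(3) S by (simp add: hom_eval[OF W h \<sigma>(1)] holds_in_iff)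
      qed
      moreover have "sg_eval ?W \<sigma> w \<in> carrier ?W" for w
        using W \<sigma>(1) by (intro semigrp.eval_closed) (simp_all add: semigrp_def)
      ultimately have "r (sg_eval ?W \<sigma> p) = r (sg_eval ?W \<sigma> q)" using kernel by simp
      then show "holds_under F \<psi> (p, q)"
        by (simp add: holds_under_def \<sigma>(2) hom_eval[OF W hom \<sigma>(1)])
    qed
  qed
  \<comment> \<open>Assignments are total, so the variables from \<open>k\<close> on also need a value in \<open>F\<close>.\<close>
  define gen where "gen i = (if i < k then [i] else [0])" for i :: nat
  define \<phi> where "\<phi> = r \<circ> gen"
  have gen: "gen \<in> UNIV \<rightarrow> carrier ?W" using k by (auto simp: gen_def carrier_W)
  have \<phi>: "\<phi> \<in> UNIV \<rightarrow> carrier F" using hom_closed[OF hom] range_mem[OF gen] by (simp add: \<phi>_def)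
  have eval_gen: "sg_eval ?W gen w = w" if "w \<noteq> []" "set w \<subseteq> {..<k}" for w
    using that
    by (induction w rule: nonempty_snoc_induct) (auto simp: eval_snoc gen_def word_sgrp_def)
  have eval_r: "sg_eval F \<phi> w = r w" if "w \<in> carrier ?W" for w
    using that eval_gen[of w] hom_eval[OF W hom gen, of w] by (simp add: \<phi>_def carrier_W)
  have word: "\<exists>w. w \<noteq> [] \<and> set w \<subseteq> {..<k} \<and> a = sg_eval F \<phi> w" if "a \<in> carrier F" for a
  proof -
    obtain w where w: "w \<in> carrier ?W" "a = r w" using \<open>a \<in> carrier F\<close> surj by blast
    then show ?thesis using eval_r[OF w(1)] by (intro exI[of _ w]) (simp add: carrier_W)
  qed
  have gens: "finite (\<phi> ` {..<k})" "\<phi> ` {..<k} \<subseteq> carrier F" using \<phi> by auto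
  have "finitely_generated F"
  proof -
    have "sg_generated F (\<phi> ` {..<k}) = carrier F"
    proof
      show "sg_generated F (\<phi> ` {..<k}) \<subseteq> carrier F"
      proof
        fix x assume "x \<in> sg_generated F (\<phi> ` {..<k})"
        then show "x \<in> carrier F" by induction (use gens(2) in auto)
      qed
      show "carrier F \<subseteq> sg_generated F (\<phi> ` {..<k})"
      proof
        fix x assume "x \<in> carrier F"
        then obtain w where "w \<noteq> []" "set w \<subseteq> {..<k}" "x = sg_eval F \<phi> w" using word by blast
        then show "x \<in> sg_generated F (\<phi> ` {..<k})"
          using generated_eval_subset[of w \<phi> "\<phi> ` {..<k}" F] by blast
      qed
    qed
    then show ?thesis using gens by (auto simp: finitely_generated_def)
  qed
  moreover have "free_on V F (\<phi> ` {..<k})"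
    unfolding free_on_def
  proof (intro conjI ballI FV gens(2))
    show "\<phi> ` {..<k} \<noteq> {}" using k by auto
    fix T \<psi> assume T: "T \<in> V" and \<psi>: "\<psi> \<in> \<phi> ` {..<k} \<rightarrow> carrier T"
    interpret T: semigrp T using variety_semigroup[OF V T] by unfold_locales
    define \<chi> where "\<chi> i = \<psi> (\<phi> (if i < k then i else 0))" for i
    have \<chi>: "\<chi> \<in> UNIV \<rightarrow> carrier T" using \<psi> k by (auto simp: \<chi>_def)
    have h\<chi>: "sg_eval T \<chi> \<in> sg_hom ?W T" using eval_hom_word_sgrp[OF T.semigroup \<chi>] .
    define h where "h = (\<lambda>a\<in>carrier F. sg_eval T \<chi> (inv_into (carrier ?W) r a))"
    have h_r: "h (r w) = sg_eval T \<chi> w" if w: "w \<in> carrier ?W" for w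
    proof -
      let ?v = "inv_into (carrier ?W) r (r w)"
      have "?v \<in> carrier ?W" "r ?v = r w" using w by (auto intro: inv_into_into f_inv_into_f)
      then have "holds_in V (?v, w)" using kernel w by blast
      then show ?thesis using T \<chi> w surj by (auto simp: h_def holds_in_iff)
    qed
    have h_hom: "h \<in> sg_hom F T"
      unfolding sg_hom_def
    proof (intro CollectI conjI ballI funcsetI)
      fix x assume "x \<in> carrier F"
      then show "h x \<in> carrier T" using h_r hom_closed[OF h\<chi>] unfolding surj[symmetric] by auto
    next
      fix x y assume "x \<in> carrier F" "y \<in> carrier F"
      then obtain u v where "u \<in> carrier ?W" "v \<in> carrier ?W" "x = r u" "y = r v"
        unfolding surj[symmetric] by auto
      then show "h (x \<odot>\<^bsub>F\<^esub> y) = h x \<odot>\<^bsub>T\<^esub> h y"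
        using h_r[of "u \<odot>\<^bsub>?W\<^esub> v"] W
        by (simp add: hom_mult[OF hom, symmetric] h_r hom_mult[OF h\<chi>] is_semigroup_def)
    qed
    have h_gen: "h x = \<psi> x" if x: "x \<in> \<phi> ` {..<k}" for x
    proof -
      obtain i where i: "i < k" "x = \<phi> i" using x by auto
      then have "h x = sg_eval T \<chi> [i]" using h_r[of "[i]"] by (simp add: \<phi>_def gen_def carrier_W)
      then show ?thesis using i by (simp add: \<chi>_def)
    qed
    show "\<exists>!h. h \<in> sg_hom F T \<and> h \<in> extensional (carrier F) \<and> (\<forall>x\<in>\<phi> ` {..<k}. h x = \<psi> x)"
    proof (rule ex1I[of _ h])
      show "h \<in> sg_hom F T \<and> h \<in> extensional (carrier F) \<and> (\<forall>x\<in>\<phi> ` {..<k}. h x = \<psi> x)"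
        using h_hom h_gen by (auto simp: h_def)
      fix g assume g: "g \<in> sg_hom F T \<and> g \<in> extensional (carrier F) \<and> (\<forall>x\<in>\<phi> ` {..<k}. g x = \<psi> x)"
      show "g = h"
      proof (rule extensionalityI[of _ "carrier F"])
        fix a assume "a \<in> carrier F"
        then obtain w where w: "w \<noteq> []" "set w \<subseteq> {..<k}" "a = sg_eval F \<phi> w" using word by blast
        have "g a = sg_eval T (g \<circ> \<phi>) w" using g w(3) hom_eval[OF F _ \<phi>, of g T w] by blast
        also have "\<dots> = sg_eval T (h \<circ> \<phi>) w"
        proof (rule eval_cong[OF w(1)])
          fix i assume "i \<in> set w"
          then have "\<phi> i \<in> \<phi> ` {..<k}" using w(2) by auto
          then show "(g \<circ> \<phi>) i = (h \<circ> \<phi>) i" using g h_gen by auto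
        qed
        also have "\<dots> = h a" using h_hom w(3) hom_eval[OF F _ \<phi>, of h T w] by simp
        finally show "g a = h a" .
      qed (use g in \<open>auto simp: h_def\<close>)
    qed
  qed
  then have "free_in V F" by (auto simp: free_in_def)
  moreover have "holds_in V (p, q)"
    if "p \<noteq> []" "q \<noteq> []" "set p \<subseteq> {..<k}" "set q \<subseteq> {..<k}" "sg_eval F \<phi> p = sg_eval F \<phi> q" for p q
    using that eval_r[of p] eval_r[of q] kernel[of p q] by (simp add: carrier_W)
  ultimately show thesis using word by (intro that[OF FV _ _ \<phi>]) blast+
qed

lemma holds_in_power:
  fixes V :: "('u::infinite) sgrp set" and x :: nat
  assumes V: "variety V" and jk: "j > 0" "k > 0"
  shows "holds_in V (word_pow [x] j, word_pow [x] k) \<longleftrightarrow>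
    (\<forall>S\<in>V. \<forall>a\<in>carrier S. sg_pow S a j = sg_pow S a k)"
proof -
  have eval: "sg_eval S \<phi> (word_pow [x] i) = sg_pow S (\<phi> x) i"
    if "S \<in> V" "\<phi> \<in> UNIV \<rightarrow> carrier S" "i > 0" for S and \<phi> :: "nat \<Rightarrow> _" and i
  proof -
    interpret semigrp S using variety_semigroup[OF V that(1)] by unfold_locales
    show ?thesis using eval_word_pow[OF that(2) _ that(3), of "[x]"] by simp
  qed
  have "(\<forall>\<phi>\<in>UNIV \<rightarrow> carrier S. sg_eval S \<phi> (word_pow [x] j) = sg_eval S \<phi> (word_pow [x] k)) \<longleftrightarrow>
      (\<forall>a\<in>carrier S. sg_pow S a j = sg_pow S a k)" if S: "S \<in> V" for S
  proof
    assume L: "\<forall>\<phi>\<in>UNIV \<rightarrow> carrier S. sg_eval S \<phi> (word_pow [x] j) = sg_eval S \<phi> (word_pow [x] k)"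
    show "\<forall>a\<in>carrier S. sg_pow S a j = sg_pow S a k"
    proof
      fix a assume a: "a \<in> carrier S"
      have c: "(\<lambda>_. a) \<in> UNIV \<rightarrow> carrier S" using a by simp
      show "sg_pow S a j = sg_pow S a k" using L[rule_format, OF c] eval[OF S c] jk by simp
    qed
  next
    assume R: "\<forall>a\<in>carrier S. sg_pow S a j = sg_pow S a k"
    show "\<forall>\<phi>\<in>UNIV \<rightarrow> carrier S. sg_eval S \<phi> (word_pow [x] j) = sg_eval S \<phi> (word_pow [x] k)"
    proof
      fix \<phi> :: "nat \<Rightarrow> _" assume \<phi>: "\<phi> \<in> UNIV \<rightarrow> carrier S"
      then have "\<phi> x \<in> carrier S" by auto
      then show "sg_eval S \<phi> (word_pow [x] j) = sg_eval S \<phi> (word_pow [x] k)"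
        using R eval[OF S \<phi>] jk by simp
    qed
  qed
  then show ?thesis by (simp add: holds_in_iff)
qed

text \<open>
  Periodicity is uniform: a repetition among the powers of the generator of the one-generated
  free semigroup is an identity of the variety.
\<close>

lemma periodic_variety_power_law:
  assumes "periodic_variety V"
  obtains m n where "m > 0" "n > 0" "\<And>S. S \<in> V \<Longrightarrow> satisfies_power_law S m n"
proof -
  have V: "variety V" and per: "\<And>S. S \<in> V \<Longrightarrow> periodic S"
    using assms by (auto simp: periodic_variety_def)
  obtain F \<phi> where F: "F \<in> V" "\<phi> \<in> UNIV \<rightarrow> carrier F"
    and eq: "\<forall>p q. p \<noteq> [] \<and> q \<noteq> [] \<and> set p \<subseteq> {..<1} \<and> set q \<subseteq> {..<1} \<and>
       sg_eval F \<phi> p = sg_eval F \<phi> q \<longrightarrow> holds_in V (p, q)"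
    using free_semigroup_exists[OF V, of 1] by (metis zero_less_one)
  interpret F: semigrp F using variety_semigroup[OF V F(1)] by unfold_locales
  have a: "\<phi> 0 \<in> carrier F" using F(2) by auto
  have "sg_pow F (\<phi> 0) k \<in> sg_generated F {\<phi> 0}" for k
    by (induction k) (auto intro: sg_generated.intros)
  then have "(\<lambda>k. sg_pow F (\<phi> 0) (Suc k)) ` UNIV \<subseteq> sg_generated F {\<phi> 0}" by blast
  moreover have "finite (sg_generated F {\<phi> 0})" using per[OF F(1)] a by (simp add: periodic_def)
  ultimately have "finite (range (\<lambda>k. sg_pow F (\<phi> 0) (Suc k)))" by (rule finite_subset)
  then have "\<not> inj (\<lambda>k. sg_pow F (\<phi> 0) (Suc k))" using finite_imageD infinite_UNIV_nat by blast
  then obtain i j where ij: "i < j" "sg_pow F (\<phi> 0) (Suc i) = sg_pow F (\<phi> 0) (Suc j)"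
    by (metis injI linorder_neqE_nat)
  have set: "set (word_pow [0] k) \<subseteq> {..<1}" for k by (auto simp: word_pow_def)
  have "sg_eval F \<phi> (word_pow [0] (Suc i)) = sg_eval F \<phi> (word_pow [0] (Suc j))"
    using F.eval_word_pow[OF F(2), of "[0]"] ij(2) by (simp del: sg_pow.simps)
  then have "holds_in V (word_pow [0] (Suc i), word_pow [0] (Suc j))"
    using eq set by (simp add: word_pow_eq_Nil)
  then have *: "\<forall>S\<in>V. \<forall>a\<in>carrier S. sg_pow S a (Suc i) = sg_pow S a (Suc j)"
    using holds_in_power[OF V, of "Suc i" "Suc j" 0] by simp
  then have "satisfies_power_law S (Suc i) (j - i)" if "S \<in> V" for S
    using that ij(1) by (simp add: satisfies_power_law_def del: sg_pow.simps)
  then show thesis using that[of "Suc i" "j - i"] ij(1) by simp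
qed

lemma subdirect_product_iff:
  fixes S :: "'a sgrp"
  shows "subdirect_product_of S C \<longleftrightarrow>
    (\<forall>u\<in>carrier S. \<forall>v\<in>carrier S. u \<noteq> v \<longrightarrow>
       (\<exists>T\<in>C. \<exists>f\<in>sg_hom S T. f ` carrier S = carrier T \<and> f u \<noteq> f v))"
proof
  assume "subdirect_product_of S C"
  then obtain I :: "('a \<times> 'a) set" and T h where C: "\<forall>i\<in>I. T i \<in> C"
    and h: "h \<in> sg_hom S (sg_product I T)" "inj_on h (carrier S)"
    and surj: "\<forall>i\<in>I. (\<lambda>s. h s i) ` carrier S = carrier (T i)"
    unfolding subdirect_product_of_def by blast
  show "\<forall>u\<in>carrier S. \<forall>v\<in>carrier S. u \<noteq> v \<longrightarrow>
      (\<exists>T\<in>C. \<exists>f\<in>sg_hom S T. f ` carrier S = carrier T \<and> f u \<noteq> f v)"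
  proof (intro ballI impI)
    fix u v assume uv: "u \<in> carrier S" "v \<in> carrier S" "u \<noteq> v"
    then have "h u \<noteq> h v" using h(2) by (auto simp: inj_on_def)
    moreover have "h u \<in> extensional I" "h v \<in> extensional I"
      using hom_closed[OF h(1)] uv by (auto simp: sg_product_def PiE_def)
    ultimately obtain i where i: "i \<in> I" "h u i \<noteq> h v i" by (meson extensionalityI)
    have "(\<lambda>s. h s i) \<in> sg_hom S (T i)"
      using h(1) i(1) by (auto simp: sg_hom_def sg_product_def)
    moreover have "T i \<in> C" "(\<lambda>s. h s i) ` carrier S = carrier (T i)" using C surj i by auto
    ultimately show "\<exists>T\<in>C. \<exists>f\<in>sg_hom S T. f ` carrier S = carrier T \<and> f u \<noteq> f v"
      using i(2) by (intro bexI[of _ "T i"] bexI[of _ "\<lambda>s. h s i"] conjI)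
  qed
next
  assume R: "\<forall>u\<in>carrier S. \<forall>v\<in>carrier S. u \<noteq> v \<longrightarrow>
      (\<exists>T\<in>C. \<exists>f\<in>sg_hom S T. f ` carrier S = carrier T \<and> f u \<noteq> f v)"
  define I where "I = {(u, v). u \<in> carrier S \<and> v \<in> carrier S \<and> u \<noteq> v}"
  have "\<forall>i\<in>I. \<exists>T f. T \<in> C \<and> f \<in> sg_hom S T \<and> f ` carrier S = carrier T \<and> f (fst i) \<noteq> f (snd i)"
    using R by (fastforce simp: I_def)
  then obtain T f where Tf: "\<And>i. i \<in> I \<Longrightarrow>
      T i \<in> C \<and> f i \<in> sg_hom S (T i) \<and> f i ` carrier S = carrier (T i) \<and> f i (fst i) \<noteq> f i (snd i)"
    by metis
  define h where "h s = (\<lambda>i\<in>I. f i s)" for s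
  have fc: "f i s \<in> carrier (T i)" if "i \<in> I" "s \<in> carrier S" for i s
    using Tf[OF that(1)] hom_closed that(2) by metis
  have fm: "f i (s \<odot>\<^bsub>S\<^esub> t) = f i s \<odot>\<^bsub>T i\<^esub> f i t" if "i \<in> I" "s \<in> carrier S" "t \<in> carrier S" for i s t
    using Tf[OF that(1)] hom_mult that(2,3) by metis
  have "h \<in> sg_hom S (sg_product I T)"
    unfolding sg_hom_def
  proof (intro CollectI conjI ballI funcsetI)
    fix s assume "s \<in> carrier S"
    then show "h s \<in> carrier (sg_product I T)" using fc by (simp add: h_def sg_product_def PiE_I)
  next
    fix s t assume "s \<in> carrier S" "t \<in> carrier S"
    then show "h (s \<odot>\<^bsub>S\<^esub> t) = h s \<odot>\<^bsub>sg_product I T\<^esub> h t"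
      using fm by (intro ext) (simp add: h_def sg_product_def)
  qed
  moreover have "inj_on h (carrier S)"
  proof (rule inj_onI, rule ccontr)
    fix u v assume uv: "u \<in> carrier S" "v \<in> carrier S" "h u = h v" "u \<noteq> v"
    then have "(u, v) \<in> I" by (simp add: I_def)
    then show False using Tf[of "(u, v)"] fun_cong[OF uv(3), of "(u, v)"] by (simp add: h_def)
  qed
  moreover have "\<forall>i\<in>I. (\<lambda>s. h s i) ` carrier S = carrier (T i)" using Tf by (simp add: h_def)
  ultimately show "subdirect_product_of S C" using Tf unfolding subdirect_product_of_def by blast
qed



section \<open>The semigroups N2, S0, L21 and R21\<close>

lemma small_semigroups:
  "is_semigroup N2" "is_semigroup S0" "is_semigroup L21" "is_semigroup R21"
  by (auto simp: is_semigroup_def N2_def S0_def L21_def R21_def)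

lemma small_finite:
  "finite (carrier N2)" "finite (carrier S0)" "finite (carrier L21)" "finite (carrier R21)"
  by (simp_all add: N2_def S0_def L21_def R21_def)

lemma R21_opposite: "R21 = sg_opposite L21"
  by (auto simp: sg_opposite_def L21_def R21_def fun_eq_iff)

text \<open>
  An identity that fails in \<open>N2\<close> has a single variable on one side. Identifying all variables
  turns it into \<open>x = x\<^sup>k\<close>, unless it is an equation between two variables.
\<close>

lemma no_N2_imp_power_law:
  fixes V :: "('u::infinite) sgrp set"
  assumes V: "variety V" and "\<not> contains_copy V N2"
  shows "\<exists>n>0. \<forall>S\<in>V. satisfies_power_law S 1 n"
proof -
  obtain p q where pq: "p \<noteq> []" "q \<noteq> []" "holds_in V (p, q)" "\<not> satisfies N2 (p, q)"
    using separating_identity[OF V small_semigroups(1) small_finite(1) assms(2)] .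
  have *: ?thesis if pq: "length p = 1" "q \<noteq> []" "q \<noteq> p" "holds_in V (p, q)" for p q
  proof -
    obtain x where p: "p = [x]" using pq(1) by (metis One_nat_def length_0_conv length_Suc_conv)
    show ?thesis
    proof (cases "length q = 1")
      case True
      then obtain y where q: "q = [y]" by (metis One_nat_def length_0_conv length_Suc_conv)
      have xy: "x \<noteq> y" using p q pq(3) by simp
      have "a = b" if S: "S \<in> V" and ab: "a \<in> carrier S" "b \<in> carrier S" for S a b
      proof -
        have "(\<lambda>i. if i = x then a else b) \<in> UNIV \<rightarrow> carrier S" using ab by simp
        then show ?thesis using pq(4) S xy unfolding holds_in_iff p q by fastforce
      qed
      then have "\<forall>S\<in>V. satisfies_power_law S 1 1"
        using variety_semigroup[OF V] by (auto simp: satisfies_power_law_def is_semigroup_def)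
      then show ?thesis by blast
    next
      case False
      define n where "n = length q - 1"
      have n: "n > 0" "length q = 1 + n" using False pq(2) by (auto simp: n_def neq_Nil_conv)
      have "sg_pow S a (1 + n) = sg_pow S a 1" if S: "S \<in> V" and a: "a \<in> carrier S" for S a
      proof -
        have "(\<lambda>_. a) \<in> UNIV \<rightarrow> carrier S" using a by simp
        then have "sg_eval S (\<lambda>_. a) q = sg_eval S (\<lambda>_. a) p"
          using pq(4) S unfolding holds_in_iff by metis
        then show ?thesis using pq(2) n by (simp add: eval_const p)
      qed
      then show ?thesis using n(1) by (auto simp: satisfies_power_law_def)
    qed
  qed
  have long: "sg_eval N2 \<phi> w = E0" if "w \<noteq> []" "length w \<noteq> 1" for \<phi> w
  proof -
    have "length w = 1 \<or> sg_eval N2 \<phi> w = E0" using that(1)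
      by (induction w rule: nonempty_snoc_induct) (auto simp: eval_snoc N2_def)
    then show ?thesis using that(2) by simp
  qed
  have "length p = 1 \<or> length q = 1"
  proof (rule ccontr)
    assume "\<not> ?thesis"
    then have "satisfies N2 (p, q)" using pq(1,2) long by (simp add: satisfies_def holds_under_def)
    then show False using pq(4) by simp
  qed
  moreover have "p \<noteq> q" using pq(4) by (auto simp: satisfies_def holds_under_def)
  ultimately show ?thesis using *[of p q] *[of q p] pq by (auto simp: holds_in_iff)
qed

lemma (in semigrp) eval_opposite:
  assumes "\<phi> \<in> UNIV \<rightarrow> carrier S" "w \<noteq> []"
  shows "sg_eval (sg_opposite S) \<phi> (rev w) = sg_eval S \<phi> w"
  using assms(2)
proof (induction w rule: list_nonempty_induct)
  case (cons x w)
  then show ?case using eval_append[OF assms(1), of "[x]" w] by (simp add: eval_snoc)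
qed simp

lemma satisfies_opposite:
  assumes "is_semigroup S" "p \<noteq> []" "q \<noteq> []"
  shows "satisfies (sg_opposite S) (rev p, rev q) \<longleftrightarrow> satisfies S (p, q)"
proof -
  interpret semigrp S by unfold_locales fact
  show ?thesis using assms(2,3) by (simp add: satisfies_def holds_under_def eval_opposite)
qed

text \<open>
  The value of a word in \<open>L21\<close> is the first letter that is not the identity. An identity
  failing there is evaluated at the idempotents \<open>h\<close> of \<open>f g\<close> and \<open>k\<close> of \<open>g f\<close>, with \<open>e\<close> for the
  adjoined identity. All nontrivial values then lie above one \<open>\<J>\<close>-class, that of \<open>h\<close> and \<open>k\<close>. If the
  two sides start with \<open>h\<close> and with \<open>k\<close>, stability gives \<open>k h = h\<close>; if one of them is \<open>e\<close>, then \<open>f\<close> or \<open>g\<close>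
  is \<open>e\<close>.
\<close>

lemma (in cr_semigrp) L21_identity_consequence:
  assumes pq: "p \<noteq> []" "q \<noteq> []" "satisfies S (p, q)" "\<not> satisfies L21 (p, q)"
    and c: "e \<in> carrier S" "f \<in> carrier S" "g \<in> carrier S"
    and i: "e \<odot> e = e" "f \<odot> f = f" "g \<odot> g = g"
    and le: "idempotent_le S f e" "idempotent_le S g e"
  shows "g \<odot> f \<odot> g = f \<odot> g"
proof -
  have ef: "e \<odot> f = f" "f \<odot> e = f" "e \<odot> g = g" "g \<odot> e = g" using le by (auto simp: idempotent_le_def)
  obtain \<phi> where \<phi>: "\<phi> \<in> UNIV \<rightarrow> carrier L21" "sg_eval L21 \<phi> p \<noteq> sg_eval L21 \<phi> q"
    using pq(4) by (auto simp: satisfies_def holds_under_def)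
  define h k where "h = idm (f \<odot> g)" and "k = idm (g \<odot> f)"
  define \<psi> where "\<psi> j = (case \<phi> j of E1 \<Rightarrow> e | Ee \<Rightarrow> h | _ \<Rightarrow> k)" for j
  have hk: "h \<in> carrier S" "k \<in> carrier S" "h \<odot> h = h" "k \<odot> k = k" using c by (auto simp: h_def k_def)
  have e_hk: "e \<odot> h = h" "h \<odot> e = h" "e \<odot> k = k" "k \<odot> e = k"
    unfolding h_def k_def using c ef
    by (auto simp: assoc intro!: idm_absorb_left idm_absorb_right) (simp_all add: assoc[symmetric])
  have fg_hk: "f \<odot> h = h" "g \<odot> k = k"
    using c i unfolding h_def k_def by (auto intro!: idm_absorb_left simp: assoc[symmetric])
  have \<psi>: "\<psi> \<in> UNIV \<rightarrow> carrier S" using hk c by (auto simp: \<psi>_def split: elt.split)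
  have J_hk: "J_below S h k" "J_below S k h"
    using c J_idm J_swap J_trans unfolding h_def k_def by (meson closed pow_closed)+
  have J_he: "J_below S h e" using J_mult_right[of h e] hk c e_hk by simp
  have \<phi>_cases: "\<phi> j = E1 \<or> \<phi> j = Ee \<or> \<phi> j = Ef" for j
    using range_mem[OF \<phi>(1), of j] by (auto simp: L21_def)
  have L21_mul: "x \<odot>\<^bsub>L21\<^esub> y = (if x = E1 then y else x)" for x y by (simp add: L21_def)
  have J_\<psi>: "J_below S h (\<psi> j)" for j
    using \<phi>_cases[of j] J_he J_hk J_refl hk by (auto simp: \<psi>_def)
  have eval: "(sg_eval L21 \<phi> w = E1 \<and> sg_eval S \<psi> w = e \<or>
      sg_eval L21 \<phi> w = Ee \<and> h \<odot> sg_eval S \<psi> w = sg_eval S \<psi> w \<or>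
      sg_eval L21 \<phi> w = Ef \<and> k \<odot> sg_eval S \<psi> w = sg_eval S \<psi> w) \<and> J_below S h (sg_eval S \<psi> w)"
    if "w \<noteq> []" for w
    using that
  proof (induction w rule: nonempty_snoc_induct)
    case (single x)
    then show ?case using \<phi>_cases[of x] hk J_\<psi>[of x] by (auto simp: \<psi>_def)
  next
    case (snoc w x)
    define W where "W = sg_eval S \<psi> w"
    have W: "W \<in> carrier S" using \<psi> by (auto simp: W_def)
    have x: "\<psi> x \<in> carrier S" using range_mem[OF \<psi>] .
    have "J_below S h (W \<odot> \<psi> x)" using snoc J_\<psi> J_meet[OF W x] by (simp add: W_def)
    moreover have "h \<odot> (W \<odot> \<psi> x) = W \<odot> \<psi> x" if "h \<odot> W = W" using that hk W x by (simp add: assoc[symmetric])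
    moreover have "k \<odot> (W \<odot> \<psi> x) = W \<odot> \<psi> x" if "k \<odot> W = W" using that hk W x by (simp add: assoc[symmetric])
    moreover have "W \<odot> \<psi> x = \<psi> x" if "W = e" using that \<phi>_cases[of x] e_hk i by (auto simp: \<psi>_def)
    moreover have "\<phi> x = E1 \<and> \<psi> x = e \<or> \<phi> x = Ee \<and> h \<odot> \<psi> x = \<psi> x \<or> \<phi> x = Ef \<and> k \<odot> \<psi> x = \<psi> x"
      using \<phi>_cases[of x] hk by (auto simp: \<psi>_def)
    ultimately show ?case using snoc.IH snoc.hyps unfolding W_def[symmetric]
      by (simp add: eval_snoc L21_mul W_def[symmetric]) (elim disjE conjE; simp)
  qed
  have goal: ?thesis if pq: "p \<noteq> []" "q \<noteq> []" "sg_eval S \<psi> p = sg_eval S \<psi> q"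
    and vals: "sg_eval L21 \<phi> p = Ee \<or> sg_eval L21 \<phi> p = Ef \<and> sg_eval L21 \<phi> q = E1"
      "sg_eval L21 \<phi> p \<noteq> sg_eval L21 \<phi> q" for p q
  proof -
    define P where "P = sg_eval S \<psi> p"
    have P: "P \<in> carrier S" using \<psi> by (auto simp: P_def)
    have PQ: "sg_eval S \<psi> q = P" using pq(3) by (simp add: P_def)
    have JP: "J_below S h P" using eval[OF pq(1)] by (simp add: P_def)
    consider "h \<odot> P = P" "k \<odot> P = P" | "h \<odot> P = P" "P = e" | "k \<odot> P = P" "P = e"
      using eval[OF pq(1)] eval[OF pq(2)] vals unfolding PQ P_def[symmetric] by auto
    then show ?thesis
    proof cases
      case 1
      then have "J_below S h (h \<odot> P)" using JP by simp
      then obtain d where d: "d \<in> carrier S" "h = h \<odot> P \<odot> d" using stable_right hk P by blast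
      have "k \<odot> (P \<odot> d) = P \<odot> d" using 1(2) hk P d(1) by (simp add: assoc[symmetric])
      then have "k \<odot> h = h" using d(2) 1(1) by simp
      then have "g \<odot> h = h" using fg_hk c hk by (metis assoc)
      then have "g \<odot> (h \<odot> (f \<odot> g)) = h \<odot> (f \<odot> g)" using c hk by (simp add: assoc[symmetric])
      moreover have "h \<odot> (f \<odot> g) = f \<odot> g" using c by (simp add: h_def)
      ultimately show ?thesis using c by (simp add: assoc)
    next
      case 2
      then have "h = e" using e_hk by simp
      then have "f = e" using fg_hk ef by simp
      then show ?thesis using i ef by simp
    next
      case 3
      then have "k = e" using e_hk by simp
      then have "g = e" using fg_hk ef by simp
      then show ?thesis using ef by simp
    qed
  qed
  have eq: "sg_eval S \<psi> p = sg_eval S \<psi> q" using pq(3) \<psi> by (simp add: satisfies_def holds_under_def)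
  have "sg_eval L21 \<phi> p \<in> {E1, Ee, Ef}" "sg_eval L21 \<phi> q \<in> {E1, Ee, Ef}"
    using eval[OF pq(1)] eval[OF pq(2)] by auto
  then consider "sg_eval L21 \<phi> p = Ee \<or> sg_eval L21 \<phi> p = Ef \<and> sg_eval L21 \<phi> q = E1"
    | "sg_eval L21 \<phi> q = Ee \<or> sg_eval L21 \<phi> q = Ef \<and> sg_eval L21 \<phi> p = E1"
    using \<phi>(2) by auto
  then show ?thesis
    using goal[of p q] goal[of q p] pq(1,2) eq \<phi>(2) by cases auto
qed

lemma (in cr_semigrp) R21_identity_consequence:
  assumes pq: "p \<noteq> []" "q \<noteq> []" "satisfies S (p, q)" "\<not> satisfies R21 (p, q)"
    and c: "e \<in> carrier S" "f \<in> carrier S" "g \<in> carrier S"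
    and i: "e \<odot> e = e" "f \<odot> f = f" "g \<odot> g = g"
    and le: "idempotent_le S f e" "idempotent_le S g e"
  shows "g \<odot> f \<odot> g = g \<odot> f"
proof -
  interpret op: cr_semigrp "sg_opposite S" n by (rule opposite_cr)
  have "satisfies (sg_opposite S) (rev p, rev q)"
    using satisfies_opposite[OF semigroup pq(1,2)] pq(3) by simp
  moreover have "\<not> satisfies L21 (rev p, rev q)"
    using satisfies_opposite[OF small_semigroups(3), of "rev p" "rev q"] pq by (simp add: R21_opposite)
  ultimately show ?thesis
    using op.L21_identity_consequence[of "rev p" "rev q" e f g] pq(1,2) c i le
    by (simp add: idempotent_le_def assoc)
qed

lemma excluded_semigroups_imp_laws:
  fixes V :: "('u::infinite) sgrp set"
  assumes V: "variety V" and n: "n > 0" "\<forall>S\<in>V. satisfies_power_law S 1 n"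
    and L: "\<not> contains_copy V L21" and R: "\<not> contains_copy V R21" and S: "S \<in> V"
  shows "permutes_inner_factors S n"
proof -
  interpret cr_semigrp S n using variety_semigroup[OF V S] n S by unfold_locales auto
  obtain p q where L: "p \<noteq> []" "q \<noteq> []" "holds_in V (p, q)" "\<not> satisfies L21 (p, q)"
    using separating_identity[OF V small_semigroups(3) small_finite(3) L] .
  obtain p' q' where R: "p' \<noteq> []" "q' \<noteq> []" "holds_in V (p', q')" "\<not> satisfies R21 (p', q')"
    using separating_identity[OF V small_semigroups(4) small_finite(4) R] .
  have sat: "satisfies S (p, q)" "satisfies S (p', q')" using L R S by (auto simp: holds_in_def)
  have "locally_commuting S"
    unfolding locally_commuting_def
  proof (intro ballI impI)
    fix e f g assume *: "e \<in> carrier S" "f \<in> carrier S" "g \<in> carrier S"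
      "e \<odot>\<^bsub>S\<^esub> e = e" "f \<odot>\<^bsub>S\<^esub> f = f" "g \<odot>\<^bsub>S\<^esub> g = g" "idempotent_le S f e" "idempotent_le S g e"
    show "f \<odot>\<^bsub>S\<^esub> g = g \<odot>\<^bsub>S\<^esub> f"
      using L21_identity_consequence[OF L(1,2) sat(1) L(4) *]
        R21_identity_consequence[OF R(1,2) sat(2) R(4) *] by simp
  qed
  then show ?thesis by (rule locally_commuting_imp_permutes)
qed

text \<open>
  Evaluating \<open>x y = q\<close> at \<open>(a b, a)\<close> and at \<open>(a, b a)\<close>, with all other variables zero, forces \<open>q\<close>
  to be \<open>x\<^sup>i y\<close> and \<open>x y\<^sup>j\<close>, hence \<open>x y\<close>. So no identity of such a semigroup can be violated in
  \<open>S0\<close>, where only variables and products of two distinct variables take nonzero values.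
\<close>

lemma square_zero_regular_imp_S0:
  assumes S: "is_semigroup S" and z: "is_zero S z"
    and ab: "a \<in> carrier S" "b \<in> carrier S" "a \<odot>\<^bsub>S\<^esub> b \<odot>\<^bsub>S\<^esub> a = a" "a \<odot>\<^bsub>S\<^esub> a = z" "a \<noteq> z"
    and pq: "p \<noteq> []" "q \<noteq> []" "satisfies S (p, q)"
  shows "satisfies S0 (p, q)"
proof -
  interpret semigrp S by unfold_locales fact
  have zS: "z \<in> carrier S" and z_mul: "\<And>x. x \<in> carrier S \<Longrightarrow> x \<odot>\<^bsub>S\<^esub> z = z \<and> z \<odot>\<^bsub>S\<^esub> x = z"
    using z by (auto simp: is_zero_def)
  define e f where "e = a \<odot>\<^bsub>S\<^esub> b" and "f = b \<odot>\<^bsub>S\<^esub> a"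
  have ef: "e \<in> carrier S" "f \<in> carrier S" using ab by (auto simp: e_def f_def)
  have mul: "e \<odot>\<^bsub>S\<^esub> a = a" "a \<odot>\<^bsub>S\<^esub> f = a" "a \<odot>\<^bsub>S\<^esub> e = z" "f \<odot>\<^bsub>S\<^esub> a = z"
    "e \<odot>\<^bsub>S\<^esub> e = e" "f \<odot>\<^bsub>S\<^esub> f = f"
  proof -
    show ea: "e \<odot>\<^bsub>S\<^esub> a = a" using ab by (simp add: e_def)
    show af: "a \<odot>\<^bsub>S\<^esub> f = a" using ab by (simp add: f_def assoc)
    show "a \<odot>\<^bsub>S\<^esub> e = z" using ab z_mul by (simp add: e_def assoc[symmetric])
    show "f \<odot>\<^bsub>S\<^esub> a = z" using ab z_mul by (simp add: f_def assoc)
    show "e \<odot>\<^bsub>S\<^esub> e = e" using ea ab ef by (simp add: e_def assoc[symmetric])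
    show "f \<odot>\<^bsub>S\<^esub> f = f" using af ab ef by (simp add: f_def assoc)
  qed
  have ne: "e \<noteq> a" "f \<noteq> a" using mul ab by auto
  have eq: "sg_eval S \<psi> p = sg_eval S \<psi> q" if "\<psi> \<in> UNIV \<rightarrow> carrier S" for \<psi>
    using pq(3) that by (simp add: satisfies_def holds_under_def)
  have single: "q = p" if pq: "length p = 1" "q \<noteq> []"
    and eq: "\<And>\<psi>. \<psi> \<in> UNIV \<rightarrow> carrier S \<Longrightarrow> sg_eval S \<psi> p = sg_eval S \<psi> q" for p q :: sg_word
  proof -
    obtain x where p: "p = [x]" using pq(1) by (metis One_nat_def length_0_conv length_Suc_conv)
    define \<psi> where "\<psi> i = (if i = x then a else z)" for i
    have \<psi>: "\<psi> \<in> UNIV \<rightarrow> carrier S" using ab zS by (simp add: \<psi>_def)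
    have "w = [x] \<or> sg_eval S \<psi> w = z" if "w \<noteq> []" for w
      using that
    proof (induction w rule: nonempty_snoc_induct)
      case (snoc w y)
      then show ?case using ab z_mul zS range_mem[OF \<psi>] by (auto simp: eval_snoc) (auto simp: \<psi>_def)
    qed (simp add: \<psi>_def)
    then show ?thesis using eq[OF \<psi>] pq(2) ab(5) by (auto simp: p \<psi>_def)
  qed
  have double: "q = [x, y]" if xy: "x \<noteq> y" and q: "q \<noteq> []"
    and eq: "\<And>\<psi>. \<psi> \<in> UNIV \<rightarrow> carrier S \<Longrightarrow> sg_eval S \<psi> [x, y] = sg_eval S \<psi> q" for x y and q :: sg_word
  proof -
    define \<psi> where "\<psi> i = (if i = x then e else if i = y then a else z)" for i
    have \<psi>: "\<psi> \<in> UNIV \<rightarrow> carrier S" using ab ef zS by (simp add: \<psi>_def)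
    have "sg_eval S \<psi> w = z \<or> set w \<subseteq> {x} \<and> sg_eval S \<psi> w = e \<or>
        (\<exists>w'. w = w' @ [y] \<and> set w' \<subseteq> {x}) \<and> sg_eval S \<psi> w = a" if "w \<noteq> []" for w
      using that
    proof (induction w rule: nonempty_snoc_induct)
      case (snoc w v)
      have "\<psi> v = z \<or> v = x \<and> \<psi> v = e \<or> v = y \<and> \<psi> v = a" using xy by (auto simp: \<psi>_def)
      then show ?case
        using snoc ab(4) z_mul mul(1,3,5) range_mem[OF \<psi>, of v] zS ef(1) ab(1)
        by (auto simp: eval_snoc)
    qed (auto simp: \<psi>_def)
    moreover have "sg_eval S \<psi> q = a" using eq[OF \<psi>] xy mul by (simp add: sg_eval_def \<psi>_def)
    ultimately obtain w where w: "q = w @ [y]" "set w \<subseteq> {x}" using q ne ab(5) by metis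
    define \<chi> where "\<chi> i = (if i = x then a else if i = y then f else z)" for i
    have \<chi>: "\<chi> \<in> UNIV \<rightarrow> carrier S" using ab ef zS by (simp add: \<chi>_def)
    have "sg_eval S \<chi> w = z \<or> set w \<subseteq> {y} \<and> sg_eval S \<chi> w = f \<or>
        (\<exists>w'. w = x # w' \<and> set w' \<subseteq> {y}) \<and> sg_eval S \<chi> w = a" if "w \<noteq> []" for w
      using that
    proof (induction w rule: nonempty_snoc_induct)
      case (snoc w v)
      have "\<chi> v = z \<or> v = x \<and> \<chi> v = a \<or> v = y \<and> \<chi> v = f" using xy by (auto simp: \<chi>_def)
      then show ?case
        using snoc ab(4) z_mul mul(2,4,6) range_mem[OF \<chi>, of v] zS ef(2) ab(1)
        by (auto simp: eval_snoc)
    qed (auto simp: \<chi>_def)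
    moreover have "sg_eval S \<chi> q = a" using eq[OF \<chi>] xy mul by (simp add: sg_eval_def \<chi>_def)
    ultimately obtain w' where w': "q = x # w'" "set w' \<subseteq> {y}" using q ne ab(5) by metis
    show ?thesis
    proof (cases w)
      case Nil
      then show ?thesis using w w' xy by simp
    next
      case (Cons v u)
      then have "v = x" "w' = u @ [y]" using w w' by auto
      moreover have "u = []" using Cons w(2) w'(2) \<open>w' = u @ [y]\<close> xy by (cases u) auto
      ultimately show ?thesis using w' by simp
    qed
  qed
  have S0_val: "sg_eval S0 \<phi> w = E0"
    if \<phi>: "\<phi> \<in> UNIV \<rightarrow> carrier S0" and "w \<noteq> []" "length w \<noteq> 1" "\<And>x y. x \<noteq> y \<Longrightarrow> w \<noteq> [x, y]" for \<phi> w
  proof -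
    have "length w = 1 \<or> (\<exists>x y. w = [x, y]) \<and> sg_eval S0 \<phi> w \<in> {Ec, E0} \<or> sg_eval S0 \<phi> w = E0"
      using that(2) by (induction w rule: nonempty_snoc_induct)
        (auto simp: eval_snoc S0_def length_Suc_conv One_nat_def)
    moreover have "sg_eval S0 \<phi> [x, x] = E0" for x by (auto simp: sg_eval_def S0_def)
    ultimately show ?thesis using that(3,4) by metis
  qed
  show ?thesis
  proof (cases "p = q")
    case True
    then show ?thesis by (simp add: satisfies_def holds_under_def)
  next
    case False
    have "length p \<noteq> 1" "length q \<noteq> 1" using single[of p q] single[of q p] pq eq False by auto
    moreover have "p \<noteq> [x, y]" "q \<noteq> [x, y]" if "x \<noteq> y" for x y
      using double[OF that, of q] double[OF that, of p] pq eq False by auto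
    ultimately show ?thesis using S0_val pq(1,2) by (simp add: satisfies_def holds_under_def)
  qed
qed

lemma non_completely_regular_imp_S0:
  fixes V :: "('u::infinite) sgrp set"
  assumes V: "variety V" and T: "T \<in> V" "completely_zero_simple T" "periodic_semigrp T m n"
    and x: "x \<in> carrier T" "sg_pow T x (Suc n) \<noteq> x"
  shows "contains_copy V S0"
proof (rule ccontr)
  assume "\<not> contains_copy V S0"
  then obtain p q where pq: "p \<noteq> []" "q \<noteq> []" "holds_in V (p, q)" "\<not> satisfies S0 (p, q)"
    using separating_identity[OF V small_semigroups(2) small_finite(2)] by blast
  interpret T: periodic_semigrp T m n by fact
  have z: "is_zero T (x \<odot>\<^bsub>T\<^esub> x)" using T.square_zero_or_in_subgroup[OF T(2) x] .
  have x_nz: "\<not> is_zero T x" using T.zero_pow x(2) by blast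
  then have "x \<noteq> x \<odot>\<^bsub>T\<^esub> x" using z by metis
  moreover obtain y where "y \<in> carrier T" "x \<odot>\<^bsub>T\<^esub> y \<odot>\<^bsub>T\<^esub> x = x"
    using T.completely_zero_simple_regular[OF T(2) x(1) x_nz] by blast
  moreover have "satisfies T (p, q)" using pq(3) T(1) by (simp add: holds_in_def)
  ultimately have "satisfies S0 (p, q)"
    using square_zero_regular_imp_S0[OF T.semigroup z x(1)] pq(1,2) by blast
  then show False using pq(4) by simp
qed

lemma S0_products:
  "Ea \<in> carrier S0" "Eb \<in> carrier S0" "Ec \<in> carrier S0" "E0 \<in> carrier S0"
  "Ea \<odot>\<^bsub>S0\<^esub> Eb = Ec" "Eb \<odot>\<^bsub>S0\<^esub> Ea = Ec" "Ea \<odot>\<^bsub>S0\<^esub> Ea = E0" "Eb \<odot>\<^bsub>S0\<^esub> Eb = E0"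
  "E0 \<odot>\<^bsub>S0\<^esub> Ea = E0" "E0 \<odot>\<^bsub>S0\<^esub> Eb = E0"
  by (simp_all add: S0_def)

lemma S0_not_separated:
  assumes T: "completely_zero_simple T" "periodic_semigrp T m n" and h: "h \<in> sg_hom S0 T"
  shows "h Ec = h E0"
proof -
  interpret T: periodic_semigrp T m n by fact
  note mult = hom_mult[OF h, symmetric] and S0 = S0_products
  have "h Ea \<odot>\<^bsub>T\<^esub> h Eb = h Ea \<odot>\<^bsub>T\<^esub> h Ea"
    by (rule T.completely_zero_simple_quasi_identity[OF T(1)])
       (simp_all add: mult S0 hom_closed[OF h])
  then show ?thesis by (simp add: mult S0)
qed

text \<open>
  As \<open>y\<close> is a multiple of its square, it cannot be absorbed by an idempotent square without being
  equal to it.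
\<close>

lemma (in cr_semigrp) square_absorbing:
  assumes "y \<in> carrier S" "z \<in> carrier S" "y \<odot> y = z" "z \<odot> y = z" "z \<odot> z = z"
  shows "y = z"
proof -
  obtain d where d: "d \<in> carrier S" "idm y = y \<odot> d" using idm_factor assms by blast
  have "y = y \<odot> (y \<odot> d)" using d(2) assms(1) by (metis idm_right)
  then have y: "y = z \<odot> d" using assms(1,3) d(1) by (simp add: assoc[symmetric])
  then have "z \<odot> y = (z \<odot> z) \<odot> d" using assms(2) d(1) by (metis assoc)
  then show ?thesis using y assms(4,5) by simp
qed

lemma power_law_excludes:
  assumes V: "variety V" and n: "n > 0" "\<forall>S\<in>V. satisfies_power_law S 1 n"
    and T: "y \<in> carrier T" "z \<in> carrier T" "y \<noteq> z"
      "y \<odot>\<^bsub>T\<^esub> y = z" "z \<odot>\<^bsub>T\<^esub> y = z" "z \<odot>\<^bsub>T\<^esub> z = z"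
  shows "\<not> contains_copy V T"
proof (rule not_contains_copyI[OF V])
  fix S g assume S: "S \<in> V" "is_semigroup S" and g: "g \<in> sg_hom T S" "inj_on g (carrier T)"
  interpret cr_semigrp S n using S n by unfold_locales auto
  have "g y = g z"
    by (rule square_absorbing) (simp_all add: hom_closed[OF g(1)] hom_mult[OF g(1), symmetric] T)
  then show False using g(2) T(1-3) by (auto simp: inj_on_def)
qed

lemma permutation_law_identifies:
  assumes T: "T = L21 \<or> T = R21" and S: "is_semigroup S" "permutes_inner_factors S n"
    and h: "h \<in> sg_hom T S"
  shows "h Ee = h Ef"
proof -
  interpret semigrp S using S(1) by unfold_locales
  have mem: "Ee \<in> carrier T" "Ef \<in> carrier T" "E1 \<in> carrier T" using T by (auto simp: L21_def R21_def)
  have mul: "E1 \<odot>\<^bsub>T\<^esub> x = x" "x \<odot>\<^bsub>T\<^esub> E1 = x" "Ee \<odot>\<^bsub>T\<^esub> Ee = Ee" "Ef \<odot>\<^bsub>T\<^esub> Ef = Ef" for x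
    using T by (auto simp: L21_def R21_def)
  have ef: "(Ee \<odot>\<^bsub>T\<^esub> Ef = Ee \<and> Ef \<odot>\<^bsub>T\<^esub> Ee = Ef) \<or> (Ee \<odot>\<^bsub>T\<^esub> Ef = Ef \<and> Ef \<odot>\<^bsub>T\<^esub> Ee = Ee)"
    using T by (auto simp: L21_def R21_def)
  then have prod_mem: "Ee \<odot>\<^bsub>T\<^esub> Ef \<in> carrier T" "Ef \<odot>\<^bsub>T\<^esub> Ee \<in> carrier T" using mem by auto
  have idem: "sg_pow S (h x) n = h x" if "x \<in> {Ee, Ef}" for x
    using that hom_mult[OF h mem(1) mem(1)] hom_mult[OF h mem(2) mem(2)] mul
    by (intro pow_idempotent) auto
  have "sg_pow S (h E1 \<odot>\<^bsub>S\<^esub> h Ee \<odot>\<^bsub>S\<^esub> h Ef \<odot>\<^bsub>S\<^esub> h E1) n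
      = sg_pow S (h E1 \<odot>\<^bsub>S\<^esub> h Ef \<odot>\<^bsub>S\<^esub> h Ee \<odot>\<^bsub>S\<^esub> h E1) n"
    using S(2) hom_closed[OF h] mem unfolding permutes_inner_factors_def by blast
  then have "sg_pow S (h (Ee \<odot>\<^bsub>T\<^esub> Ef)) n = sg_pow S (h (Ef \<odot>\<^bsub>T\<^esub> Ee)) n"
    by (simp add: hom_mult[OF h, symmetric] mem mul prod_mem)
  then show ?thesis using ef idem[of Ee] idem[of Ef] by auto
qed



section \<open>Equivalence of the conditions\<close>

definition satisfies_laws :: "'a sgrp set \<Rightarrow> nat \<Rightarrow> bool" where
  "satisfies_laws K n \<longleftrightarrow>
     (\<forall>S\<in>K. satisfies_power_law S 1 n \<and> permutes_inner_factors S n)"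

lemma satisfies_laws_iff_identities:
  assumes K: "\<And>S. S \<in> K \<Longrightarrow> is_semigroup S" and n: "n > 0"
  shows "satisfies_laws K n \<longleftrightarrow>
    (\<forall>S\<in>K. satisfies S ([1], word_pow [1] (n + 1)) \<and>
           satisfies S (word_pow [0, 1, 2, 3] n, word_pow [0, 2, 1, 3] n))"
proof -
  have "satisfies_power_law S 1 n \<longleftrightarrow> satisfies S ([1], word_pow [1] (n + 1))"
    and "permutes_inner_factors S n \<longleftrightarrow>
      satisfies S (word_pow [0, 1, 2, 3] n, word_pow [0, 2, 1, 3] n)" if S: "S \<in> K" for S
  proof -
    interpret semigrp S using K[OF S] by unfold_locales
    have pow: "sg_eval S \<phi> (word_pow [1] (n + 1)) = sg_pow S (\<phi> 1) (n + 1)"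
      if "\<phi> \<in> UNIV \<rightarrow> carrier S" for \<phi>
      using eval_word_pow[OF that, of "[1]" "n + 1"] by simp
    show "satisfies_power_law S 1 n \<longleftrightarrow> satisfies S ([1], word_pow [1] (n + 1))"
    proof
      assume L: "satisfies_power_law S 1 n"
      show "satisfies S ([1], word_pow [1] (n + 1))"
        unfolding satisfies_def
      proof
        fix \<phi> :: "nat \<Rightarrow> _" assume \<phi>: "\<phi> \<in> UNIV \<rightarrow> carrier S"
        have "sg_pow S (\<phi> 1) (1 + n) = \<phi> 1"
          using L range_mem[OF \<phi>, of 1] by (simp add: satisfies_power_law_def)
        then show "holds_under S \<phi> ([1], word_pow [1] (n + 1))"
          using pow[OF \<phi>] by (simp add: holds_under_def del: sg_pow.simps)
      qed
    next
      assume L: "satisfies S ([1], word_pow [1] (n + 1))"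
      show "satisfies_power_law S 1 n"
        unfolding satisfies_power_law_def
      proof
        fix x assume x: "x \<in> carrier S"
        then have c: "(\<lambda>_. x) \<in> UNIV \<rightarrow> carrier S" by simp
        have "sg_eval S (\<lambda>_. x) [1] = sg_eval S (\<lambda>_. x) (word_pow [1] (n + 1))"
          using L c unfolding satisfies_def holds_under_def by blast
        then show "sg_pow S x (1 + n) = sg_pow S x 1" using pow[OF c] by simp
      qed
    qed
    have pow4: "sg_eval S \<phi> (word_pow [i, j, k, l] n)
        = sg_pow S (\<phi> i \<odot>\<^bsub>S\<^esub> \<phi> j \<odot>\<^bsub>S\<^esub> \<phi> k \<odot>\<^bsub>S\<^esub> \<phi> l) n"
      if "\<phi> \<in> UNIV \<rightarrow> carrier S" for \<phi> and i j k l :: nat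
      using eval_word_pow[OF that _ n, of "[i, j, k, l]"] by (simp add: eval_4)
    show "permutes_inner_factors S n \<longleftrightarrow>
      satisfies S (word_pow [0, 1, 2, 3] n, word_pow [0, 2, 1, 3] n)"
    proof
      assume L: "permutes_inner_factors S n"
      show "satisfies S (word_pow [0, 1, 2, 3] n, word_pow [0, 2, 1, 3] n)"
        unfolding satisfies_def
      proof
        fix \<phi> :: "nat \<Rightarrow> _" assume \<phi>: "\<phi> \<in> UNIV \<rightarrow> carrier S"
        show "holds_under S \<phi> (word_pow [0, 1, 2, 3] n, word_pow [0, 2, 1, 3] n)"
          using L range_mem[OF \<phi>] by (simp add: holds_under_def pow4[OF \<phi>] permutes_inner_factors_def)
      qed
    next
      assume R: "satisfies S (word_pow [0, 1, 2, 3] n, word_pow [0, 2, 1, 3] n)"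
      show "permutes_inner_factors S n"
        unfolding permutes_inner_factors_def
      proof (intro ballI)
        fix a x y b assume *: "a \<in> carrier S" "x \<in> carrier S" "y \<in> carrier S" "b \<in> carrier S"
        define \<phi> where "\<phi> i = (if i = 0 then a else if i = 1 then x else if i = 2 then y else b)" for i :: nat
        have \<phi>: "\<phi> \<in> UNIV \<rightarrow> carrier S" using * by (simp add: \<phi>_def)
        have "holds_under S \<phi> (word_pow [0, 1, 2, 3] n, word_pow [0, 2, 1, 3] n)"
          using R \<phi> by (simp add: satisfies_def)
        then show "sg_pow S (a \<odot>\<^bsub>S\<^esub> x \<odot>\<^bsub>S\<^esub> y \<odot>\<^bsub>S\<^esub> b) n = sg_pow S (a \<odot>\<^bsub>S\<^esub> y \<odot>\<^bsub>S\<^esub> x \<odot>\<^bsub>S\<^esub> b) n"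
          by (simp add: holds_under_def pow4[OF \<phi>]) (simp add: \<phi>_def)
      qed
    qed
  qed
  then show ?thesis unfolding satisfies_laws_def by blast
qed

lemma laws_cr_semigrp:
  assumes "satisfies_laws V n" "n > 0" "S \<in> V" "is_semigroup S"
  shows "cr_semigrp S n" "locally_commuting S"
proof -
  show "cr_semigrp S n" using assms by unfold_locales (auto simp: satisfies_laws_def)
  then interpret cr_semigrp S n .
  show "locally_commuting S"
    using permutes_imp_locally_commuting assms by (auto simp: satisfies_laws_def)
qed

lemma laws_imp_subdirect:
  assumes V: "variety V" and laws: "satisfies_laws V n" "n > 0" and S: "S \<in> V"
  shows "subdirect_product_of S {T \<in> V. completely_zero_simple T}"
  unfolding subdirect_product_iff
proof (intro ballI impI)
  fix u v assume uv: "u \<in> carrier S" "v \<in> carrier S" "u \<noteq> v"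
  note cr = laws_cr_semigrp[OF laws S variety_semigroup[OF V S]]
  then interpret cr_semigrp S n by simp
  obtain T :: "'a sgrp" and f where "completely_zero_simple T" "f \<in> sg_hom S T"
    "f ` carrier S = carrier T" "f u \<noteq> f v"
    using separating_quotient[OF cr(2) uv] by blast
  moreover from this have "T \<in> V" using variety_surjective_image[OF V S] by blast
  ultimately show "\<exists>T\<in>{T \<in> V. completely_zero_simple T}.
      \<exists>f\<in>sg_hom S T. f ` carrier S = carrier T \<and> f u \<noteq> f v" by blast
qed

lemma subdirect_imp_approximated: "subdirect_product_of S C \<Longrightarrow> approximated_by S C"
  unfolding subdirect_product_iff approximated_by_def by blast

lemma subdirect_mono: "subdirect_product_of S C \<Longrightarrow> C \<subseteq> D \<Longrightarrow> subdirect_product_of S D"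
  unfolding subdirect_product_iff by blast

lemma subdirect_in_variety:
  assumes "variety V" "S \<in> V" "subdirect_product_of S C"
  shows "subdirect_product_of S {T \<in> V. T \<in> C}"
  unfolding subdirect_product_iff
proof (intro ballI impI)
  fix u v assume "u \<in> carrier S" "v \<in> carrier S" "u \<noteq> v"
  then obtain T f where T: "T \<in> C" and f: "f \<in> sg_hom S T" "f ` carrier S = carrier T" "f u \<noteq> f v"
    using assms(3) unfolding subdirect_product_iff by blast
  have "T \<in> V" using variety_surjective_image[OF assms(1,2) f(1,2)] .
  then show "\<exists>T\<in>{T \<in> V. T \<in> C}. \<exists>f\<in>sg_hom S T. f ` carrier S = carrier T \<and> f u \<noteq> f v"
    using T f by (intro bexI[of _ T] bexI[of _ f] conjI) simp_all
qed

text \<open>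
  The quotients of a one-generated free semigroup are monogenic. A completely 0-simple one whose
  generator \<open>y\<close> violates the power law would consist of \<open>y\<close> and the zero \<open>y y\<close>, without a nonzero
  idempotent. So the free semigroup on one generator satisfies the power law, hence all of \<open>V\<close> does,
  and then the factors of the free semigroup on four generators satisfy the permutation law as well.
\<close>

lemma free_subdirect_imp_laws:
  fixes V :: "('u::infinite) sgrp set"
  assumes V: "variety V" and mn: "m > 0" "n > 0" "\<And>S. S \<in> V \<Longrightarrow> satisfies_power_law S m n"
    and free: "\<And>F. free_in V F \<Longrightarrow> finitely_generated F \<Longrightarrow>
      subdirect_product_of F {T. completely_zero_simple T}"
  shows "satisfies_laws V n"
proof -
  have sep: "\<exists>T f. T \<in> V \<and> completely_zero_simple T \<and> f \<in> sg_hom F T \<and> f ` carrier F = carrier T \<and> f u \<noteq> f v"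
    if "F \<in> V" "free_in V F" "finitely_generated F" "u \<in> carrier F" "v \<in> carrier F" "u \<noteq> v" for F u v
    using subdirect_in_variety[OF V that(1) free[OF that(2,3)]] that(4-6)
    unfolding subdirect_product_iff by blast
  have power: "\<forall>S\<in>V. satisfies_power_law S 1 n"
  proof -
    obtain F \<phi> where F: "F \<in> V" "free_in V F" "finitely_generated F" and \<phi>: "\<phi> \<in> UNIV \<rightarrow> carrier F"
      and word: "\<forall>a\<in>carrier F. \<exists>w. w \<noteq> [] \<and> set w \<subseteq> {..<1} \<and> a = sg_eval F \<phi> w"
      and eq: "\<forall>p q. p \<noteq> [] \<and> q \<noteq> [] \<and> set p \<subseteq> {..<1} \<and> set q \<subseteq> {..<1} \<and>
         sg_eval F \<phi> p = sg_eval F \<phi> q \<longrightarrow> holds_in V (p, q)"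
      using free_semigroup_exists[OF V zero_less_one] .
    interpret F: semigrp F using variety_semigroup[OF V F(1)] by unfold_locales
    define x where "x = \<phi> 0"
    have x: "x \<in> carrier F" using range_mem[OF \<phi>] by (simp add: x_def)
    have pow: "\<exists>k>0. a = sg_pow F x k" if a: "a \<in> carrier F" for a
    proof -
      obtain w where w: "w \<noteq> []" "set w \<subseteq> {..<1}" "a = sg_eval F \<phi> w" using word a by blast
      have "sg_eval F \<phi> w = sg_eval F (\<lambda>_. x) w"
        by (rule eval_cong[OF w(1)]) (use w(2) in \<open>auto simp: x_def\<close>)
      then show ?thesis using w(1,3) by (intro exI[of _ "length w"]) (simp add: eval_const)
    qed
    have "sg_pow F x (Suc n) = x"
    proof (rule ccontr)
      assume "sg_pow F x (Suc n) \<noteq> x"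
      then obtain T f where T: "T \<in> V" "completely_zero_simple T"
        and f: "f \<in> sg_hom F T" "f ` carrier F = carrier T" "f (sg_pow F x (Suc n)) \<noteq> f x"
        using sep[OF F _ x, of "sg_pow F x (Suc n)"] x F.pow_closed by blast
      interpret T: periodic_semigrp T m n
        using variety_semigroup[OF V T(1)] mn T(1) by unfold_locales auto
      define y where "y = f x"
      have y: "y \<in> carrier T" "sg_pow T y (Suc n) \<noteq> y"
        using hom_closed[OF f(1) x] f(3) hom_pow[OF F.semigroup f(1) x] by (simp_all add: y_def del: sg_pow.simps)
      define z where "z = y \<odot>\<^bsub>T\<^esub> y"
      have z: "is_zero T z" unfolding z_def using T.square_zero_or_in_subgroup[OF T(2) y] .
      have T_cases: "t = y \<or> t = z" if t: "t \<in> carrier T" for t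
      proof -
        obtain a where a: "a \<in> carrier F" "t = f a" using t f(2) by blast
        obtain k where k: "k > 0" "a = sg_pow F x k" using pow[OF a(1)] by blast
        have "t = sg_pow T y k" using a(2) k(2) hom_pow[OF F.semigroup f(1) x] by (simp add: y_def)
        moreover have "sg_pow T y k = y \<or> sg_pow T y k = z"
          using z y(1) by (induction k) (auto simp: z_def is_zero_def)
        ultimately show ?thesis by simp
      qed
      have yy: "y \<odot>\<^bsub>T\<^esub> y \<noteq> y" using T.pow_idempotent[of y "Suc n"] y(2) by blast
      obtain e where "e \<in> carrier T" "e \<odot>\<^bsub>T\<^esub> e = e" "is_zero T e \<longrightarrow> carrier T = {e}"
        using T(2) by (auto simp: completely_zero_simple_def nonzero_idempotents_def)
      then show False using T_cases[of e] yy y(1) z unfolding z_def by auto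
    qed
    then have "sg_eval F \<phi> (word_pow [0] 1) = sg_eval F \<phi> (word_pow [0] (Suc n))"
      using F.eval_word_pow[OF \<phi>, of "[0]"] by (simp add: x_def del: sg_pow.simps(2)) simp
    moreover have "set (word_pow [0] k) \<subseteq> {..<1}" for k by (auto simp: word_pow_def)
    ultimately have "holds_in V (word_pow [0] 1, word_pow [0] (Suc n))"
      using eq by (simp add: word_pow_eq_Nil)
    then show ?thesis
      using holds_in_power[OF V, of 1 "Suc n" 0] by (simp add: satisfies_power_law_def)
  qed
  have "holds_in V (word_pow [0, 1, 2, 3] n, word_pow [0, 2, 1, 3] n)"
  proof -
    let ?p = "word_pow [0, 1, 2, 3] n" and ?q = "word_pow [0, 2, 1, 3] n"
    obtain F \<phi> where F: "F \<in> V" "free_in V F" "finitely_generated F" and \<phi>: "\<phi> \<in> UNIV \<rightarrow> carrier F"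
      and "\<forall>a\<in>carrier F. \<exists>w. w \<noteq> [] \<and> set w \<subseteq> {..<4} \<and> a = sg_eval F \<phi> w"
      and eq: "\<forall>p q. p \<noteq> [] \<and> q \<noteq> [] \<and> set p \<subseteq> {..<4} \<and> set q \<subseteq> {..<4} \<and>
         sg_eval F \<phi> p = sg_eval F \<phi> q \<longrightarrow> holds_in V (p, q)"
      using free_semigroup_exists[OF V zero_less_numeral] .
    interpret F: semigrp F using variety_semigroup[OF V F(1)] by unfold_locales
    have "sg_eval F \<phi> ?p = sg_eval F \<phi> ?q"
    proof (rule ccontr)
      assume "sg_eval F \<phi> ?p \<noteq> sg_eval F \<phi> ?q"
      then obtain T f where T: "T \<in> V" "completely_zero_simple T"
        and f: "f \<in> sg_hom F T" "f (sg_eval F \<phi> ?p) \<noteq> f (sg_eval F \<phi> ?q)"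
        using sep[OF F F.eval_closed[OF \<phi>] F.eval_closed[OF \<phi>]] by blast
      interpret T: cr_semigrp T n
        using variety_semigroup[OF V T(1)] mn power T(1) by unfold_locales auto
      have "satisfies_laws {T} n"
        using T.completely_zero_simple_permutes[OF T(2)] T.cr_law by (simp add: satisfies_laws_def)
      then have "satisfies T (?p, ?q)"
        using satisfies_laws_iff_identities[of "{T}" n] T.semigroup mn(2) by simp
      moreover have "f \<circ> \<phi> \<in> UNIV \<rightarrow> carrier T"
        using hom_closed[OF f(1)] range_mem[OF \<phi>] by simp
      ultimately show False
        using f(2) hom_eval[OF F.semigroup f(1) \<phi>] by (simp add: satisfies_def holds_under_def)
    qed
    moreover have "set (word_pow w k) \<subseteq> set w" for w :: sg_word and k by (auto simp: word_pow_def)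
    then have "set ?p \<subseteq> {..<4}" "set ?q \<subseteq> {..<4}" by force+
    ultimately show ?thesis using eq mn(2) by (simp add: word_pow_eq_Nil)
  qed
  moreover have "holds_in V ([1], word_pow [1] (n + 1))"
    using power holds_in_power[OF V, of 1 "n + 1" 1]
    by (simp add: satisfies_power_law_def word_pow_def)
  ultimately show ?thesis
    using satisfies_laws_iff_identities[of V n] variety_semigroup[OF V] mn(2) by (simp add: holds_in_def)
qed

text \<open>
  The quasi-identity that \<open>S0\<close> violates holds in \<open>W\<close>, so \<open>S0\<close> is not in \<open>V\<close>. This forces \<open>W\<close> to consist
  of unions of groups; these satisfy both laws, and identities pass from \<open>W\<close> to \<open>V\<close>.
\<close>

lemma qVar_imp_laws:
  fixes V :: "('u::infinite) sgrp set"
  assumes V: "variety V" and mn: "m > 0" "n > 0" "\<And>S. S \<in> V \<Longrightarrow> satisfies_power_law S m n"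
    and W: "\<And>T. T \<in> W \<Longrightarrow> completely_zero_simple T" and VW: "V = qVar W"
  shows "satisfies_laws V n"
proof -
  have W_sg: "is_semigroup T" if "T \<in> W" for T
    using W[OF that] by (simp add: completely_zero_simple_def zero_simple_def)
  then have WV: "W \<subseteq> V" unfolding VW qVar_def by auto
  have per: "periodic_semigrp T m n" if "T \<in> W" for T
    using W_sg[OF that] mn WV that by unfold_locales auto
  have "\<not> contains_copy V S0"
  proof (rule not_contains_copyI[OF V])
    fix S g assume S: "S \<in> V" "is_semigroup S" and g: "g \<in> sg_hom S0 S" "inj_on g (carrier S0)"
    let ?\<Gamma> = "[([0, 1], [1, 0]), ([0, 0, 0], [0, 0]), ([0, 0, 1], [0, 0])] :: sg_identity list"
    let ?\<epsilon> = "([0, 1], [0, 0]) :: sg_identity"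
    have "satisfies_quasi T ?\<Gamma> ?\<epsilon>" if "T \<in> W" for T
      unfolding satisfies_quasi_def
    proof (intro ballI impI)
      interpret T: periodic_semigrp T m n using per[OF that] .
      fix \<phi> :: "nat \<Rightarrow> 'u" assume \<phi>: "\<phi> \<in> UNIV \<rightarrow> carrier T" and "\<forall>\<gamma>\<in>set ?\<Gamma>. holds_under T \<phi> \<gamma>"
      then show "holds_under T \<phi> ?\<epsilon>"
        using T.completely_zero_simple_quasi_identity[OF W[OF that] range_mem[OF \<phi>] range_mem[OF \<phi>], of 0 1]
        by (simp add: holds_under_def sg_eval_def)
    qed
    moreover have "\<forall>\<gamma>\<in>set ?\<Gamma>. proper_identity \<gamma>" "proper_identity ?\<epsilon>"
      by (simp_all add: proper_identity_def)
    ultimately have quasi: "satisfies_quasi S ?\<Gamma> ?\<epsilon>"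
      using S(1) unfolding VW qVar_def by blast
    define \<phi> :: "nat \<Rightarrow> 'u" where "\<phi> i = (if i = 0 then g Ea else g Eb)" for i
    note S0 = S0_products
    have \<phi>: "\<phi> \<in> UNIV \<rightarrow> carrier S" using hom_closed[OF g(1)] S0 by (simp add: \<phi>_def)
    have "\<forall>\<gamma>\<in>set ?\<Gamma>. holds_under S \<phi> \<gamma>"
      by (simp add: holds_under_def sg_eval_def \<phi>_def hom_mult[OF g(1), symmetric] S0)
    then have "holds_under S \<phi> ?\<epsilon>" using quasi \<phi> unfolding satisfies_quasi_def by blast
    then have "g Ec = g E0"
      by (simp add: holds_under_def sg_eval_def \<phi>_def hom_mult[OF g(1), symmetric] S0)
    then show False using g(2) S0(3,4) by (auto simp: inj_on_def)
  qed
  then have pow: "sg_pow T x (Suc n) = x" if "T \<in> W" "x \<in> carrier T" for T x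
    using non_completely_regular_imp_S0[OF V _ W[OF that(1)] per[OF that(1)] that(2)] that(1) WV by blast
  have laws_W: "satisfies_laws W n"
    unfolding satisfies_laws_def
  proof
    fix T assume T: "T \<in> W"
    have "satisfies_power_law T 1 n" using pow[OF T] by (simp add: satisfies_power_law_def)
    then interpret T: cr_semigrp T n using W_sg[OF T] mn(2) by unfold_locales auto
    show "satisfies_power_law T 1 n \<and> permutes_inner_factors T n"
      using T.cr_law T.completely_zero_simple_permutes[OF W[OF T]] by simp
  qed
  have transfer: "satisfies S \<epsilon>" if "S \<in> V" "proper_identity \<epsilon>" "\<forall>T\<in>W. satisfies T \<epsilon>" for S \<epsilon>
  proof -
    have nil: "satisfies_quasi U [] \<epsilon> \<longleftrightarrow> satisfies U \<epsilon>" for U :: "'u sgrp"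
      by (simp add: satisfies_quasi_def satisfies_def)
    have "\<forall>\<Gamma> \<epsilon>. (\<forall>\<gamma>\<in>set \<Gamma>. proper_identity \<gamma>) \<and> proper_identity \<epsilon> \<and>
        (\<forall>T\<in>W. satisfies_quasi T \<Gamma> \<epsilon>) \<longrightarrow> satisfies_quasi S \<Gamma> \<epsilon>"
      using that(1) unfolding VW qVar_def by simp
    from this[rule_format, of "[]" \<epsilon>] have "satisfies_quasi S [] \<epsilon>" using that(2,3) nil by simp
    then show ?thesis using nil by simp
  qed
  show ?thesis
    using laws_W satisfies_laws_iff_identities[of W n] satisfies_laws_iff_identities[of V n]
      W_sg variety_semigroup[OF V] mn(2) transfer
    by (simp add: proper_identity_def word_pow_eq_Nil)
qed

lemma laws_imp_qVar:
  fixes V :: "('u::infinite) sgrp set"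
  assumes V: "variety V" and laws: "satisfies_laws V n" "n > 0"
  shows "V = qVar {T \<in> V. completely_zero_simple T}" (is "V = qVar ?W")
proof
  show "V \<subseteq> qVar ?W"
  proof
    fix S assume S: "S \<in> V"
    interpret semigrp S using variety_semigroup[OF V S] by unfold_locales
    have appr: "approximated_by S ?W"
      using subdirect_imp_approximated laws_imp_subdirect[OF V laws S] by blast
    have "satisfies_quasi S \<Gamma> \<epsilon>" if quasi: "\<forall>T\<in>?W. satisfies_quasi T \<Gamma> \<epsilon>" for \<Gamma> \<epsilon>
      unfolding satisfies_quasi_def
    proof (intro ballI impI, rule ccontr)
      fix \<phi> :: "nat \<Rightarrow> 'u" assume \<phi>: "\<phi> \<in> UNIV \<rightarrow> carrier S" and prem: "\<forall>\<gamma>\<in>set \<Gamma>. holds_under S \<phi> \<gamma>"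
        and fail: "\<not> holds_under S \<phi> \<epsilon>"
      obtain p q where \<epsilon>: "\<epsilon> = (p, q)" by force
      have ne: "sg_eval S \<phi> p \<noteq> sg_eval S \<phi> q" using fail by (simp add: \<epsilon> holds_under_def)
      obtain T f where T: "T \<in> ?W" and f: "f \<in> sg_hom S T" "f (sg_eval S \<phi> p) \<noteq> f (sg_eval S \<phi> q)"
        using appr ne eval_closed[OF \<phi>] unfolding approximated_by_def by meson
      have eval: "sg_eval T (f \<circ> \<phi>) w = f (sg_eval S \<phi> w)" for w
        using hom_eval[OF semigroup f(1) \<phi>] by simp
      have "f \<circ> \<phi> \<in> UNIV \<rightarrow> carrier T" using hom_closed[OF f(1)] range_mem[OF \<phi>] by simp
      moreover have "\<forall>\<gamma>\<in>set \<Gamma>. holds_under T (f \<circ> \<phi>) \<gamma>"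
        using prem by (auto simp: holds_under_def eval)
      ultimately have "holds_under T (f \<circ> \<phi>) \<epsilon>"
        using quasi T unfolding satisfies_quasi_def by blast
      then show False using f(2) by (simp add: \<epsilon> holds_under_def eval)
    qed
    then show "S \<in> qVar ?W" using semigroup by (simp add: qVar_def)
  qed
next
  show "qVar ?W \<subseteq> V"
  proof
    fix S assume S: "S \<in> qVar ?W"
    show "S \<in> V"
    proof (rule variety_memI[OF V])
      show "is_semigroup S" using S by (simp add: qVar_def)
      fix p q :: sg_word assume pq: "p \<noteq> []" "q \<noteq> []" "holds_in V (p, q)"
      have "\<forall>\<Gamma> \<epsilon>. (\<forall>\<gamma>\<in>set \<Gamma>. proper_identity \<gamma>) \<and> proper_identity \<epsilon> \<and>
          (\<forall>T\<in>?W. satisfies_quasi T \<Gamma> \<epsilon>) \<longrightarrow> satisfies_quasi S \<Gamma> \<epsilon>"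
        using S unfolding qVar_def by simp
      from this[rule_format, of "[]" "(p, q)"] have "satisfies_quasi S [] (p, q)"
        using pq by (simp add: satisfies_quasi_def holds_in_def satisfies_def proper_identity_def)
      then show "satisfies S (p, q)" by (simp add: satisfies_quasi_def satisfies_def)
    qed
  qed
qed

text \<open>
  If \<open>N2\<close> is in \<open>V\<close>, its approximation needs a completely 0-simple member of \<open>V\<close> outside the
  completely regular ones, which brings \<open>S0\<close> into \<open>V\<close>; but \<open>S0\<close> cannot be approximated. So the
  members of \<open>V\<close> are completely regular, and approximable finite ones satisfy the permutation law,
  which fails in \<open>L21\<close> and \<open>R21\<close>.
\<close>

lemma finite_approximated_excludes:
  fixes V :: "('u::infinite) sgrp set"
  assumes V: "variety V" and mn: "m > 0" "n > 0" "\<And>S. S \<in> V \<Longrightarrow> satisfies_power_law S m n"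
    and appr: "\<And>S. S \<in> V \<Longrightarrow> finite (carrier S) \<Longrightarrow> approximated_by S {T\<in>V. completely_zero_simple T}"
  shows "\<not> contains_copy V N2 \<and> \<not> contains_copy V L21 \<and> \<not> contains_copy V R21"
proof -
  have per: "periodic_semigrp T m n" if "T \<in> V" for T
    using variety_semigroup[OF V that] mn that by unfold_locales auto
  have sep: "\<exists>T h. T \<in> V \<and> completely_zero_simple T \<and> h \<in> sg_hom U T \<and> h u \<noteq> h v"
    if copy: "contains_copy V U" and U: "finite (carrier U)" "u \<in> carrier U" "v \<in> carrier U" "u \<noteq> v"
    for U :: "elt sgrp" and u v
  proof -
    obtain S g where S: "S \<in> V" "is_semigroup S" and g: "g \<in> sg_hom U S" "bij_betw g (carrier U) (carrier S)"
      using contains_copyE[OF copy V] by blast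
    have "finite (carrier S)" using g(2) U(1) bij_betw_finite by blast
    moreover have "g u \<noteq> g v" "g u \<in> carrier S" "g v \<in> carrier S"
      using g(2) U by (auto simp: bij_betw_def inj_on_def)
    ultimately obtain T f where "T \<in> V" "completely_zero_simple T" "f \<in> sg_hom S T" "f (g u) \<noteq> f (g v)"
      using appr[OF S(1)] unfolding approximated_by_def by blast
    then show ?thesis using hom_comp[OF g(1)] by (metis comp_apply)
  qed
  have no_S0: "\<not> contains_copy V S0"
  proof
    assume "contains_copy V S0"
    from sep[OF this small_finite(2), of Ec E0] S0_products
    obtain T h where "T \<in> V" "completely_zero_simple T" "h \<in> sg_hom S0 T" "h Ec \<noteq> h E0" by auto
    then show False using S0_not_separated per by blast
  qed
  then have cr: "cr_semigrp T n" if T: "T \<in> V" "completely_zero_simple T" for T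
  proof -
    have "sg_pow T x (Suc n) = x" if "x \<in> carrier T" for x
      using non_completely_regular_imp_S0[OF V T per[OF T(1)] that] no_S0 by blast
    then have "satisfies_power_law T 1 n" by (simp add: satisfies_power_law_def)
    then show ?thesis using variety_semigroup[OF V T(1)] mn(2) by unfold_locales
  qed
  have "\<not> contains_copy V N2"
  proof
    have N2: "Ea \<in> carrier N2" "E0 \<in> carrier N2" "x \<odot>\<^bsub>N2\<^esub> y = E0" for x y by (simp_all add: N2_def)
    assume "contains_copy V N2"
    from sep[OF this small_finite(1) N2(1,2)]
    obtain T h where T: "T \<in> V" "completely_zero_simple T" and h: "h \<in> sg_hom N2 T" "h Ea \<noteq> h E0" by auto
    interpret T: cr_semigrp T n using cr[OF T] .
    have "h Ea = h E0"
      by (rule T.square_absorbing) (simp_all add: hom_closed[OF h(1)] hom_mult[OF h(1), symmetric] N2)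
    then show False using h(2) by simp
  qed
  moreover have "\<not> contains_copy V U" if U: "U = L21 \<or> U = R21" for U
  proof
    have mem: "finite (carrier U)" "Ee \<in> carrier U" "Ef \<in> carrier U" using U by (auto simp: L21_def R21_def)
    assume "contains_copy V U"
    from sep[OF this mem]
    obtain T h where T: "T \<in> V" "completely_zero_simple T" and h: "h \<in> sg_hom U T" "h Ee \<noteq> h Ef" by auto
    interpret T: cr_semigrp T n using cr[OF T] .
    show False
      using permutation_law_identifies[OF U T.semigroup T.completely_zero_simple_permutes[OF T(2)] h(1)] h(2)
      by simp
  qed
  ultimately show ?thesis by blast
qed

lemma laws_exclude_small:
  assumes V: "variety V" and laws: "satisfies_laws V n" "n > 0"
  shows "\<not> contains_copy V N2 \<and> \<not> contains_copy V S0 \<and>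
     \<not> contains_copy V S1l \<and> \<not> contains_copy V S2l \<and> \<not> contains_copy V S3l \<and>
     \<not> contains_copy V S1r \<and> \<not> contains_copy V S2r \<and> \<not> contains_copy V S3r \<and>
     \<not> contains_copy V L21 \<and> \<not> contains_copy V R21"
proof -
  have pow: "\<forall>S\<in>V. satisfies_power_law S 1 n" using laws by (simp add: satisfies_laws_def)
  note excl = power_law_excludes[OF V laws(2) pow]
  have "\<not> contains_copy V T" if T: "T \<in> {N2, S0, S1l, S2l, S1r, S2r}" for T
    using T by (intro excl[of Ea _ E0])
      (auto simp: N2_def S0_def S1l_def S2l_def S1r_def S2r_def sg_opposite_def)
  moreover have "\<not> contains_copy V T" if T: "T \<in> {S3l, S3r}" for T
    using T by (intro excl[of Ex _ Ee]) (auto simp: S3l_def S3r_def sg_opposite_def)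
  moreover have "\<not> contains_copy V T" if T: "T = L21 \<or> T = R21" for T
  proof (rule not_contains_copyI[OF V])
    fix S g assume S: "S \<in> V" "is_semigroup S" and g: "g \<in> sg_hom T S" "inj_on g (carrier T)"
    have "g Ee = g Ef"
      using permutation_law_identifies[OF T S(2) _ g(1), of n] laws(1) S(1) by (simp add: satisfies_laws_def)
    then show False using g(2) T by (auto simp: inj_on_def L21_def R21_def)
  qed
  ultimately show ?thesis by simp
qed

lemma excluded_imp_laws:
  fixes V :: "('u::infinite) sgrp set"
  assumes V: "variety V"
    and "\<not> contains_copy V N2" "\<not> contains_copy V L21" "\<not> contains_copy V R21"
  shows "\<exists>n>0. satisfies_laws V n"
proof -
  obtain n where n: "n > 0" "\<forall>S\<in>V. satisfies_power_law S 1 n"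
    using no_N2_imp_power_law[OF V assms(2)] by blast
  then show ?thesis
    using excluded_semigroups_imp_laws[OF V n assms(3,4)] by (auto simp: satisfies_laws_def)
qed

lemma laws_imp_rees_sushkevich:
  fixes V :: "('a::infinite) sgrp set"
  assumes V: "variety V" and laws: "satisfies_laws V n" "n > 0"
  shows "rees_sushkevich V"
proof -
  have *: "sg_eval S \<phi> [0, 0] = sg_eval S \<phi> (word_pow [0] (n + 2)) \<and>
      sg_eval S \<phi> [0, 1, 0] = sg_eval S \<phi> (word_pow [0, 1] (n + 1) @ [0]) \<and>
      sg_eval S \<phi> (word_pow [0, 3, 2] n @ [0, 1, 2]) = sg_eval S \<phi> ([0, 1, 2] @ word_pow [0, 3, 2] n)"
    if S: "S \<in> V" and \<phi>: "\<phi> \<in> UNIV \<rightarrow> carrier S" for S and \<phi> :: "nat \<Rightarrow> 'a"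
  proof (intro conjI)
    note cr = laws_cr_semigrp[OF laws S variety_semigroup[OF V S]]
    then interpret cr_semigrp S n by simp
    note c = range_mem[OF \<phi>]
    have pow: "sg_pow S x (n + 1) = x" if "x \<in> carrier S" for x using pow_periodic[OF that] by simp
    have "sg_pow S (\<phi> 0) (n + 2) = sg_pow S (\<phi> 0) (n + 1) \<odot>\<^bsub>S\<^esub> \<phi> 0" using exponent_pos by simp
    then show "sg_eval S \<phi> [0, 0] = sg_eval S \<phi> (word_pow [0] (n + 2))"
      using eval_word_pow[OF \<phi>, of "[0]" "n + 2"] pow[OF c] by (simp add: sg_eval_def del: sg_pow.simps)
    have "sg_eval S \<phi> (word_pow [0, 1] (n + 1)) = sg_eval S \<phi> [0, 1]"
      using eval_word_pow[OF \<phi>, of "[0, 1]" "n + 1"] pow[OF eval_closed[OF \<phi>]] by (simp del: sg_pow.simps)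
    then show "sg_eval S \<phi> [0, 1, 0] = sg_eval S \<phi> (word_pow [0, 1] (n + 1) @ [0])"
      using eval_snoc[of "word_pow [0, 1] (n + 1)" S \<phi> 0] eval_snoc[of "[0, 1]" S \<phi> 0]
      by (simp add: word_pow_eq_Nil)
    have "sg_eval S \<phi> (word_pow [0, 3, 2] n) = idm (\<phi> 0 \<odot>\<^bsub>S\<^esub> \<phi> 3 \<odot>\<^bsub>S\<^esub> \<phi> 2)"
      using eval_word_pow[OF \<phi> _ exponent_pos, of "[0, 3, 2]"] by (simp add: sg_eval_def)
    moreover have "sg_eval S \<phi> [0, 1, 2] = \<phi> 0 \<odot>\<^bsub>S\<^esub> \<phi> 1 \<odot>\<^bsub>S\<^esub> \<phi> 2" by (simp add: sg_eval_def)
    ultimately show "sg_eval S \<phi> (word_pow [0, 3, 2] n @ [0, 1, 2]) = sg_eval S \<phi> ([0, 1, 2] @ word_pow [0, 3, 2] n)"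
      using idm_commutes_same_ends[OF cr(2) c c c c] exponent_pos eval_append[OF \<phi>]
      by (simp add: word_pow_eq_Nil del: append_Cons)
  qed
  show ?thesis
    unfolding rees_sushkevich_def Let_def holds_in_iff
    using V laws(2) * by (intro conjI exI[of _ n]) auto
qed

text \<open>
  For \<open>x\<close> and \<open>z\<close> equal to the adjoined identity, the third Rees--Sushkevich identity says that \<open>h\<^sup>n\<close>
  commutes with \<open>y\<close>, which distinct left zeros or right zeros do not.
\<close>

lemma rees_sushkevich_excludes:
  assumes "rees_sushkevich V"
  shows "\<not> contains_copy V L21" "\<not> contains_copy V R21"
proof -
  have V: "variety V" using assms by (simp add: rees_sushkevich_def)
  obtain n where n: "n > 0"
    and id: "holds_in V (word_pow [0, 3, 2] n @ [0, 1, 2], [0, 1, 2] @ word_pow [0, 3, 2] n)"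
    using assms by (auto simp: rees_sushkevich_def Let_def)
  have "\<not> contains_copy V T" if T: "T = L21 \<or> T = R21" for T
  proof (rule not_contains_copyI[OF V])
    fix S g assume S: "S \<in> V" "is_semigroup S" and g: "g \<in> sg_hom T S" "inj_on g (carrier T)"
    interpret semigrp S using S(2) by unfold_locales
    have mem: "Ee \<in> carrier T" "Ef \<in> carrier T" "E1 \<in> carrier T" using T by (auto simp: L21_def R21_def)
    have mul: "E1 \<odot>\<^bsub>T\<^esub> x = x" "x \<odot>\<^bsub>T\<^esub> E1 = x" "Ee \<odot>\<^bsub>T\<^esub> Ee = Ee" for x
      using T by (auto simp: L21_def R21_def)
    define \<phi> :: "nat \<Rightarrow> _" where "\<phi> i = g (if i = 3 then Ee else if i = 1 then Ef else E1)" for i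
    have \<phi>: "\<phi> \<in> UNIV \<rightarrow> carrier S" using hom_closed[OF g(1)] mem by (simp add: \<phi>_def)
    have "sg_eval S \<phi> (word_pow [0, 3, 2] n) = g Ee"
      using eval_word_pow[OF \<phi> _ n, of "[0, 3, 2]"] pow_idempotent[of "g Ee"]
      by (simp add: sg_eval_def \<phi>_def hom_mult[OF g(1), symmetric] mem mul)
    moreover have "sg_eval S \<phi> [0, 1, 2] = g Ef"
      by (simp add: sg_eval_def \<phi>_def hom_mult[OF g(1), symmetric] mem mul)
    moreover have "sg_eval S \<phi> (word_pow [0, 3, 2] n @ [0, 1, 2]) = sg_eval S \<phi> ([0, 1, 2] @ word_pow [0, 3, 2] n)"
      using id S(1) \<phi> by (simp add: holds_in_iff)
    ultimately have "g Ee \<odot>\<^bsub>S\<^esub> g Ef = g Ef \<odot>\<^bsub>S\<^esub> g Ee"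
      using n eval_append[OF \<phi>] by (simp add: word_pow_eq_Nil del: append_Cons)
    then have "g (Ee \<odot>\<^bsub>T\<^esub> Ef) = g (Ef \<odot>\<^bsub>T\<^esub> Ee)" by (simp add: hom_mult[OF g(1)] mem)
    then have "g Ee = g Ef" using T by (auto simp: L21_def R21_def)
    then show False using g(2) mem by (auto simp: inj_on_def)
  qed
  then show "\<not> contains_copy V L21" "\<not> contains_copy V R21" by simp_all
qed

lemma finite_imp_finitely_generated:
  assumes "is_semigroup S" "finite (carrier S)"
  shows "finitely_generated S"
proof -
  interpret semigrp S using assms(1) by unfold_locales
  have "x \<in> carrier S" if "x \<in> sg_generated S (carrier S)" for x
    using that by induction auto
  then have "sg_generated S (carrier S) = carrier S" by (auto intro: sg_generated.gen)
  then show ?thesis using assms(2) by (auto simp: finitely_generated_def)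
qed

lemma all_equivalentI:
  assumes "list_all (\<lambda>P. P \<longleftrightarrow> C) Ps"
  shows "all_equivalent Ps"
  using assms by (auto simp: all_equivalent_def list_all_iff)

theorem theorem3:
  fixes V :: "('u::infinite) sgrp set"
  assumes "periodic_variety V"
  shows "all_equivalent
    [\<forall>F. free_in V F \<longrightarrow> subdirect_product_of F {T. completely_zero_simple T},
     \<forall>F. free_in V F \<and> finitely_generated F \<longrightarrow>
        subdirect_product_of F {T. completely_zero_simple T},
     \<forall>S\<in>V. subdirect_product_of S {T. completely_zero_simple T},
     \<forall>S\<in>V. finitely_generated S \<longrightarrow> approximated_by S {T\<in>V. completely_zero_simple T},
     \<forall>S\<in>V. finite (carrier S) \<longrightarrow> approximated_by S {T\<in>V. completely_zero_simple T},
     \<forall>S\<in>V. finite (carrier S) \<longrightarrow> subdirect_product_of S {T. completely_zero_simple T},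
     \<exists>W. (\<forall>T\<in>W. completely_zero_simple T) \<and> V = qVar W,
     rees_sushkevich V \<and> \<not> contains_copy V N2,
     \<exists>n>0. let a = 0; x = 1; y = 2; b = 3 in
        holds_in V ([x], word_pow [x] (n + 1)) \<and>
        holds_in V (word_pow [a, x, y, b] n, word_pow [a, y, x, b] n),
     \<forall>S\<in>V. normal_band_of_groups S,
     \<not> contains_copy V N2 \<and> \<not> contains_copy V S0 \<and>
     \<not> contains_copy V S1l \<and> \<not> contains_copy V S2l \<and> \<not> contains_copy V S3l \<and>
     \<not> contains_copy V S1r \<and> \<not> contains_copy V S2r \<and> \<not> contains_copy V S3r \<and>
     \<not> contains_copy V L21 \<and> \<not> contains_copy V R21]"
proof -
  let ?c0s = "{T :: 'u sgrp. completely_zero_simple T}"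
  let ?C = "\<exists>n>0. satisfies_laws V n"
  have V: "variety V" using assms by (simp add: periodic_variety_def)
  note sg = variety_semigroup[OF V]
  obtain m n where mn: "m > 0" "n > 0" "\<And>S. S \<in> V \<Longrightarrow> satisfies_power_law S m n"
    using periodic_variety_power_law[OF assms] by blast
  have per: "periodic_semigrp S m n" if "S \<in> V" for S
    using sg[OF that] mn that by unfold_locales auto
  have subdirect: "subdirect_product_of S {T \<in> V. completely_zero_simple T}" if ?C "S \<in> V" for S
    using laws_imp_subdirect[OF V] that by blast
  have subdirect': "subdirect_product_of S ?c0s" if ?C "S \<in> V" for S
    using subdirect_mono[OF subdirect[OF that], of ?c0s] by blast
  have finite_approx: ?C
    if "\<forall>S\<in>V. finite (carrier S) \<longrightarrow> approximated_by S {T\<in>V. completely_zero_simple T}"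
    using finite_approximated_excludes[OF V mn] that excluded_imp_laws[OF V] by blast
  have free_mem: "F \<in> V" if "free_in V F" for F
    using that by (auto simp: free_in_def free_on_def)
  have free: ?C if "\<forall>F. free_in V F \<and> finitely_generated F \<longrightarrow> subdirect_product_of F ?c0s"
    using free_subdirect_imp_laws[OF V mn] that mn(2) by blast
  have finite_subdirect: ?C if "\<forall>S\<in>V. finite (carrier S) \<longrightarrow> subdirect_product_of S ?c0s"
  proof (rule finite_approx, intro ballI impI)
    fix S assume "S \<in> V" "finite (carrier S)"
    then show "approximated_by S {T\<in>V. completely_zero_simple T}"
      using subdirect_imp_approximated[OF subdirect_in_variety[OF V, of S ?c0s]] that by simp
  qed
  have 1: "(\<forall>F. free_in V F \<longrightarrow> subdirect_product_of F ?c0s) \<longleftrightarrow> ?C"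
    using free subdirect' free_mem by blast
  have 2: "(\<forall>F. free_in V F \<and> finitely_generated F \<longrightarrow> subdirect_product_of F ?c0s) \<longleftrightarrow> ?C"
    using free subdirect' free_mem by blast
  have 3: "(\<forall>S\<in>V. subdirect_product_of S ?c0s) \<longleftrightarrow> ?C"
    using finite_subdirect subdirect' by blast
  have 4: "(\<forall>S\<in>V. finitely_generated S \<longrightarrow> approximated_by S {T\<in>V. completely_zero_simple T}) \<longleftrightarrow> ?C"
    using finite_approx finite_imp_finitely_generated[OF sg] subdirect subdirect_imp_approximated by blast
  have 5: "(\<forall>S\<in>V. finite (carrier S) \<longrightarrow> approximated_by S {T\<in>V. completely_zero_simple T}) \<longleftrightarrow> ?C"
    using finite_approx subdirect subdirect_imp_approximated by blast
  have 6: "(\<forall>S\<in>V. finite (carrier S) \<longrightarrow> subdirect_product_of S ?c0s) \<longleftrightarrow> ?C"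
    using finite_subdirect subdirect' by blast
  have 7: "(\<exists>W. (\<forall>T\<in>W. completely_zero_simple T) \<and> V = qVar W) \<longleftrightarrow> ?C"
  proof
    assume "\<exists>W. (\<forall>T\<in>W. completely_zero_simple T) \<and> V = qVar W"
    then obtain W where "\<forall>T\<in>W. completely_zero_simple T" "V = qVar W" by blast
    then show ?C using qVar_imp_laws[OF V mn, of W] mn(2) by blast
  next
    assume ?C
    then have "V = qVar {T \<in> V. completely_zero_simple T}" using laws_imp_qVar[OF V] by blast
    then show "\<exists>W. (\<forall>T\<in>W. completely_zero_simple T) \<and> V = qVar W"
      by (intro exI[of _ "{T \<in> V. completely_zero_simple T}"]) simp
  qed
  have small: "\<not> contains_copy V N2 \<and> \<not> contains_copy V S0 \<and>
     \<not> contains_copy V S1l \<and> \<not> contains_copy V S2l \<and> \<not> contains_copy V S3l \<and>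
     \<not> contains_copy V S1r \<and> \<not> contains_copy V S2r \<and> \<not> contains_copy V S3r \<and>
     \<not> contains_copy V L21 \<and> \<not> contains_copy V R21 \<longleftrightarrow> ?C"
    using laws_exclude_small[OF V] excluded_imp_laws[OF V] by blast
  have 8: "rees_sushkevich V \<and> \<not> contains_copy V N2 \<longleftrightarrow> ?C"
    using laws_imp_rees_sushkevich[OF V] rees_sushkevich_excludes excluded_imp_laws[OF V] small by blast
  have 9: "(\<exists>n>0. let a = 0; x = 1; y = 2; b = 3 in
        holds_in V ([x], word_pow [x] (n + 1)) \<and>
        holds_in V (word_pow [a, x, y, b] n, word_pow [a, y, x, b] n)) \<longleftrightarrow> ?C"
    using satisfies_laws_iff_identities[OF sg] unfolding Let_def holds_in_def by blast
  have 10: "(\<forall>S\<in>V. normal_band_of_groups S) \<longleftrightarrow> ?C"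
  proof
    assume "\<forall>S\<in>V. normal_band_of_groups S"
    then have "satisfies_laws V n"
      using periodic_semigrp.normal_band_of_groups_laws[OF per] by (simp add: satisfies_laws_def)
    then show ?C using mn(2) by blast
  next
    assume ?C
    then show "\<forall>S\<in>V. normal_band_of_groups S"
      using cr_semigrp.normal_band_of_groups[OF laws_cr_semigrp] sg by blast
  qed
  show ?thesis
    by (rule all_equivalentI[where C = ?C], simp only: list.pred_inject, intro conjI TrueI)
       (fact 1 2 3 4 5 6 7 8 9 10 small)+
qed

end
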